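(* Let $V$ be the ground model, let $\{C_\alpha:\alpha<\omega_1 \text{ limit}\}$ be a club guessing sequence in $V$, and let $f:\omega\to\omega$ be a strictly increasing function in $V$. Let $Q^f$ be the notion of forcing defined in the context. Then forcing with $Q^f$ adds a graph $X$ on $\omega_1$, namely the generic graph $X=\bigcup\{g:(s,u,g,m,h_i,c)\in G\}$ for generic $G\subseteq Q^f$, such that (in the generic extension) $X$ is uncountably chromatic, and for every $r<\omega$ every subgraph of $X$ on at most $f(r)$ vertices has chromatic number at most $2^{r+1}$.
   Context: A graph is a pair $(V,X)$ with $X\subseteq[V]^2$; it is often identified with its edge set $X$. The chromatic number $\mathrm{Chr}(X)$ is the least cardinal $\mu$ for which there is a coloring of the vertices with $\mu$ colors giving adjacent vertices different colors. A path of length $i$ is a sequence $v_0,\dots,v_i$ of distinct vertices with $\{v_k,v_{k+1}\}\in X$ for $k<i$. A circuit of length $n$ is a sequence of distinct vertices $v_1,\dots,v_n$ with consecutive vertices adjacent and $\{v_n,v_1\}\in X$. Club guessing sequence: each $C_\alpha$ is a set of order type $\omega$ cofinal in $\alpha$ ($\alpha<\omega_1$ limit), and for every closed unbounded $C\subseteq\omega_1$ there is $\alpha$ with $C_\alpha\subseteq C$. The forcing $Q^f$: a condition is $p=(s,u,g,m,h_i,c)$, where $s\in[\omega_1]^{<\omega}$; $u\subseteq s$ consists of limit ordinals; $g\subseteq[u]^2$ is a graph on $u$; $m:u\to\omega$; for each $\alpha\in u$ there are ordinals $h_0(\alpha)<\cdots<h_{m(\alpha)-1}(\alpha)<\alpha$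 which are $C_\alpha$-separated, i.e. $\min(C_\alpha)<h_0(\alpha)$ and between $h_i(\alpha)$ and $h_{i+1}(\alpha)$ there is an element of $C_\alpha$ ($h_i(\alpha)$ is undefined if $i\ge m(\alpha)$ or $\alpha\notin u$); $c:g\to\omega$ is such that if $\{x,\alpha\},\{y,\alpha\}\in g$ with $x\ne y$ and $x,y<\alpha$ then $c(x,\alpha)\ne c(y,\alpha)$. Put $Y^p_r=\{e\in g:c(e)\ge r\}$ for $r<\omega$. It is further required that for every $r<\omega$: (1) if $\alpha\in u$ is incident to some $e\in g$ with $c(e)\ge r$ then $m(\alpha)\ge r$; (2) if $x,y$ are connected in $Y^p_r$ by a path of length $i\ge1$, then $h_{j-i}(x)<h_j(y)<h_{j+i}(x)$ holds (in particular all these values are defined) for $i\le j\le f(r)-i$; (3) $Y^p_r$ contains no odd circuit of length $\le f(r)$. Ordering: $p'=(s',u',g',m',h'_i,c')$ extends $p=(s,u,g,m,h_i,c)$, written $p'\le p$, iff $s'\supseteq s$, $u=u'\cap s$, $g=g'\cap[s]^2$, $m'(\alpha)\ge m(\alpha)$ for $\alpha\in u$, $h'_i(\alpha)=h_i(\alpha)$ for $\alpha\in u$, $i<m(\alpha)$, and $c'(x,\alpha)=c(x,\alpha)$ for $\{x,\alpha\}\in g$. *)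

theory Defs
  imports "HOL-Library.Countable_Set_Type" "HOL-Library.FuncSet"
begin

section \<open>The first uncountable ordinal\<close>

text \<open>The type \<open>omega1\<close> is the set of countable ordinals. It is carved out of the cardinal
  successor of \<open>natLeq\<close>, which is a well-order; the lemmas below show that it is uncountable
  with countable proper initial segments, which determines it up to isomorphism.\<close>

typedef omega1 = "Field (cardSuc natLeq)"
proof -
  have "infinite (Field (cardSuc natLeq))"
    using cardSuc_finite[OF natLeq_Card_order] by (simp add: Field_natLeq)
  then show ?thesis using infinite_imp_nonempty by blast
qed

lemma omega1_Well_order: "Well_order (cardSuc natLeq)"
  by (rule cardSuc_Well_order[OF natLeq_Card_order])

instantiation omega1 :: wellorder
begin

definition less_eq_omega1 :: "omega1 \<Rightarrow> omega1 \<Rightarrow> bool" where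
  "x \<le> y \<longleftrightarrow> (Rep_omega1 x, Rep_omega1 y) \<in> cardSuc natLeq"

definition less_omega1 :: "omega1 \<Rightarrow> omega1 \<Rightarrow> bool" where
  "x < y \<longleftrightarrow> x \<le> y \<and> x \<noteq> (y :: omega1)"

instance
proof
  have lin: "linear_order_on (Field (cardSuc natLeq)) (cardSuc natLeq)"
    and wf: "wf (cardSuc natLeq - Id)"
    using omega1_Well_order by (auto simp: well_order_on_def)
  then have tr: "trans (cardSuc natLeq)" and rf: "refl_on (Field (cardSuc natLeq)) (cardSuc natLeq)"
    and as: "antisym (cardSuc natLeq)" and tot: "total_on (Field (cardSuc natLeq)) (cardSuc natLeq)"
    by (auto simp: order_on_defs)
  show refl: "x \<le> x" for x :: omega1
    using rf Rep_omega1[of x] by (auto simp: less_eq_omega1_def refl_on_def)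
  show "x \<le> z" if "x \<le> y" "y \<le> z" for x y z :: omega1
    using that tr by (auto simp: less_eq_omega1_def dest: transD)
  show anti: "x = y" if "x \<le> y" "y \<le> x" for x y :: omega1
    using that as by (auto simp: less_eq_omega1_def Rep_omega1_inject dest: antisymD)
  show "x < y \<longleftrightarrow> x \<le> y \<and> \<not> y \<le> x" for x y :: omega1
    using anti refl by (auto simp: less_omega1_def)
  show "x \<le> y \<or> y \<le> x" for x y :: omega1
    using tot refl Rep_omega1[of x] Rep_omega1[of y]
    by (cases "x = y") (auto simp: less_eq_omega1_def total_on_def Rep_omega1_inject)
  show "P a" if step: "\<And>x. (\<And>y. y < x \<Longrightarrow> P y) \<Longrightarrow> P x" for P and a :: omega1
  proof -
    have "wf (inv_image (cardSuc natLeq - Id) Rep_omega1)"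
      using wf by (rule wf_inv_image)
    then show ?thesis
    proof (induction a rule: wf_induct_rule)
      case (less x)
      show ?case
        by (rule step, rule less)
           (auto simp: less_omega1_def less_eq_omega1_def Rep_omega1_inject)
    qed
  qed
qed

end

lemma uncountable_omega1:
  includes cardinal_syntax
  shows "uncountable (UNIV :: omega1 set)"
proof
  assume "countable (UNIV :: omega1 set)"
  then have "countable (Rep_omega1 ` UNIV)" by (rule countable_image)
  also have "Rep_omega1 ` UNIV = Field (cardSuc natLeq)"
    by (rule type_definition.Rep_range[OF type_definition_omega1])
  finally have "|Field (cardSuc natLeq)| \<le>o natLeq"
    by (simp add: countable_card_le_natLeq)
  moreover have "natLeq <o |Field (cardSuc natLeq)|"
    using cardSuc_greater[OF natLeq_Card_order]
      card_of_Field_ordIso[OF cardSuc_Card_order[OF natLeq_Card_order]]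
      ordIso_symmetric ordLess_ordIso_trans by blast
  ultimately show False
    using not_ordLess_ordLeq by blast
qed

lemma countable_initial_segment_omega1:
  includes cardinal_syntax
  shows "countable {..<a :: omega1}"
proof -
  have "|underS (cardSuc natLeq) (Rep_omega1 a)| <o cardSuc natLeq"
    by (rule card_of_underS[OF cardSuc_Card_order[OF natLeq_Card_order] Rep_omega1])
  then have "countable (underS (cardSuc natLeq) (Rep_omega1 a))"
    unfolding countable_card_le_natLeq
    by (rule cardSuc_ordLeq_ordLess[OF natLeq_Card_order card_of_Card_order, THEN iffD1])
  moreover have "Rep_omega1 ` {..<a} \<subseteq> underS (cardSuc natLeq) (Rep_omega1 a)"
    by (auto simp: underS_def less_omega1_def less_eq_omega1_def Rep_omega1_inject)
  ultimately have "countable (Rep_omega1 ` {..<a})"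
    using countable_subset by blast
  then show ?thesis
    by (rule countable_image_inj_on) (simp add: inj_on_def Rep_omega1_inject)
qed


section \<open>Club guessing\<close>

definition limit_ordinal :: "omega1 \<Rightarrow> bool" where
  "limit_ordinal \<alpha> \<longleftrightarrow> (\<exists>\<beta>. \<beta> < \<alpha>) \<and> (\<forall>\<beta><\<alpha>. \<exists>\<gamma>. \<beta> < \<gamma> \<and> \<gamma> < \<alpha>)"

definition club :: "omega1 set \<Rightarrow> bool" where
  "club D \<longleftrightarrow> (\<forall>\<alpha>. \<exists>\<beta>\<in>D. \<alpha> < \<beta>) \<and>
     (\<forall>\<delta>. limit_ordinal \<delta> \<and> (\<forall>\<beta><\<delta>. \<exists>\<gamma>\<in>D. \<beta> < \<gamma> \<and> \<gamma> < \<delta>) \<longrightarrow> \<delta> \<in> D)"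

text \<open>Only the values of \<open>C\<close> at limit ordinals matter. The strictly increasing enumeration by
  the natural numbers says that the order type is \<open>\<omega>\<close>.\<close>

definition club_guessing :: "(omega1 \<Rightarrow> omega1 set) \<Rightarrow> bool" where
  "club_guessing C \<longleftrightarrow>
     (\<forall>\<alpha>. limit_ordinal \<alpha> \<longrightarrow>
        C \<alpha> \<subseteq> {..<\<alpha>} \<and> (\<forall>\<beta><\<alpha>. \<exists>\<gamma>\<in>C \<alpha>. \<beta> < \<gamma>) \<and>
        (\<exists>e :: nat \<Rightarrow> omega1. strict_mono e \<and> range e = C \<alpha>)) \<and>
     (\<forall>D. club D \<longrightarrow> (\<exists>\<alpha>. limit_ordinal \<alpha> \<and> C \<alpha> \<subseteq> D))"


section \<open>The notion of forcing\<close>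

definition edge_path :: "'a set set \<Rightarrow> 'a list \<Rightarrow> bool" where
  "edge_path X vs \<longleftrightarrow> vs \<noteq> [] \<and> distinct vs \<and> (\<forall>k. Suc k < length vs \<longrightarrow> {vs ! k, vs ! Suc k} \<in> X)"

definition connected_by_path :: "'a set set \<Rightarrow> nat \<Rightarrow> 'a \<Rightarrow> 'a \<Rightarrow> bool" where
  "connected_by_path X i x y \<longleftrightarrow>
     (\<exists>vs. edge_path X vs \<and> length vs = Suc i \<and> hd vs = x \<and> last vs = y)"

definition circuit :: "'a set set \<Rightarrow> 'a list \<Rightarrow> bool" where
  "circuit X vs \<longleftrightarrow> edge_path X vs \<and> {last vs, hd vs} \<in> X"

text \<open>The field \<open>h_of p i \<alpha>\<close> is \<open>h\<^sub>i(\<alpha>)\<close>, with \<open>None\<close> for an undefined value. The functions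
  \<open>m\<close> and \<open>c\<close> live on \<open>u\<close> and \<open>g\<close>; they are total in HOL and are made extensional below,
  so that distinct records are distinct conditions.\<close>

record cond =
  s_of :: "omega1 set"
  u_of :: "omega1 set"
  g_of :: "omega1 set set"
  m_of :: "omega1 \<Rightarrow> nat"
  h_of :: "nat \<Rightarrow> omega1 \<Rightarrow> omega1 option"
  c_of :: "omega1 set \<Rightarrow> nat"

definition Y_of :: "cond \<Rightarrow> nat \<Rightarrow> omega1 set set" where
  "Y_of p r = {e \<in> g_of p. c_of p e \<ge> r}"

definition h_separated :: "(omega1 \<Rightarrow> omega1 set) \<Rightarrow> cond \<Rightarrow> omega1 \<Rightarrow> bool" where
  "h_separated C p \<alpha> \<longleftrightarrow>
     (\<forall>i a. h_of p i \<alpha> = Some a \<longrightarrow> a < \<alpha>) \<and>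
     (\<forall>a. h_of p 0 \<alpha> = Some a \<longrightarrow> (LEAST \<gamma>. \<gamma> \<in> C \<alpha>) < a) \<and>
     (\<forall>i a b. h_of p i \<alpha> = Some a \<and> h_of p (Suc i) \<alpha> = Some b \<longrightarrow>
        a < b \<and> (\<exists>\<gamma>\<in>C \<alpha>. a < \<gamma> \<and> \<gamma> < b))"

definition h_interleaved :: "cond \<Rightarrow> nat \<Rightarrow> nat \<Rightarrow> omega1 \<Rightarrow> omega1 \<Rightarrow> bool" where
  "h_interleaved p i j x y \<longleftrightarrow>
     (\<exists>a b d. h_of p (j - i) x = Some a \<and> h_of p j y = Some b \<and> h_of p (j + i) x = Some d \<and>
        a < b \<and> b < d)"

definition Qf :: "(omega1 \<Rightarrow> omega1 set) \<Rightarrow> (nat \<Rightarrow> nat) \<Rightarrow> cond set" where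
  "Qf C f = {p.
     finite (s_of p) \<and> u_of p \<subseteq> s_of p \<and> (\<forall>\<alpha>\<in>u_of p. limit_ordinal \<alpha>) \<and>
     (\<forall>e\<in>g_of p. e \<subseteq> u_of p \<and> card e = 2) \<and>
     m_of p \<in> u_of p \<rightarrow>\<^sub>E UNIV \<and>
     (\<forall>i \<alpha>. h_of p i \<alpha> = None \<longleftrightarrow> \<alpha> \<notin> u_of p \<or> i \<ge> m_of p \<alpha>) \<and>
     (\<forall>\<alpha>\<in>u_of p. h_separated C p \<alpha>) \<and>
     c_of p \<in> g_of p \<rightarrow>\<^sub>E UNIV \<and>
     (\<forall>x y \<alpha>. {x, \<alpha>} \<in> g_of p \<and> {y, \<alpha>} \<in> g_of p \<and> x \<noteq> y \<and> x < \<alpha> \<and> y < \<alpha> \<longrightarrow>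
        c_of p {x, \<alpha>} \<noteq> c_of p {y, \<alpha>}) \<and>
     (\<forall>r.
        (\<forall>\<alpha>\<in>u_of p. (\<exists>e\<in>g_of p. \<alpha> \<in> e \<and> c_of p e \<ge> r) \<longrightarrow> m_of p \<alpha> \<ge> r) \<and>
        (\<forall>i x y. i \<ge> 1 \<and> connected_by_path (Y_of p r) i x y \<longrightarrow>
           (\<forall>j. i \<le> j \<and> j + i \<le> f r \<longrightarrow> h_interleaved p i j x y)) \<and>
        (\<forall>vs. circuit (Y_of p r) vs \<and> odd (length vs) \<longrightarrow> \<not> length vs \<le> f r))}"

definition extends :: "cond \<Rightarrow> cond \<Rightarrow> bool" where
  "extends p' p \<longleftrightarrow>
     s_of p \<subseteq> s_of p' \<and> u_of p = u_of p' \<inter> s_of p \<and>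
     g_of p = {e \<in> g_of p'. e \<subseteq> s_of p} \<and>
     (\<forall>\<alpha>\<in>u_of p. m_of p \<alpha> \<le> m_of p' \<alpha> \<and> (\<forall>i<m_of p \<alpha>. h_of p' i \<alpha> = h_of p i \<alpha>)) \<and>
     (\<forall>e\<in>g_of p. c_of p' e = c_of p e)"

definition top_cond :: cond where
  "top_cond = \<lparr>s_of = {}, u_of = {}, g_of = {}, m_of = (\<lambda>_. undefined),
     h_of = (\<lambda>_ _. None), c_of = (\<lambda>_. undefined)\<rparr>"


section \<open>Names and the forcing relation\<close>

text \<open>A name is a set of pairs (name, condition). HOL has no set of all sets of names, so the sets
  are indexed by a type \<open>'i\<close>: the type consists of the names that hereditarily have at most
  \<open>|'i|\<close> elements. If \<open>omega1\<close> embeds into \<open>'i\<close>, then these include names for all sets of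
  hereditary size at most \<open>\<aleph>\<^sub>1\<close> in the extension, hence for all colorings of graphs on \<open>\<omega>\<^sub>1\<close>.\<close>

datatype ('i, 'p) name = Name "'i \<Rightarrow> (('i, 'p) name \<times> 'p) option"

primrec name_elems :: "('i, 'p) name \<Rightarrow> (('i, 'p) name \<times> 'p) set" where
  "name_elems (Name F) = ran F"

text \<open>This is meaningful for sets of at most \<open>|'i|\<close> pairs, see the lemma.\<close>

definition name_of_set :: "(('i, 'p) name \<times> 'p) set \<Rightarrow> ('i, 'p) name" where
  "name_of_set S = (SOME x. name_elems x = S)"

lemma name_elems_name_of_set:
  fixes S :: "(('i, 'p) name \<times> 'p) set" and k :: "('i, 'p) name \<times> 'p \<Rightarrow> 'i"
  assumes "inj_on k S"
  shows "name_elems (name_of_set S) = S"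
proof -
  let ?F = "\<lambda>i. if i \<in> k ` S then Some (inv_into S k i) else None"
  have "ran ?F = inv_into S k ` k ` S" unfolding ran_def by (simp add: image_def) blast
  also have "\<dots> = S" using assms by (simp add: image_comp cong: image_cong)
  finally have "ran ?F = S" .
  then have "name_elems (Name ?F) = S" by simp
  then show ?thesis unfolding name_of_set_def by (rule someI)
qed

definition name_child :: "(('i, 'p) name \<times> ('i, 'p) name) set" where
  "name_child = {(z, x). z \<in> fst ` name_elems x}"

lemma wf_name_child: "wf name_child"
proof (rule wfUNIVI)
  fix P :: "('i, 'p) name \<Rightarrow> bool" and x
  assume step: "\<forall>x. (\<forall>y. (y, x) \<in> name_child \<longrightarrow> P y) \<longrightarrow> P x"
  show "P x"
  proof (induction x)
    case (Name F)
    have "P y" if "(y, Name F) \<in> name_child" for y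
    proof -
      from that obtain i q where "F i = Some (y, q)"
        by (auto simp: name_child_def ran_def)
      then have "Some (y, q) \<in> range F" by (metis rangeI)
      then show ?thesis
        by (rule Name[of "Some (y, q)" "(y, q)" y]) (auto simp: fsts.simps)
    qed
    with step show ?case by blast
  qed
qed

text \<open>The forcing relation for equality: every element of either name is forced to belong to the
  other one, where \<open>z\<close> is forced to belong to \<open>y\<close> if densely often it is forced to be equal to
  some element of \<open>y\<close>. In the second half the arguments of the recursive call are exchanged so
  that the recursion is on the first argument; forced equality is symmetric.
  Pairs whose second component is not in \<open>P\<close> are ignored, so every name acts as a \<open>P\<close>-name.\<close>

function forces_eq ::
  "'p set \<Rightarrow> ('p \<Rightarrow> 'p \<Rightarrow> bool) \<Rightarrow> 'p \<Rightarrow> ('i, 'p) name \<Rightarrow> ('i, 'p) name \<Rightarrow> bool" where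
  "forces_eq P le p x y \<longleftrightarrow>
     (\<forall>(z, s)\<in>name_elems x. \<forall>q\<in>P. le q p \<and> le q s \<and> s \<in> P \<longrightarrow>
        (\<exists>r\<in>P. le r q \<and> (\<exists>(w, t)\<in>name_elems y. le r t \<and> t \<in> P \<and> forces_eq P le r z w))) \<and>
     (\<forall>(w, t)\<in>name_elems y. \<forall>q\<in>P. le q p \<and> le q t \<and> t \<in> P \<longrightarrow>
        (\<exists>r\<in>P. le r q \<and> (\<exists>(z, s)\<in>name_elems x. le r s \<and> s \<in> P \<and> forces_eq P le r z w)))"
  by pat_completeness auto
termination
  by (relation "inv_image name_child (\<lambda>(P, le, p, x, y). x)")
     (use wf_name_child in \<open>auto simp: name_child_def image_iff intro: bexI[rotated]\<close>)

definition forces_mem ::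
  "'p set \<Rightarrow> ('p \<Rightarrow> 'p \<Rightarrow> bool) \<Rightarrow> 'p \<Rightarrow> ('i, 'p) name \<Rightarrow> ('i, 'p) name \<Rightarrow> bool" where
  "forces_mem P le p x y \<longleftrightarrow>
     (\<forall>q\<in>P. le q p \<longrightarrow>
        (\<exists>r\<in>P. le r q \<and> (\<exists>(w, t)\<in>name_elems y. le r t \<and> t \<in> P \<and> forces_eq P le r x w)))"

text \<open>The sentences of the forcing language: the language of set theory with the names as
  constants. A quantifier binds by a function on names.\<close>

datatype 'n sentence =
    Mem 'n 'n  (infix "\<^bold>\<in>" 60)
  | Eq 'n 'n  (infix "\<^bold>=" 60)
  | Neg "'n sentence"  ("\<^bold>\<not> _" [50] 50)
  | Conj "'n sentence" "'n sentence"  (infixr "\<^bold>\<and>" 45)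
  | All "'n \<Rightarrow> 'n sentence"  (binder "\<^bold>\<forall>" 10)

primrec forces ::
  "'p set \<Rightarrow> ('p \<Rightarrow> 'p \<Rightarrow> bool) \<Rightarrow> ('i, 'p) name sentence \<Rightarrow> 'p \<Rightarrow> bool" where
  "forces P le (x \<^bold>\<in> y) = (\<lambda>p. forces_mem P le p x y)"
| "forces P le (x \<^bold>= y) = (\<lambda>p. forces_eq P le p x y)"
| "forces P le (\<^bold>\<not> A) = (\<lambda>p. \<forall>q\<in>P. le q p \<longrightarrow> \<not> forces P le A q)"
| "forces P le (A \<^bold>\<and> B) = (\<lambda>p. forces P le A p \<and> forces P le B p)"
| "forces P le (All \<Phi>) = (\<lambda>p. \<forall>x. forces P le (\<Phi> x) p)"

text \<open>A sentence holds in every generic extension iff every condition forces it.\<close>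

definition holds_in_extension ::
  "'p set \<Rightarrow> ('p \<Rightarrow> 'p \<Rightarrow> bool) \<Rightarrow> ('i, 'p) name sentence \<Rightarrow> bool" where
  "holds_in_extension P le A \<longleftrightarrow> (\<forall>p\<in>P. forces P le A p)"

definition Disj :: "'n sentence \<Rightarrow> 'n sentence \<Rightarrow> 'n sentence"  (infixr "\<^bold>\<or>" 40) where
  "A \<^bold>\<or> B \<equiv> \<^bold>\<not> (\<^bold>\<not> A \<^bold>\<and> \<^bold>\<not> B)"

definition Imp :: "'n sentence \<Rightarrow> 'n sentence \<Rightarrow> 'n sentence"  (infixr "\<^bold>\<longrightarrow>" 35) where
  "A \<^bold>\<longrightarrow> B \<equiv> \<^bold>\<not> (A \<^bold>\<and> \<^bold>\<not> B)"

definition Iff :: "'n sentence \<Rightarrow> 'n sentence \<Rightarrow> 'n sentence"  (infixr "\<^bold>\<longleftrightarrow>" 35) where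
  "A \<^bold>\<longleftrightarrow> B \<equiv> (A \<^bold>\<longrightarrow> B) \<^bold>\<and> (B \<^bold>\<longrightarrow> A)"

definition Ex :: "('n \<Rightarrow> 'n sentence) \<Rightarrow> 'n sentence"  (binder "\<^bold>\<exists>" 10) where
  "Ex \<Phi> \<equiv> \<^bold>\<not> (\<^bold>\<forall>x. \<^bold>\<not> \<Phi> x)"


section \<open>Set theory in the forcing language\<close>

definition is_subset :: "'n \<Rightarrow> 'n \<Rightarrow> 'n sentence" where
  "is_subset a b \<equiv> (\<^bold>\<forall>x. x \<^bold>\<in> a \<^bold>\<longrightarrow> x \<^bold>\<in> b)"

definition is_upair :: "'n \<Rightarrow> 'n \<Rightarrow> 'n \<Rightarrow> 'n sentence" where
  "is_upair z x y \<equiv> (\<^bold>\<forall>w. w \<^bold>\<in> z \<^bold>\<longleftrightarrow> w \<^bold>= x \<^bold>\<or> w \<^bold>= y)"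

definition is_opair :: "'n \<Rightarrow> 'n \<Rightarrow> 'n \<Rightarrow> 'n sentence" where
  "is_opair z x y \<equiv> (\<^bold>\<exists>a. \<^bold>\<exists>b. is_upair a x x \<^bold>\<and> is_upair b x y \<^bold>\<and> is_upair z a b)"

definition maps_to :: "'n \<Rightarrow> 'n \<Rightarrow> 'n \<Rightarrow> 'n sentence" where
  "maps_to F x y \<equiv> (\<^bold>\<exists>z. is_opair z x y \<^bold>\<and> z \<^bold>\<in> F)"

definition is_function :: "'n \<Rightarrow> 'n \<Rightarrow> 'n \<Rightarrow> 'n sentence" where
  "is_function F A B \<equiv>
     (\<^bold>\<forall>z. z \<^bold>\<in> F \<^bold>\<longrightarrow> (\<^bold>\<exists>x. \<^bold>\<exists>y. x \<^bold>\<in> A \<^bold>\<and> y \<^bold>\<in> B \<^bold>\<and> is_opair z x y)) \<^bold>\<and>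
     (\<^bold>\<forall>x. x \<^bold>\<in> A \<^bold>\<longrightarrow> (\<^bold>\<exists>y. maps_to F x y)) \<^bold>\<and>
     (\<^bold>\<forall>x. \<^bold>\<forall>y. \<^bold>\<forall>y'. maps_to F x y \<^bold>\<and> maps_to F x y' \<^bold>\<longrightarrow> y \<^bold>= y')"

definition is_injection :: "'n \<Rightarrow> 'n \<Rightarrow> 'n \<Rightarrow> 'n sentence" where
  "is_injection F A B \<equiv> is_function F A B \<^bold>\<and>
     (\<^bold>\<forall>x. \<^bold>\<forall>x'. \<^bold>\<forall>y. maps_to F x y \<^bold>\<and> maps_to F x' y \<^bold>\<longrightarrow> x \<^bold>= x')"

definition is_bijection :: "'n \<Rightarrow> 'n \<Rightarrow> 'n \<Rightarrow> 'n sentence" where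
  "is_bijection F A B \<equiv> is_injection F A B \<^bold>\<and> (\<^bold>\<forall>y. y \<^bold>\<in> B \<^bold>\<longrightarrow> (\<^bold>\<exists>x. maps_to F x y))"

definition embeds :: "'n \<Rightarrow> 'n \<Rightarrow> 'n sentence" where
  "embeds A B \<equiv> (\<^bold>\<exists>F. is_injection F A B)"

text \<open>Well-foundedness of \<open>\<in>\<close> is part of the axioms of set theory, so it is not repeated.\<close>

definition is_ordinal :: "'n \<Rightarrow> 'n sentence" where
  "is_ordinal a \<equiv>
     (\<^bold>\<forall>x. x \<^bold>\<in> a \<^bold>\<longrightarrow> is_subset x a) \<^bold>\<and>
     (\<^bold>\<forall>x. \<^bold>\<forall>y. x \<^bold>\<in> a \<^bold>\<and> y \<^bold>\<in> a \<^bold>\<longrightarrow> x \<^bold>\<in> y \<^bold>\<or> x \<^bold>= y \<^bold>\<or> y \<^bold>\<in> x)"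

definition is_cardinal :: "'n \<Rightarrow> 'n sentence" where
  "is_cardinal a \<equiv> is_ordinal a \<^bold>\<and> (\<^bold>\<forall>b. b \<^bold>\<in> a \<^bold>\<longrightarrow> \<^bold>\<not> (\<^bold>\<exists>F. is_bijection F b a))"

definition is_graph :: "'n \<Rightarrow> 'n \<Rightarrow> 'n sentence" where
  "is_graph W X \<equiv>
     (\<^bold>\<forall>e. e \<^bold>\<in> X \<^bold>\<longrightarrow> (\<^bold>\<exists>x. \<^bold>\<exists>y. x \<^bold>\<in> W \<^bold>\<and> y \<^bold>\<in> W \<^bold>\<and> \<^bold>\<not> (x \<^bold>= y) \<^bold>\<and> is_upair e x y))"

definition is_subgraph :: "'n \<Rightarrow> 'n \<Rightarrow> 'n \<Rightarrow> 'n \<Rightarrow> 'n sentence" where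
  "is_subgraph W Y V X \<equiv> is_graph W Y \<^bold>\<and> is_subset W V \<^bold>\<and> is_subset Y X"

definition is_coloring :: "'n \<Rightarrow> 'n \<Rightarrow> 'n \<Rightarrow> 'n \<Rightarrow> 'n sentence" where
  "is_coloring F W X K \<equiv> is_function F W K \<^bold>\<and>
     (\<^bold>\<forall>e. \<^bold>\<forall>x. \<^bold>\<forall>y. \<^bold>\<forall>k. \<^bold>\<forall>l. e \<^bold>\<in> X \<^bold>\<and> is_upair e x y \<^bold>\<and> maps_to F x k \<^bold>\<and> maps_to F y l \<^bold>\<longrightarrow>
        \<^bold>\<not> (k \<^bold>= l))"

definition colorable :: "'n \<Rightarrow> 'n \<Rightarrow> 'n \<Rightarrow> 'n sentence" where
  "colorable W X K \<equiv> (\<^bold>\<exists>F. is_coloring F W X K)"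

definition is_Chr :: "'n \<Rightarrow> 'n \<Rightarrow> 'n \<Rightarrow> 'n sentence" where
  "is_Chr W X \<mu> \<equiv> is_cardinal \<mu> \<^bold>\<and> colorable W X \<mu> \<^bold>\<and>
     (\<^bold>\<forall>\<nu>. \<nu> \<^bold>\<in> \<mu> \<^bold>\<longrightarrow> \<^bold>\<not> (is_cardinal \<nu> \<^bold>\<and> colorable W X \<nu>))"

text \<open>In the remaining definitions \<open>w\<close> stands for the set \<open>\<omega>\<close>.\<close>

definition is_countable :: "'n \<Rightarrow> 'n \<Rightarrow> 'n sentence" where
  "is_countable w a \<equiv> embeds a w"

definition is_first_uncountable :: "'n \<Rightarrow> 'n \<Rightarrow> 'n sentence" where
  "is_first_uncountable w a \<equiv> is_ordinal a \<^bold>\<and> \<^bold>\<not> is_countable w a \<^bold>\<and>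
     (\<^bold>\<forall>b. b \<^bold>\<in> a \<^bold>\<longrightarrow> is_countable w b)"

definition uncountably_chromatic :: "'n \<Rightarrow> 'n \<Rightarrow> 'n \<Rightarrow> 'n sentence" where
  "uncountably_chromatic w W X \<equiv> (\<^bold>\<exists>\<mu>. is_Chr W X \<mu> \<^bold>\<and> \<^bold>\<not> is_countable w \<mu>)"

definition Chr_at_most :: "'n \<Rightarrow> 'n \<Rightarrow> 'n \<Rightarrow> 'n sentence" where
  "Chr_at_most W X \<kappa> \<equiv> (\<^bold>\<exists>\<mu>. is_Chr W X \<mu> \<^bold>\<and> (\<mu> \<^bold>\<in> \<kappa> \<^bold>\<or> \<mu> \<^bold>= \<kappa>))"


section \<open>Names for ground model sets and for the generic graph\<close>

text \<open>\<open>check_ord one \<alpha>\<close> is the canonical name of the von Neumann ordinal \<open>\<alpha>\<close>, where \<open>one\<close> is the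
  greatest condition. It is used for \<open>\<alpha> :: nat\<close> and \<open>\<alpha> :: omega1\<close>.\<close>

function check_ord :: "'p \<Rightarrow> 'o::wellorder \<Rightarrow> ('i, 'p) name" where
  "check_ord one \<alpha> = name_of_set ((\<lambda>\<beta>. (check_ord one \<beta>, one)) ` {..<\<alpha>})"
  by pat_completeness auto
termination
  by (relation "inv_image {(\<beta>, \<alpha>). \<beta> < \<alpha>} snd") (auto simp: wf)

definition check_ords :: "'p \<Rightarrow> 'o::wellorder set \<Rightarrow> ('i, 'p) name" where
  "check_ords one A = name_of_set ((\<lambda>\<alpha>. (check_ord one \<alpha>, one)) ` A)"

definition omega_name :: "('i, cond) name" where
  "omega_name = check_ords top_cond (UNIV :: nat set)"

definition omega1_name :: "('i, cond) name" where
  "omega1_name = check_ords top_cond (UNIV :: omega1 set)"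

text \<open>For a generic filter \<open>G\<close> this name is evaluated to the union of the graphs \<open>g\<close> of the
  conditions in \<open>G\<close>.\<close>

definition generic_graph :: "(omega1 \<Rightarrow> omega1 set) \<Rightarrow> (nat \<Rightarrow> nat) \<Rightarrow> ('i, cond) name" where
  "generic_graph C f = name_of_set {(check_ords top_cond e, p) | e p. p \<in> Qf C f \<and> e \<in> g_of p}"

end

theory Submission
  imports Defs
begin

text \<open>
  Requirement (2) is transitive: the inequalities for single edges add up along a walk. So a
  condition only has to satisfy it for edges, and (3) may be read as a statement about odd closed
  walks, which homomorphisms carry from one graph to another. This is \<open>Qf_iff\<close>.

  \<^emph>\<open>Small subgraphs.\<close> In a condition, the edges of a fixed color \<open>i < r\<close> form a forest, since every
  vertex has at most one smaller neighbor along them, and the graph \<open>Y\<^sub>r\<close> of the remaining edges has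
  no odd circuit on at most \<open>f r\<close> vertices. These \<open>r + 1\<close> graphs are bipartite, so \<open>r + 1\<close> bits
  color their union (\<open>condition_coloring\<close>). In the extension, a subgraph on at most \<open>f r\<close> vertices is
  finite, hence some condition decides its vertices and edges, and its chromatic number is the one
  that the ground model computes (\<open>finite_subgraph_Chr\<close>).

  \<^emph>\<open>Uncountable chromatic number.\<close> The main step is \<open>same_value_on_edge\<close>: if every condition has, for
  every \<open>\<alpha>\<close>, an extension that decides a value \<open>n < \<omega>\<close> for \<open>\<alpha>\<close>, then some condition has an edge \<open>{x, \<alpha>}\<close>
  and decides the same value for \<open>x\<close> and \<open>\<alpha>\<close>. Choose \<open>\<alpha>\<close> such that \<open>C\<^sub>\<alpha>\<close> consists of closure points of
  suitable Skolem functions, let \<open>q\<^sub>2\<close> decide the value of \<open>\<alpha>\<close>, let \<open>r\<close> exceed all colors in \<open>q\<^sub>2\<close>, and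
  make sure that \<open>h\<^sub>i(\<alpha>)\<close> is defined for \<open>i \<le> f r\<close>. As the elements of \<open>C\<^sub>\<alpha>\<close> separate the ordinals
  \<open>h\<^sub>i(\<alpha>)\<close>, the condition \<open>q\<^sub>2\<close> can be reflected block by block (\<open>reflection\<close>) to a copy \<open>q\<^sub>1\<close> over its
  part below \<open>min C\<^sub>\<alpha>\<close>, with \<open>x\<close> in the place of \<open>\<alpha>\<close>, such that
  \<open>h\<^sub>0(x) < h\<^sub>0(\<alpha>) < h\<^sub>1(x) < h\<^sub>1(\<alpha>) < \<dots> < x < \<alpha>\<close>. The union of \<open>q\<^sub>1\<close> and \<open>q\<^sub>2\<close> with the new edge
  \<open>{x, \<alpha>}\<close> of color \<open>r\<close> is a condition (locale \<open>amalgamation\<close>): an odd closed walk that avoids the new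
  edge folds to one in \<open>q\<^sub>2\<close>, and a short circuit through the new edge would give a short walk in \<open>q\<^sub>2\<close>
  from \<open>\<alpha>\<close> to a vertex \<open>d\<close> below \<open>min C\<^sub>\<alpha>\<close>, which (2) forbids because it implies \<open>h\<^sub>0(\<alpha>) < d\<close>.

  A name for a function from \<open>\<omega>\<^sub>1\<close> to a countable ordinal, or from a countable ordinal onto \<open>\<omega>\<^sub>1\<close>, yields
  such decided values. Hence \<open>\<omega>\<^sub>1\<close> stays the first uncountable ordinal and a cardinal, the generic graph
  has no coloring with countably many colors, and its chromatic number is \<open>\<omega>\<^sub>1\<close>.
\<close>

section \<open>Rules for the forcing relation\<close>

(* The right-hand side contains an instance of the left-hand side under a binder, so as a
   rewrite rule this equation loops. *)
declare forces_eq.simps [simp del]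

locale forcing_notion =
  fixes P :: "'p set" and le :: "'p \<Rightarrow> 'p \<Rightarrow> bool" and one :: 'p
  assumes le_refl: "p \<in> P \<Longrightarrow> le p p"
    and le_trans: "le r q \<Longrightarrow> le q p \<Longrightarrow> le r p"
    and one_in: "one \<in> P" and le_one: "p \<in> P \<Longrightarrow> le p one"
begin

definition below :: "'p \<Rightarrow> 'p set" where "below p = {q \<in> P. le q p}"

definition elems :: "('i, 'p) name \<Rightarrow> (('i, 'p) name \<times> 'p) set" where
  "elems x = {(z, s) \<in> name_elems x. s \<in> P}"

abbreviation fc :: "'p \<Rightarrow> ('i, 'p) name sentence \<Rightarrow> bool"  (infix "\<tturnstile>" 49) where
  "p \<tturnstile> A \<equiv> forces P le A p"

lemma below_refl: "p \<in> P \<Longrightarrow> p \<in> below p" by (simp add: below_def le_refl)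
lemma below_trans: "r \<in> below q \<Longrightarrow> q \<in> below p \<Longrightarrow> r \<in> below p"
  using le_trans by (auto simp: below_def)
lemma below_P: "q \<in> below p \<Longrightarrow> q \<in> P" by (simp add: below_def)
lemma below_one: "p \<in> P \<Longrightarrow> p \<in> below one" by (simp add: below_def le_one)

text \<open>One half of forced equality. The two halves differ in the order of the arguments of the recursive
  call; the parameter \<open>R\<close> hides this difference, so that one proof serves for both.\<close>
definition covered ::
  "'p \<Rightarrow> ('i, 'p) name \<Rightarrow> ('i, 'p) name \<Rightarrow> ('p \<Rightarrow> ('i, 'p) name \<Rightarrow> ('i, 'p) name \<Rightarrow> bool) \<Rightarrow> bool" where
  "covered p x y R \<longleftrightarrow> (\<forall>(z, s)\<in>elems x. \<forall>q\<in>below p \<inter> below s.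
     \<exists>r\<in>below q. \<exists>(w, t)\<in>elems y. r \<in> below t \<and> R r z w)"

lemma coveredE:
  assumes "covered p x y R" "(z, s) \<in> elems x" "q \<in> below p" "q \<in> below s"
  obtains r w t where "r \<in> below q" "(w, t) \<in> elems y" "r \<in> below t" "R r z w"
  using assms unfolding covered_def by fast

lemma coveredI:
  assumes "\<And>z s q. (z, s) \<in> elems x \<Longrightarrow> q \<in> below p \<Longrightarrow> q \<in> below s \<Longrightarrow>
    \<exists>r\<in>below q. \<exists>(w, t)\<in>elems y. r \<in> below t \<and> R r z w"
  shows "covered p x y R"
  using assms unfolding covered_def by blast

lemma covered_mono: "covered p x y R \<Longrightarrow> q \<in> below p \<Longrightarrow> covered q x y R"
  unfolding covered_def using below_trans by blast

lemma covered_weaken: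
  assumes c: "covered p x y R"
    and R: "\<And>r z s w t. (z, s) \<in> elems x \<Longrightarrow> (w, t) \<in> elems y \<Longrightarrow> R r z w \<Longrightarrow> S r z w"
  shows "covered p x y S"
proof (rule coveredI)
  fix z s q assume z: "(z, s) \<in> elems x" and q: "q \<in> below p" "q \<in> below s"
  obtain r w t where "r \<in> below q" "(w, t) \<in> elems y" "r \<in> below t" "R r z w"
    using c z q by (rule coveredE)
  with R[OF z] show "\<exists>r\<in>below q. \<exists>(w, t)\<in>elems y. r \<in> below t \<and> S r z w" by blast
qed

lemma covered_local:
  assumes "\<And>q. q \<in> below p \<Longrightarrow> \<exists>r\<in>below q. covered r x y R"
  shows "covered p x y R"
proof (rule coveredI)
  fix z s q assume z: "(z, s) \<in> elems x" and q: "q \<in> below p" "q \<in> below s"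
  obtain r where r: "r \<in> below q" "covered r x y R" using assms[OF q(1)] by blast
  obtain r' w t where "r' \<in> below r" "(w, t) \<in> elems y" "r' \<in> below t" "R r' z w"
    using r(2) z below_refl[OF below_P[OF r(1)]] below_trans[OF r(1) q(2)] by (rule coveredE)
  with below_trans[OF _ r(1)] show "\<exists>r\<in>below q. \<exists>(w, t)\<in>elems y. r \<in> below t \<and> R r z w" by blast
qed

lemma covered_trans:
  assumes c: "covered p x y R" "covered p y z S"
    and mono: "\<And>q r a b. R q a b \<Longrightarrow> r \<in> below q \<Longrightarrow> R r a b"
    and RS: "\<And>r a s b c t. (a, s) \<in> elems x \<Longrightarrow> (c, t) \<in> elems z \<Longrightarrow> R r a b \<Longrightarrow> S r b c \<Longrightarrow> T r a c"
  shows "covered p x z T"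
proof (rule coveredI)
  fix a s q assume a: "(a, s) \<in> elems x" and q: "q \<in> below p" "q \<in> below s"
  obtain r b t where r: "r \<in> below q" "(b, t) \<in> elems y" "r \<in> below t" "R r a b"
    using c(1) a q by (rule coveredE)
  obtain r' c' t' where r': "r' \<in> below r" "(c', t') \<in> elems z" "r' \<in> below t'" "S r' b c'"
    using c(2) r(2) below_trans[OF r(1) q(1)] r(3) by (rule coveredE)
  have "T r' a c'" using RS[OF a r'(2) mono[OF r(4) r'(1)] r'(4)] .
  then show "\<exists>r\<in>below q. \<exists>(c, t)\<in>elems z. r \<in> below t \<and> T r a c"
    using r' below_trans[OF r'(1) r(1)] by blast
qed

lemma forces_eq_iff:
  "p \<tturnstile> x \<^bold>= y \<longleftrightarrow> covered p x y (\<lambda>r z w. r \<tturnstile> z \<^bold>= w) \<and> covered p y x (\<lambda>r w z. r \<tturnstile> z \<^bold>= w)"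
proof -
  have "(\<forall>(z, s)\<in>name_elems x. \<forall>q\<in>P. le q p \<and> le q s \<and> s \<in> P \<longrightarrow>
          (\<exists>r\<in>P. le r q \<and> (\<exists>(w, t)\<in>name_elems y. le r t \<and> t \<in> P \<and> E r z w))) \<longleftrightarrow> covered p x y E"
    for x y :: "('i, 'p) name" and E
    unfolding covered_def below_def elems_def Ball_def Bex_def split_paired_All split_paired_Ex
    by (simp, meson)
  from this[of x y "\<lambda>r z w. forces_eq P le r z w"] this[of y x "\<lambda>r w z. forces_eq P le r z w"]
  show ?thesis unfolding forces.simps forces_eq.simps[of P le p x y] by (rule arg_cong2)
qed

lemma eqD:
  assumes "p \<tturnstile> x \<^bold>= y"
  shows "covered p x y (\<lambda>r z w. r \<tturnstile> z \<^bold>= w)" "covered p y x (\<lambda>r w z. r \<tturnstile> z \<^bold>= w)"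
  by (rule conjunct1[OF iffD1[OF forces_eq_iff assms]], rule conjunct2[OF iffD1[OF forces_eq_iff assms]])

lemma eqI:
  "covered p x y (\<lambda>r z w. r \<tturnstile> z \<^bold>= w) \<Longrightarrow> covered p y x (\<lambda>r w z. r \<tturnstile> z \<^bold>= w) \<Longrightarrow> p \<tturnstile> x \<^bold>= y"
  by (rule iffD2[OF forces_eq_iff conjI])

lemma forces_mem_iff:
  "p \<tturnstile> x \<^bold>\<in> y \<longleftrightarrow> (\<forall>q\<in>below p. \<exists>r\<in>below q. \<exists>(w, t)\<in>elems y. r \<in> below t \<and> r \<tturnstile> x \<^bold>= w)"
proof -
  have "(\<exists>r\<in>P. le r q \<and> (\<exists>(w, t)\<in>name_elems y. le r t \<and> t \<in> P \<and> forces_eq P le r x w)) \<longleftrightarrow>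
        (\<exists>r\<in>below q. \<exists>(w, t)\<in>elems y. r \<in> below t \<and> forces_eq P le r x w)" for q
    by (auto simp: below_def elems_def)
  then show ?thesis unfolding forces.simps forces_mem_def by (auto simp: below_def)
qed

lemma forces_Neg_iff: "p \<tturnstile> \<^bold>\<not> A \<longleftrightarrow> (\<forall>q\<in>below p. \<not> q \<tturnstile> A)"
  by (auto simp: below_def)

lemma forces_Conj_iff: "p \<tturnstile> (A \<^bold>\<and> B) \<longleftrightarrow> p \<tturnstile> A \<and> p \<tturnstile> B" by simp
lemma forces_All_iff: "p \<tturnstile> All \<Phi> \<longleftrightarrow> (\<forall>x. p \<tturnstile> \<Phi> x)" by simp

declare forces.simps [simp del]
declare forces_Conj_iff [simp] forces_All_iff [simp]

lemma forces_mono: "p \<tturnstile> A \<Longrightarrow> q \<in> below p \<Longrightarrow> q \<tturnstile> A"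
proof (induction A arbitrary: p q)
  case (Mem x y)
  then show ?case unfolding forces_mem_iff using below_trans by blast
next
  case (Eq x y)
  show ?case by (rule eqI) (rule covered_mono[OF eqD(1)[OF Eq(1)] Eq(2)], rule covered_mono[OF eqD(2)[OF Eq(1)] Eq(2)])
next
  case (Neg A)
  then show ?case unfolding forces_Neg_iff using below_trans by blast
next
  case (Conj A B)
  then show ?case by (metis forces_Conj_iff)
next
  case (All \<Phi>)
  then show ?case by (metis forces_All_iff rangeI)
qed

text \<open>A sentence that is forced densely below \<open>p\<close> is forced by \<open>p\<close>. Hence a sentence may be proved at a
  condition by strengthening the condition as often as convenient, and the rules for the derived
  connectives below take the form that one expects from truth in generic extensions.\<close>
lemma forces_local: "(\<And>q. q \<in> below p \<Longrightarrow> \<exists>r\<in>below q. r \<tturnstile> A) \<Longrightarrow> p \<tturnstile> A"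
proof (induction A arbitrary: p)
  case (Mem x y)
  show ?case unfolding forces_mem_iff
  proof
    fix q assume "q \<in> below p"
    then obtain r where r: "r \<in> below q" "r \<tturnstile> x \<^bold>\<in> y" using Mem by blast
    then obtain r' where "r' \<in> below r" "\<exists>(w, t)\<in>elems y. r' \<in> below t \<and> r' \<tturnstile> x \<^bold>= w"
      unfolding forces_mem_iff using below_refl[OF below_P] by blast
    with r(1) show "\<exists>r\<in>below q. \<exists>(w, t)\<in>elems y. r \<in> below t \<and> r \<tturnstile> x \<^bold>= w"
      using below_trans by blast
  qed
next
  case (Eq x y)
  show ?case
  proof (rule eqI)
    show "covered p x y (\<lambda>r z w. r \<tturnstile> z \<^bold>= w)" by (rule covered_local) (use Eq eqD(1) in metis)
    show "covered p y x (\<lambda>r w z. r \<tturnstile> z \<^bold>= w)" by (rule covered_local) (use Eq eqD(2) in metis)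
  qed
next
  case (Neg A)
  show ?case unfolding forces_Neg_iff
  proof (intro ballI notI)
    fix q assume "q \<in> below p" "q \<tturnstile> A"
    with Neg.prems obtain r where "r \<in> below q" "r \<tturnstile> \<^bold>\<not> A" by blast
    with \<open>q \<tturnstile> A\<close> show False
      unfolding forces_Neg_iff using forces_mono below_refl below_P by blast
  qed
next
  case (Conj A B)
  then show ?case by (metis forces_Conj_iff)
next
  case (All \<Phi>)
  then show ?case by (metis forces_All_iff rangeI)
qed

lemma forces_Imp_iff: "p \<tturnstile> (A \<^bold>\<longrightarrow> B) \<longleftrightarrow> (\<forall>q\<in>below p. q \<tturnstile> A \<longrightarrow> q \<tturnstile> B)"
proof
  assume L: "p \<tturnstile> (A \<^bold>\<longrightarrow> B)"
  show "\<forall>q\<in>below p. q \<tturnstile> A \<longrightarrow> q \<tturnstile> B"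
  proof (intro ballI impI)
    fix q assume q: "q \<in> below p" "q \<tturnstile> A"
    show "q \<tturnstile> B"
    proof (rule forces_local)
      fix r assume "r \<in> below q"
      then have "r \<in> below p" "r \<tturnstile> A" using q below_trans forces_mono by blast+
      with L have "\<not> r \<tturnstile> \<^bold>\<not> B" unfolding Imp_def forces_Neg_iff[where p=p] forces_Conj_iff by blast
      then show "\<exists>s\<in>below r. s \<tturnstile> B" by (simp add: forces_Neg_iff)
    qed
  qed
next
  assume "\<forall>q\<in>below p. q \<tturnstile> A \<longrightarrow> q \<tturnstile> B"
  then show "p \<tturnstile> (A \<^bold>\<longrightarrow> B)"
    unfolding Imp_def forces_Neg_iff forces_Conj_iff using below_refl[OF below_P] by blast
qed

lemma forces_Disj_iff: "p \<tturnstile> (A \<^bold>\<or> B) \<longleftrightarrow> (\<forall>q\<in>below p. \<exists>r\<in>below q. r \<tturnstile> A \<or> r \<tturnstile> B)"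
  unfolding Disj_def forces_Neg_iff forces_Conj_iff
  by (meson below_refl below_P below_trans forces_mono)

lemma forces_Ex_iff: "p \<tturnstile> Ex \<Phi> \<longleftrightarrow> (\<forall>q\<in>below p. \<exists>r\<in>below q. \<exists>x. r \<tturnstile> \<Phi> x)"
  unfolding Ex_def forces_Neg_iff forces_All_iff by blast

lemma forces_Iff_iff: "p \<tturnstile> (A \<^bold>\<longleftrightarrow> B) \<longleftrightarrow> (\<forall>q\<in>below p. q \<tturnstile> A \<longleftrightarrow> q \<tturnstile> B)"
  unfolding Iff_def forces_Conj_iff forces_Imp_iff by blast

lemma forces_ExE: 
  assumes "p \<in> P" "p \<tturnstile> Ex \<Phi>" obtains q x where "q \<in> below p" "q \<tturnstile> \<Phi> x"
  using assms below_refl unfolding forces_Ex_iff by blast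

lemma forces_ExI: "p \<tturnstile> \<Phi> x \<Longrightarrow> p \<tturnstile> Ex \<Phi>"
  unfolding forces_Ex_iff using forces_mono below_refl below_P by blast

lemma forces_DisjI1: "p \<tturnstile> A \<Longrightarrow> p \<tturnstile> (A \<^bold>\<or> B)" and forces_DisjI2: "p \<tturnstile> B \<Longrightarrow> p \<tturnstile> (A \<^bold>\<or> B)"
  unfolding forces_Disj_iff using forces_mono below_refl below_P by blast+

lemma eq_refl: "p \<tturnstile> x \<^bold>= x"
proof (induction x arbitrary: p rule: wf_induct_rule[OF wf_name_child])
  case (1 x)
  have "q \<tturnstile> z \<^bold>= z" if "(z, s) \<in> elems x" for z s q
    using 1[of z q] that by (force simp: name_child_def elems_def)
  then have "covered p x x (\<lambda>r z w. r \<tturnstile> z \<^bold>= w)" "covered p x x (\<lambda>r w z. r \<tturnstile> z \<^bold>= w)"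
    unfolding covered_def using below_refl[OF below_P] by blast+
  then show ?case by (rule eqI)
qed

lemma eq_sym: "p \<tturnstile> x \<^bold>= y \<Longrightarrow> p \<tturnstile> y \<^bold>= x"
proof (induction x arbitrary: p y rule: wf_induct_rule[OF wf_name_child])
  case (1 x)
  have IH: "q \<tturnstile> w \<^bold>= z" if "(z, s) \<in> elems x" "q \<tturnstile> z \<^bold>= w" for z s q w
    using 1(1)[of z w q] that by (force simp: name_child_def elems_def)
  show ?case
  proof (rule eqI)
    show "covered p y x (\<lambda>r w z. r \<tturnstile> w \<^bold>= z)" using eqD(2)[OF 1(2)] by (rule covered_weaken) (rule IH)
    show "covered p x y (\<lambda>r z w. r \<tturnstile> w \<^bold>= z)" using eqD(1)[OF 1(2)] by (rule covered_weaken) (rule IH)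
  qed
qed

lemma eq_trans: "p \<tturnstile> x \<^bold>= y \<Longrightarrow> p \<tturnstile> y \<^bold>= z \<Longrightarrow> p \<tturnstile> x \<^bold>= z"
proof (induction x arbitrary: p y z rule: wf_induct_rule[OF wf_name_child])
  case (1 x)
  have IH: "q \<tturnstile> a \<^bold>= c" if "(a, s) \<in> elems x" "q \<tturnstile> a \<^bold>= b" "q \<tturnstile> b \<^bold>= c" for a b c s q
    using 1(1)[of a b q c] that by (force simp: name_child_def elems_def)
  show ?case
  proof (rule eqI)
    show "covered p x z (\<lambda>r a c. r \<tturnstile> a \<^bold>= c)"
      using eqD(1)[OF 1(2)] eqD(1)[OF 1(3)]
      by (rule covered_trans) (erule forces_mono, assumption, erule IH, assumption+)
    show "covered p z x (\<lambda>r c a. r \<tturnstile> a \<^bold>= c)"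
      using eqD(2)[OF 1(3)] eqD(2)[OF 1(2)]
      by (rule covered_trans) (erule forces_mono, assumption, rule IH, assumption+)
  qed
qed

lemma mem_elems: "(z, t) \<in> elems y \<Longrightarrow> p \<in> below t \<Longrightarrow> p \<tturnstile> z \<^bold>\<in> y"
  unfolding forces_mem_iff using eq_refl below_trans below_refl[OF below_P] by blast

lemma mem_elemsE:
  assumes "p \<tturnstile> x \<^bold>\<in> y" "p \<in> P"
  obtains q w t where "q \<in> below p" "(w, t) \<in> elems y" "q \<in> below t" "q \<tturnstile> x \<^bold>= w"
  using assms below_refl unfolding forces_mem_iff by blast

lemma mem_cong_left: "p \<tturnstile> x \<^bold>= x' \<Longrightarrow> p \<tturnstile> x \<^bold>\<in> y \<Longrightarrow> p \<tturnstile> x' \<^bold>\<in> y"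
  unfolding forces_mem_iff
proof
  fix q assume "p \<tturnstile> x \<^bold>= x'" "\<forall>q\<in>below p. \<exists>r\<in>below q. \<exists>(w, t)\<in>elems y. r \<in> below t \<and> r \<tturnstile> x \<^bold>= w"
    and q: "q \<in> below p"
  then obtain r w t where r: "r \<in> below q" "(w, t) \<in> elems y" "r \<in> below t" "r \<tturnstile> x \<^bold>= w" by blast
  have "r \<tturnstile> x' \<^bold>= x"
    using eq_sym[OF \<open>p \<tturnstile> x \<^bold>= x'\<close>] forces_mono below_trans[OF r(1) q] by blast
  then have "r \<tturnstile> x' \<^bold>= w" using r(4) by (rule eq_trans)
  with r show "\<exists>r\<in>below q. \<exists>(w, t)\<in>elems y. r \<in> below t \<and> r \<tturnstile> x' \<^bold>= w" by blast
qed

lemma mem_cong_right: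
  assumes "p \<tturnstile> y \<^bold>= y'" "p \<tturnstile> x \<^bold>\<in> y" shows "p \<tturnstile> x \<^bold>\<in> y'"
  unfolding forces_mem_iff
proof
  fix q assume q: "q \<in> below p"
  obtain r w t where r: "r \<in> below q" "(w, t) \<in> elems y" "r \<in> below t" "r \<tturnstile> x \<^bold>= w"
    using mem_elemsE[OF forces_mono[OF assms(2) q] below_P[OF q]] by blast
  obtain r' c t' where r': "r' \<in> below r" "(c, t') \<in> elems y'" "r' \<in> below t'" "r' \<tturnstile> w \<^bold>= c"
    using eqD(1)[OF assms(1)] r(2) below_trans[OF r(1) q] r(3) by (rule coveredE)
  have "r' \<tturnstile> x \<^bold>= c" using eq_trans[OF forces_mono[OF r(4) r'(1)] r'(4)] .
  then show "\<exists>r\<in>below q. \<exists>(w, t)\<in>elems y'. r \<in> below t \<and> r \<tturnstile> x \<^bold>= w"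
    using r' r(1) below_trans by blast
qed

end

section \<open>Pairs and functions in the forcing language\<close>

context forcing_notion begin

lemma upair_iff:
  assumes "p \<in> P"
  shows "p \<tturnstile> is_upair z x y \<longleftrightarrow>
    p \<tturnstile> x \<^bold>\<in> z \<and> p \<tturnstile> y \<^bold>\<in> z \<and> (\<forall>q\<in>below p. \<forall>w. q \<tturnstile> w \<^bold>\<in> z \<longrightarrow> q \<tturnstile> (w \<^bold>= x \<^bold>\<or> w \<^bold>= y))"
  (is "?L \<longleftrightarrow> ?R")
proof -
  have L: "?L \<longleftrightarrow> (\<forall>w. \<forall>q\<in>below p. q \<tturnstile> w \<^bold>\<in> z \<longleftrightarrow> q \<tturnstile> (w \<^bold>= x \<^bold>\<or> w \<^bold>= y))"
    unfolding is_upair_def forces_All_iff forces_Iff_iff by blast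
  show ?thesis
  proof
    assume ?L
    moreover have "p \<tturnstile> (x \<^bold>= x \<^bold>\<or> x \<^bold>= y)" "p \<tturnstile> (y \<^bold>= x \<^bold>\<or> y \<^bold>= y)"
      using forces_DisjI1[OF eq_refl] forces_DisjI2[OF eq_refl] by blast+
    ultimately show ?R unfolding L using below_refl[OF assms] by blast
  next
    assume R: ?R
    have "q \<tturnstile> w \<^bold>\<in> z" if q: "q \<in> below p" and d: "q \<tturnstile> (w \<^bold>= x \<^bold>\<or> w \<^bold>= y)" for q w
    proof (rule forces_local)
      fix q' assume q': "q' \<in> below q"
      then obtain r where r: "r \<in> below q'" "r \<tturnstile> w \<^bold>= x \<or> r \<tturnstile> w \<^bold>= y"
        using d unfolding forces_Disj_iff by blast
      have "r \<in> below p" using r q q' below_trans by blast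
      then have "r \<tturnstile> x \<^bold>\<in> z" "r \<tturnstile> y \<^bold>\<in> z" using R forces_mono by blast+
      then have "r \<tturnstile> w \<^bold>\<in> z" using r(2) mem_cong_left eq_sym by blast
      with r(1) show "\<exists>r\<in>below q'. r \<tturnstile> w \<^bold>\<in> z" by blast
    qed
    with R show ?L unfolding L by blast
  qed
qed

lemma upair_memE:
  assumes "p \<tturnstile> is_upair z x y" "p \<tturnstile> w \<^bold>\<in> z" "p \<in> P"
  obtains q where "q \<in> below p" "q \<tturnstile> w \<^bold>= x \<or> q \<tturnstile> w \<^bold>= y"
  using assms below_refl unfolding upair_iff[OF assms(3)] forces_Disj_iff by blast

lemma upair_mem: "p \<tturnstile> is_upair z x y \<Longrightarrow> p \<in> P \<Longrightarrow> p \<tturnstile> x \<^bold>\<in> z"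
  "p \<tturnstile> is_upair z x y \<Longrightarrow> p \<in> P \<Longrightarrow> p \<tturnstile> y \<^bold>\<in> z"
  by (simp_all add: upair_iff)

lemma upair_cong:
  assumes "p \<in> P" "p \<tturnstile> z \<^bold>= z'" "p \<tturnstile> x \<^bold>= x'" "p \<tturnstile> y \<^bold>= y'" "p \<tturnstile> is_upair z x y"
  shows "p \<tturnstile> is_upair z' x' y'"
proof -
  have "p \<tturnstile> x' \<^bold>\<in> z'" "p \<tturnstile> y' \<^bold>\<in> z'"
    using assms upair_mem mem_cong_left mem_cong_right by blast+
  moreover have "q \<tturnstile> (w \<^bold>= x' \<^bold>\<or> w \<^bold>= y')" if q: "q \<in> below p" and w: "q \<tturnstile> w \<^bold>\<in> z'" for q w
    unfolding forces_Disj_iff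
  proof
    fix q' assume q': "q' \<in> below q"
    then have q'p: "q' \<in> below p" using q below_trans by blast
    have "q' \<tturnstile> w \<^bold>\<in> z"
      using mem_cong_right[OF eq_sym[OF forces_mono[OF assms(2) q'p]] forces_mono[OF w q']] .
    with forces_mono[OF assms(5) q'p] obtain r where r: "r \<in> below q'" "r \<tturnstile> w \<^bold>= x \<or> r \<tturnstile> w \<^bold>= y"
      using below_P[OF q'] by (rule upair_memE)
    have rp: "r \<in> below p" using r(1) q'p below_trans by blast
    have "r \<tturnstile> w \<^bold>= x' \<or> r \<tturnstile> w \<^bold>= y'"
      using r(2) eq_trans[OF _ forces_mono[OF assms(3) rp]] eq_trans[OF _ forces_mono[OF assms(4) rp]] by blast
    with r(1) show "\<exists>r\<in>below q'. r \<tturnstile> w \<^bold>= x' \<or> r \<tturnstile> w \<^bold>= y'" by blast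
  qed
  ultimately show ?thesis unfolding upair_iff[OF assms(1)] by blast
qed

text \<open>Four strengthenings decide with which element of the other pair each of the four elements
  coincides; the mixed cases reduce to the two stated ones by transitivity.\<close>
lemma upair_eqE:
  assumes p: "p \<in> P" and z: "p \<tturnstile> is_upair z x y" "p \<tturnstile> is_upair z x' y'"
  obtains q where "q \<in> below p" "q \<tturnstile> x \<^bold>= x' \<and> q \<tturnstile> y \<^bold>= y' \<or> q \<tturnstile> x \<^bold>= y' \<and> q \<tturnstile> y \<^bold>= x'"
proof -
  obtain q1 where q1: "q1 \<in> below p" "q1 \<tturnstile> x \<^bold>= x' \<or> q1 \<tturnstile> x \<^bold>= y'"
    using z(2) upair_mem(1)[OF z(1) p] p by (rule upair_memE)
  have P1: "q1 \<in> P" using q1(1) by (rule below_P)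
  obtain q2 where q2: "q2 \<in> below q1" "q2 \<tturnstile> y \<^bold>= x' \<or> q2 \<tturnstile> y \<^bold>= y'"
    using forces_mono[OF z(2) q1(1)] forces_mono[OF upair_mem(2)[OF z(1) p] q1(1)] P1 by (rule upair_memE)
  have P2: "q2 \<in> P" using q2(1) by (rule below_P)
  have q2p: "q2 \<in> below p" using q2(1) q1(1) by (rule below_trans)
  obtain q3 where q3: "q3 \<in> below q2" "q3 \<tturnstile> x' \<^bold>= x \<or> q3 \<tturnstile> x' \<^bold>= y"
    using forces_mono[OF z(1) q2p] forces_mono[OF upair_mem(1)[OF z(2) p] q2p] P2 by (rule upair_memE)
  have P3: "q3 \<in> P" using q3(1) by (rule below_P)
  have q3p: "q3 \<in> below p" using q3(1) q2p by (rule below_trans)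
  obtain q4 where q4: "q4 \<in> below q3" "q4 \<tturnstile> y' \<^bold>= x \<or> q4 \<tturnstile> y' \<^bold>= y"
    using forces_mono[OF z(1) q3p] forces_mono[OF upair_mem(2)[OF z(2) p] q3p] P3 by (rule upair_memE)
  have b: "q4 \<in> below q3" "q4 \<in> below q2" "q4 \<in> below q1" "q4 \<in> below p"
    using q4(1) q3(1) q2(1) q1(1) below_trans by blast+
  have "q4 \<tturnstile> x \<^bold>= x' \<or> q4 \<tturnstile> x \<^bold>= y'" "q4 \<tturnstile> y \<^bold>= x' \<or> q4 \<tturnstile> y \<^bold>= y'"
    "q4 \<tturnstile> x' \<^bold>= x \<or> q4 \<tturnstile> x' \<^bold>= y"
    using q1(2) q2(2) q3(2) forces_mono b by blast+
  with q4(2) have "q4 \<tturnstile> x \<^bold>= x' \<and> q4 \<tturnstile> y \<^bold>= y' \<or> q4 \<tturnstile> x \<^bold>= y' \<and> q4 \<tturnstile> y \<^bold>= x'"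
    by (meson eq_sym eq_trans)
  with b(4) show ?thesis by (rule that)
qed

lemma opairE:
  assumes "p \<tturnstile> is_opair z x y" "p \<in> P"
  obtains q a b where "q \<in> below p" "q \<tturnstile> is_upair a x x" "q \<tturnstile> is_upair b x y" "q \<tturnstile> is_upair z a b"
proof -
  obtain q a where q: "q \<in> below p" "q \<tturnstile> (\<^bold>\<exists>b. is_upair a x x \<^bold>\<and> is_upair b x y \<^bold>\<and> is_upair z a b)"
    using assms(2,1) unfolding is_opair_def by (rule forces_ExE)
  obtain r b where r: "r \<in> below q" "r \<tturnstile> (is_upair a x x \<^bold>\<and> is_upair b x y \<^bold>\<and> is_upair z a b)"
    using below_P[OF q(1)] q(2) by (rule forces_ExE)
  show ?thesis by (rule that[of r a b]) (use r below_trans[OF r(1) q(1)] in auto)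
qed

lemma opairI:
  assumes "p \<tturnstile> is_upair a x x" "p \<tturnstile> is_upair b x y" "p \<tturnstile> is_upair z a b"
  shows "p \<tturnstile> is_opair z x y"
  unfolding is_opair_def by (rule forces_ExI[where p=p and x=a], rule forces_ExI[where p=p and x=b]) (use assms in simp)

lemma opair_cong:
  assumes "p \<tturnstile> z \<^bold>= z'" "p \<tturnstile> x \<^bold>= x'" "p \<tturnstile> y \<^bold>= y'" "p \<tturnstile> is_opair z x y"
  shows "p \<tturnstile> is_opair z' x' y'"
proof (rule forces_local)
  fix q assume q: "q \<in> below p"
  obtain r a b where r: "r \<in> below q" "r \<tturnstile> is_upair a x x" "r \<tturnstile> is_upair b x y" "r \<tturnstile> is_upair z a b"
    using forces_mono[OF assms(4) q] below_P[OF q] by (rule opairE)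
  have rp: "r \<in> below p" and rP: "r \<in> P" using r(1) q below_trans below_P by blast+
  note e = forces_mono[OF assms(1) rp] forces_mono[OF assms(2) rp] forces_mono[OF assms(3) rp]
  have "r \<tturnstile> is_upair a x' x'" "r \<tturnstile> is_upair b x' y'" "r \<tturnstile> is_upair z' a b"
    using upair_cong[OF rP eq_refl e(2) e(2) r(2)] upair_cong[OF rP eq_refl e(2) e(3) r(3)]
      upair_cong[OF rP e(1) eq_refl eq_refl r(4)] .
  then have "r \<tturnstile> is_opair z' x' y'" by (rule opairI)
  with r(1) show "\<exists>r\<in>below q. r \<tturnstile> is_opair z' x' y'" by blast
qed

text \<open>Kuratowski's argument. The case distinctions are legitimate because it suffices to force the
  two equalities densely.\<close>
lemma opair_inject:
  assumes p: "p \<in> P" and z: "p \<tturnstile> is_opair z x y" "p \<tturnstile> is_opair z x' y'"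
  shows "p \<tturnstile> x \<^bold>= x'" "p \<tturnstile> y \<^bold>= y'"
proof -
  have "p \<tturnstile> (x \<^bold>= x' \<^bold>\<and> y \<^bold>= y')"
  proof (rule forces_local)
    fix q assume q: "q \<in> below p"
    obtain q1 a b where q1: "q1 \<in> below q" "q1 \<tturnstile> is_upair a x x" "q1 \<tturnstile> is_upair b x y" "q1 \<tturnstile> is_upair z a b"
      using forces_mono[OF z(1) q] below_P[OF q] by (rule opairE)
    have q1p: "q1 \<in> below p" and P1: "q1 \<in> P" using q1(1) q below_trans below_P by blast+
    obtain q2 a' b' where q2: "q2 \<in> below q1" "q2 \<tturnstile> is_upair a' x' x'" "q2 \<tturnstile> is_upair b' x' y'" "q2 \<tturnstile> is_upair z a' b'"
      using forces_mono[OF z(2) q1p] P1 by (rule opairE)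
    have P2: "q2 \<in> P" using q2(1) by (rule below_P)
    obtain q3 where q3: "q3 \<in> below q2" "q3 \<tturnstile> a \<^bold>= a' \<and> q3 \<tturnstile> b \<^bold>= b' \<or> q3 \<tturnstile> a \<^bold>= b' \<and> q3 \<tturnstile> b \<^bold>= a'"
      using P2 forces_mono[OF q1(4) q2(1)] q2(4) by (rule upair_eqE)
    have q3q1: "q3 \<in> below q1" and P3: "q3 \<in> P" using q3(1) q2(1) below_trans below_P by blast+
    note A = forces_mono[OF q1(2) q3q1] and B = forces_mono[OF q1(3) q3q1]
      and A' = forces_mono[OF q2(2) q3(1)] and B' = forces_mono[OF q2(3) q3(1)]
    have "\<exists>r\<in>below q3. r \<tturnstile> x \<^bold>= x' \<and> r \<tturnstile> y \<^bold>= y'"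
      using q3(2)
    proof (elim disjE conjE)
      assume e: "q3 \<tturnstile> a \<^bold>= a'" "q3 \<tturnstile> b \<^bold>= b'"
      obtain q4 where q4: "q4 \<in> below q3" "q4 \<tturnstile> x \<^bold>= x' \<and> q4 \<tturnstile> x \<^bold>= x' \<or> q4 \<tturnstile> x \<^bold>= x' \<and> q4 \<tturnstile> x \<^bold>= x'"
        using P3 A upair_cong[OF P3 eq_sym[OF e(1)] eq_refl eq_refl A'] by (rule upair_eqE)
      obtain q5 where q5: "q5 \<in> below q4" "q5 \<tturnstile> x \<^bold>= x' \<and> q5 \<tturnstile> y \<^bold>= y' \<or> q5 \<tturnstile> x \<^bold>= y' \<and> q5 \<tturnstile> y \<^bold>= x'"
        using below_P[OF q4(1)] forces_mono[OF B q4(1)]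
          forces_mono[OF upair_cong[OF P3 eq_sym[OF e(2)] eq_refl eq_refl B'] q4(1)] by (rule upair_eqE)
      have "q5 \<tturnstile> x \<^bold>= x'" using q4(2) forces_mono[OF _ q5(1)] by blast
      then have "q5 \<tturnstile> x \<^bold>= x' \<and> q5 \<tturnstile> y \<^bold>= y'" using q5(2) by (meson eq_sym eq_trans)
      then show ?thesis using below_trans[OF q5(1) q4(1)] by blast
    next
      assume e: "q3 \<tturnstile> a \<^bold>= b'" "q3 \<tturnstile> b \<^bold>= a'"
      obtain q4 where q4: "q4 \<in> below q3" "q4 \<tturnstile> x \<^bold>= x' \<and> q4 \<tturnstile> x \<^bold>= y' \<or> q4 \<tturnstile> x \<^bold>= y' \<and> q4 \<tturnstile> x \<^bold>= x'"
        using P3 A upair_cong[OF P3 eq_sym[OF e(1)] eq_refl eq_refl B'] by (rule upair_eqE)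
      obtain q5 where q5: "q5 \<in> below q4" "q5 \<tturnstile> x \<^bold>= x' \<and> q5 \<tturnstile> y \<^bold>= x' \<or> q5 \<tturnstile> x \<^bold>= x' \<and> q5 \<tturnstile> y \<^bold>= x'"
        using below_P[OF q4(1)] forces_mono[OF B q4(1)]
          forces_mono[OF upair_cong[OF P3 eq_sym[OF e(2)] eq_refl eq_refl A'] q4(1)] by (rule upair_eqE)
      have "q5 \<tturnstile> x \<^bold>= x'" "q5 \<tturnstile> x \<^bold>= y'" using q4(2) forces_mono[OF _ q5(1)] by blast+
      then have "q5 \<tturnstile> x \<^bold>= x' \<and> q5 \<tturnstile> y \<^bold>= y'" using q5(2) by (meson eq_sym eq_trans)
      then show ?thesis using below_trans[OF q5(1) q4(1)] by blast
    qed
    then obtain r where r: "r \<in> below q3" "r \<tturnstile> (x \<^bold>= x' \<^bold>\<and> y \<^bold>= y')" by auto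
    have "r \<in> below q" using r(1) q3(1) q2(1) q1(1) below_trans by blast
    with r(2) show "\<exists>r\<in>below q. r \<tturnstile> (x \<^bold>= x' \<^bold>\<and> y \<^bold>= y')" by blast
  qed
  then show "p \<tturnstile> x \<^bold>= x'" "p \<tturnstile> y \<^bold>= y'" by simp_all
qed

lemma maps_toE:
  assumes "p \<tturnstile> maps_to F x y" "p \<in> P"
  obtains q z where "q \<in> below p" "q \<tturnstile> is_opair z x y" "q \<tturnstile> z \<^bold>\<in> F"
proof -
  obtain q z where q: "q \<in> below p" "q \<tturnstile> (is_opair z x y \<^bold>\<and> z \<^bold>\<in> F)"
    using assms(2,1) unfolding maps_to_def by (rule forces_ExE)
  show ?thesis by (rule that[of q z]) (use q in simp_all)
qed

lemma maps_toI: "p \<tturnstile> is_opair z x y \<Longrightarrow> p \<tturnstile> z \<^bold>\<in> F \<Longrightarrow> p \<tturnstile> maps_to F x y"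
  unfolding maps_to_def by (rule forces_ExI[where p=p and x=z]) simp

lemma maps_to_cong:
  assumes "p \<tturnstile> maps_to F x y" "p \<tturnstile> x \<^bold>= x'" "p \<tturnstile> y \<^bold>= y'"
  shows "p \<tturnstile> maps_to F x' y'"
proof (rule forces_local)
  fix q assume q: "q \<in> below p"
  obtain r z where r: "r \<in> below q" "r \<tturnstile> is_opair z x y" "r \<tturnstile> z \<^bold>\<in> F"
    using forces_mono[OF assms(1) q] below_P[OF q] by (rule maps_toE)
  have rp: "r \<in> below p" using r(1) q by (rule below_trans)
  have "r \<tturnstile> maps_to F x' y'"
    using opair_cong[OF eq_refl forces_mono[OF assms(2) rp] forces_mono[OF assms(3) rp] r(2)] r(3)
    by (rule maps_toI)
  with r(1) show "\<exists>r\<in>below q. r \<tturnstile> maps_to F x' y'" by blast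
qed

lemma function_unique:
  assumes "p \<tturnstile> is_function F A B" "p \<tturnstile> maps_to F x y" "p \<tturnstile> maps_to F x y'" "p \<in> P"
  shows "p \<tturnstile> y \<^bold>= y'"
  using assms(1-3) below_refl[OF assms(4)] unfolding is_function_def forces_Conj_iff forces_All_iff forces_Imp_iff
  by blast

lemma function_rel:
  assumes "p \<tturnstile> is_function F A B" "p \<tturnstile> maps_to F x y" "p \<in> P"
  shows "p \<tturnstile> x \<^bold>\<in> A" "p \<tturnstile> y \<^bold>\<in> B"
proof -
  have "p \<tturnstile> (x \<^bold>\<in> A \<^bold>\<and> y \<^bold>\<in> B)"
  proof (rule forces_local)
    fix q assume q: "q \<in> below p"
    obtain r z where r: "r \<in> below q" "r \<tturnstile> is_opair z x y" "r \<tturnstile> z \<^bold>\<in> F"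
      using forces_mono[OF assms(2) q] below_P[OF q] by (rule maps_toE)
    have rp: "r \<in> below p" using r(1) q by (rule below_trans)
    have "r \<tturnstile> (\<^bold>\<exists>x. \<^bold>\<exists>y. x \<^bold>\<in> A \<^bold>\<and> y \<^bold>\<in> B \<^bold>\<and> is_opair z x y)"
      using assms(1) rp r(3) unfolding is_function_def forces_Conj_iff forces_All_iff forces_Imp_iff by blast
    with below_P[OF r(1)] obtain r' x' where r': "r' \<in> below r" "r' \<tturnstile> (\<^bold>\<exists>y. x' \<^bold>\<in> A \<^bold>\<and> y \<^bold>\<in> B \<^bold>\<and> is_opair z x' y)"
      by (rule forces_ExE)
    obtain s y' where s: "s \<in> below r'" "s \<tturnstile> (x' \<^bold>\<in> A \<^bold>\<and> y' \<^bold>\<in> B \<^bold>\<and> is_opair z x' y')"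
      using below_P[OF r'(1)] r'(2) by (rule forces_ExE)
    have sr: "s \<in> below r" and sP: "s \<in> P" using s(1) r'(1) below_trans below_P by blast+
    have sz: "s \<tturnstile> is_opair z x' y'" "s \<tturnstile> x' \<^bold>\<in> A" "s \<tturnstile> y' \<^bold>\<in> B" using s(2) by auto
    note e = opair_inject[OF sP sz(1) forces_mono[OF r(2) sr]]
    have "s \<tturnstile> x \<^bold>\<in> A" "s \<tturnstile> y \<^bold>\<in> B" using mem_cong_left[OF e(1) sz(2)] mem_cong_left[OF e(2) sz(3)] .
    then show "\<exists>r\<in>below q. r \<tturnstile> (x \<^bold>\<in> A \<^bold>\<and> y \<^bold>\<in> B)" using below_trans[OF sr r(1)] by auto
  qed
  then show "p \<tturnstile> x \<^bold>\<in> A" "p \<tturnstile> y \<^bold>\<in> B" by simp_all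
qed

lemma function_total:
  assumes "p \<tturnstile> is_function F A B" "p \<tturnstile> x \<^bold>\<in> A" "p \<in> P"
  obtains q y where "q \<in> below p" "q \<tturnstile> maps_to F x y"
proof -
  have "p \<tturnstile> (\<^bold>\<exists>y. maps_to F x y)"
    using assms(1,2) below_refl[OF assms(3)]
    unfolding is_function_def forces_Conj_iff forces_All_iff forces_Imp_iff by blast
  with assms(3) show ?thesis using that by (rule forces_ExE)
qed

text \<open>This replaces the evaluation of names: below \<open>p\<close>, the set named by \<open>A\<close> has exactly the elements
  named by \<open>c a\<close> for \<open>a\<close> in the ground model set \<open>S\<close>.\<close>
definition represents :: "'p \<Rightarrow> ('a \<Rightarrow> ('i, 'p) name) \<Rightarrow> 'a set \<Rightarrow> ('i, 'p) name \<Rightarrow> bool" where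
  "represents p c S A \<longleftrightarrow> (\<forall>a\<in>S. p \<tturnstile> c a \<^bold>\<in> A) \<and>
     (\<forall>q\<in>below p. \<forall>x. q \<tturnstile> x \<^bold>\<in> A \<longrightarrow> (\<exists>r\<in>below q. \<exists>a\<in>S. r \<tturnstile> x \<^bold>= c a))"

text \<open>Single-valuedness of functions that are copied from the ground model, and every comparison of
  decided values, rest on this property of the names \<open>c a\<close>.\<close>
definition discrete :: "('a \<Rightarrow> ('i, 'p) name) \<Rightarrow> 'a set \<Rightarrow> bool" where
  "discrete c S \<longleftrightarrow> (\<forall>p\<in>P. \<forall>a\<in>S. \<forall>b\<in>S. p \<tturnstile> c a \<^bold>= c b \<longrightarrow> a = b)"

lemma representsI: "represents p c S A \<Longrightarrow> a \<in> S \<Longrightarrow> p \<tturnstile> c a \<^bold>\<in> A"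
  by (simp add: represents_def)

lemma representsE:
  assumes "represents p c S A" "p \<tturnstile> x \<^bold>\<in> A" "p \<in> P"
  obtains q a where "q \<in> below p" "a \<in> S" "q \<tturnstile> x \<^bold>= c a"
  using assms below_refl[OF assms(3)] unfolding represents_def by blast

lemma represents_mono: "represents p c S A \<Longrightarrow> q \<in> below p \<Longrightarrow> represents q c S A"
  unfolding represents_def using forces_mono below_trans by blast

lemma represents_cong:
  assumes "p \<tturnstile> A \<^bold>= A'" "represents p c S A"
  shows "represents p c S A'"
  using assms mem_cong_right eq_sym forces_mono unfolding represents_def by meson

lemma discreteD: "discrete c S \<Longrightarrow> p \<in> P \<Longrightarrow> a \<in> S \<Longrightarrow> b \<in> S \<Longrightarrow> p \<tturnstile> c a \<^bold>= c b \<Longrightarrow> a = b"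
  unfolding discrete_def by blast

lemma function_value:
  assumes "p \<tturnstile> is_function F A B" "p \<tturnstile> x \<^bold>\<in> A" "represents p c T B" "p \<in> P"
  obtains q t where "q \<in> below p" "t \<in> T" "q \<tturnstile> maps_to F x (c t)"
proof -
  obtain q y where q: "q \<in> below p" "q \<tturnstile> maps_to F x y"
    using assms(1,2,4) by (rule function_total)
  note qP = below_P[OF q(1)]
  have "q \<tturnstile> y \<^bold>\<in> B" using function_rel(2)[OF forces_mono[OF assms(1) q(1)] q(2) qP] .
  with represents_mono[OF assms(3) q(1)] obtain r t where r: "r \<in> below q" "t \<in> T" "r \<tturnstile> y \<^bold>= c t"
    using qP by (rule representsE)
  have "r \<tturnstile> maps_to F x (c t)" using forces_mono[OF q(2) r(1)] eq_refl r(3) by (rule maps_to_cong)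
  with below_trans[OF r(1) q(1)] r(2) show ?thesis by (rule that)
qed

text \<open>By this fact a coloring in the extension of a finite ground model graph yields a coloring
  in the ground model with the same number of colors.\<close>
lemma function_decide:
  assumes "finite S" "\<And>a. a \<in> S \<Longrightarrow> p \<tturnstile> c a \<^bold>\<in> A" "p \<tturnstile> is_function F A B" "represents p d T B" "p \<in> P"
  shows "\<exists>q\<in>below p. \<exists>\<phi>. \<forall>a\<in>S. \<phi> a \<in> T \<and> q \<tturnstile> maps_to F (c a) (d (\<phi> a))"
  using assms(1,2)
proof (induction S)
  case empty
  then show ?case using below_refl[OF assms(5)] by auto
next
  case (insert a S)
  then obtain q \<phi> where q: "q \<in> below p" "\<forall>a\<in>S. \<phi> a \<in> T \<and> q \<tturnstile> maps_to F (c a) (d (\<phi> a))" by auto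
  obtain r t where r: "r \<in> below q" "t \<in> T" "r \<tturnstile> maps_to F (c a) (d t)"
    using forces_mono[OF assms(3) q(1)] forces_mono[OF insert.prems[of a] q(1), OF insertI1]
      represents_mono[OF assms(4) q(1)] below_P[OF q(1)] by (rule function_value)
  have "\<forall>x\<in>insert a S. (\<phi>(a := t)) x \<in> T \<and> r \<tturnstile> maps_to F (c x) (d ((\<phi>(a := t)) x))"
    using r(2,3) q(2) forces_mono[OF _ r(1)] insert.hyps by auto
  with below_trans[OF r(1) q(1)] show ?case by blast
qed

lemma decide_finite:
  assumes "finite S" "p \<in> P"
  shows "\<exists>q\<in>below p. \<forall>A\<in>S. q \<tturnstile> A \<or> q \<tturnstile> \<^bold>\<not> A"
  using assms(1)
proof (induction S)
  case empty
  then show ?case using below_refl[OF assms(2)] by auto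
next
  case (insert A S)
  then obtain q where q: "q \<in> below p" "\<forall>A\<in>S. q \<tturnstile> A \<or> q \<tturnstile> \<^bold>\<not> A" by auto
  obtain r where r: "r \<in> below q" "r \<tturnstile> A \<or> r \<tturnstile> \<^bold>\<not> A"
    using below_refl[OF below_P[OF q(1)]] unfolding forces_Neg_iff by blast
  then have "\<forall>A\<in>insert A S. r \<tturnstile> A \<or> r \<tturnstile> \<^bold>\<not> A" using q(2) forces_mono[OF _ r(1)] by blast
  with below_trans[OF r(1) q(1)] show ?case by blast
qed

end

section \<open>Names for ground model sets and functions\<close>

lemma nat_into_omega1: "\<exists>g :: nat \<Rightarrow> omega1. inj g"
proof -
  have "infinite (UNIV :: omega1 set)"
    using uncountable_omega1 countable_finite by blast
  then show ?thesis unfolding infinite_iff_countable_subset by blast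
qed

text \<open>A set of pairs is the element set of some name if it embeds into the index type of the names.
  All sets needed here have at most \<open>\<aleph>\<^sub>1\<close> elements.\<close>
definition small :: "'s set \<Rightarrow> bool" where "small S \<longleftrightarrow> (\<exists>j :: 's \<Rightarrow> omega1. inj_on j S)"

lemma small_countable: "countable S \<Longrightarrow> small S"
proof -
  assume "countable S"
  then obtain j :: "_ \<Rightarrow> nat" where "inj_on j S" by (auto simp: countable_def)
  moreover obtain g :: "nat \<Rightarrow> omega1" where "inj g" using nat_into_omega1 by blast
  ultimately have "inj_on (g \<circ> j) S" by (simp add: comp_inj_on inj_on_subset)
  then show ?thesis unfolding small_def by blast
qed

lemma small_image: "small S \<Longrightarrow> small (F ` S)"
proof -
  assume "small S"
  then obtain j :: "_ \<Rightarrow> omega1" where j: "inj_on j S" by (auto simp: small_def)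
  have "inj_on (j \<circ> inv_into S F) (F ` S)"
    by (rule comp_inj_on[OF inj_on_inv_into[OF subset_refl]])
       (rule inj_on_subset[OF j], auto intro: inv_into_into)
  then show ?thesis unfolding small_def by blast
qed

(* This recursion equation loops as a rewrite rule, too. *)
declare check_ord.simps [simp del]

locale small_forcing = forcing_notion P le one
  for P :: "'p set" and le one +
  fixes \<iota> :: "omega1 \<Rightarrow> 'i"
  assumes inj_\<iota>: "inj \<iota>"
begin

lemma elems_name_of_set:
  fixes S :: "(('i, 'p) name \<times> 'p) set"
  assumes "small S" "\<And>x s. (x, s) \<in> S \<Longrightarrow> s \<in> P"
  shows "elems (name_of_set S) = S"
proof -
  obtain j :: "_ \<Rightarrow> omega1" where "inj_on j S" using assms(1) by (auto simp: small_def)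
  then have "inj_on (\<iota> \<circ> j) S" using inj_\<iota> by (simp add: comp_inj_on inj_on_subset)
  from name_elems_name_of_set[OF this] assms(2) show ?thesis unfolding elems_def by auto
qed

abbreviation ground_set :: "('a \<Rightarrow> ('i, 'p) name) \<Rightarrow> 'a set \<Rightarrow> ('i, 'p) name" where
  "ground_set c S \<equiv> name_of_set ((\<lambda>a. (c a, one)) ` S)"

lemma represents_ground_set:
  assumes "small S" "p \<in> P"
  shows "represents p c S (ground_set c S)"
proof -
  have E: "elems (ground_set c S) = (\<lambda>a. (c a, one)) ` S"
    by (rule elems_name_of_set) (use small_image[OF assms(1)] one_in in auto)
  have "p \<tturnstile> c a \<^bold>\<in> ground_set c S" if "a \<in> S" for a
  proof -
    have "(c a, one) \<in> elems (ground_set c S)" unfolding E using that by blast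
    then show ?thesis using below_one[OF assms(2)] by (rule mem_elems)
  qed
  moreover have "\<exists>r\<in>below q. \<exists>a\<in>S. r \<tturnstile> x \<^bold>= c a" if q: "q \<in> below p" and x: "q \<tturnstile> x \<^bold>\<in> ground_set c S" for q x
  proof -
    obtain r w t where "r \<in> below q" "(w, t) \<in> elems (ground_set c S)" "r \<tturnstile> x \<^bold>= w"
      using x below_P[OF q] by (rule mem_elemsE)
    then show ?thesis unfolding E by auto
  qed
  ultimately show ?thesis unfolding represents_def by blast
qed

definition upair_name :: "('i, 'p) name \<Rightarrow> ('i, 'p) name \<Rightarrow> ('i, 'p) name" where
  "upair_name x y = ground_set id {x, y}"

definition opair_name :: "('i, 'p) name \<Rightarrow> ('i, 'p) name \<Rightarrow> ('i, 'p) name" where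
  "opair_name x y = upair_name (upair_name x x) (upair_name x y)"

definition fun_name :: "('a \<Rightarrow> ('i, 'p) name) \<Rightarrow> ('a \<Rightarrow> ('i, 'p) name) \<Rightarrow> 'a set \<Rightarrow> ('i, 'p) name" where
  "fun_name c d S = ground_set (\<lambda>a. opair_name (c a) (d a)) S"

lemma represents_upair:
  assumes "p \<in> P" "represents p c {a, b} z"
  shows "p \<tturnstile> is_upair z (c a) (c b)"
proof -
  have "q \<tturnstile> (w \<^bold>= c a \<^bold>\<or> w \<^bold>= c b)" if q: "q \<in> below p" "q \<tturnstile> w \<^bold>\<in> z" for q w
    unfolding forces_Disj_iff
  proof
    fix q' assume q': "q' \<in> below q"
    obtain r e where "r \<in> below q'" "e \<in> {a, b}" "r \<tturnstile> w \<^bold>= c e"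
      using represents_mono[OF assms(2) below_trans[OF q' q(1)]] forces_mono[OF q(2) q'] below_P[OF q']
      by (rule representsE)
    then show "\<exists>r\<in>below q'. r \<tturnstile> w \<^bold>= c a \<or> r \<tturnstile> w \<^bold>= c b" by auto
  qed
  then show ?thesis
    unfolding upair_iff[OF assms(1)] using representsI[OF assms(2)] by blast
qed

lemma upair_name: "p \<in> P \<Longrightarrow> p \<tturnstile> is_upair (upair_name x y) x y"
  using represents_upair[of p id x y] represents_ground_set[of "{x, y}" p id] small_countable[of "{x, y}"]
  unfolding upair_name_def by simp

lemma opair_name: "p \<in> P \<Longrightarrow> p \<tturnstile> is_opair (opair_name x y) x y"
  unfolding opair_name_def by (rule opairI) (rule upair_name, assumption)+

lemma fun_name_maps_to: "small S \<Longrightarrow> a \<in> S \<Longrightarrow> p \<in> P \<Longrightarrow> p \<tturnstile> maps_to (fun_name c d S) (c a) (d a)"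
  unfolding fun_name_def using representsI[OF represents_ground_set] opair_name maps_toI by metis

lemma fun_name_maps_toE:
  assumes "p \<tturnstile> maps_to (fun_name c d S) x y" "small S" "p \<in> P"
  obtains q a where "q \<in> below p" "a \<in> S" "q \<tturnstile> x \<^bold>= c a" "q \<tturnstile> y \<^bold>= d a"
proof -
  obtain q z where q: "q \<in> below p" "q \<tturnstile> is_opair z x y" "q \<tturnstile> z \<^bold>\<in> fun_name c d S"
    using assms(1,3) by (rule maps_toE)
  note qP = below_P[OF q(1)]
  obtain r a where r: "r \<in> below q" "a \<in> S" "r \<tturnstile> z \<^bold>= opair_name (c a) (d a)"
    using represents_ground_set[OF assms(2) qP] q(3)[unfolded fun_name_def] qP by (rule representsE)
  note rP = below_P[OF r(1)]
  have "r \<tturnstile> is_opair (opair_name (c a) (d a)) x y"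
    using r(3) eq_refl eq_refl forces_mono[OF q(2) r(1)] by (rule opair_cong)
  note e = opair_inject[OF rP this opair_name[OF rP]]
  show ?thesis using below_trans[OF r(1) q(1)] r(2) e by (rule that)
qed

lemma fun_name_function:
  assumes S: "small S" and A: "represents p c S A" and B: "\<And>a. a \<in> S \<Longrightarrow> p \<tturnstile> d a \<^bold>\<in> B"
    and c: "discrete c S" and p: "p \<in> P"
  shows "p \<tturnstile> is_function (fun_name c d S) A B"
proof -
  let ?F = "fun_name c d S"
  have 1: "q \<tturnstile> (\<^bold>\<exists>x. \<^bold>\<exists>y. x \<^bold>\<in> A \<^bold>\<and> y \<^bold>\<in> B \<^bold>\<and> is_opair z x y)" if q: "q \<in> below p" and z: "q \<tturnstile> z \<^bold>\<in> ?F" for q z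
  proof (rule forces_local)
    fix q' assume q': "q' \<in> below q"
    obtain r a where r: "r \<in> below q'" "a \<in> S" "r \<tturnstile> z \<^bold>= opair_name (c a) (d a)"
      using represents_ground_set[OF S below_P[OF q']] forces_mono[OF z q', unfolded fun_name_def] below_P[OF q']
      by (rule representsE)
    have rp: "r \<in> below p" using r(1) q' q below_trans by blast
    have "r \<tturnstile> is_opair z (c a) (d a)"
      using eq_sym[OF r(3)] eq_refl eq_refl opair_name[OF below_P[OF r(1)]] by (rule opair_cong)
    moreover have "r \<tturnstile> c a \<^bold>\<in> A" "r \<tturnstile> d a \<^bold>\<in> B"
      using forces_mono[OF representsI[OF A r(2)] rp] forces_mono[OF B[OF r(2)] rp] .
    ultimately have "r \<tturnstile> (c a \<^bold>\<in> A \<^bold>\<and> d a \<^bold>\<in> B \<^bold>\<and> is_opair z (c a) (d a))" by simp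
    then have "r \<tturnstile> (\<^bold>\<exists>x. \<^bold>\<exists>y. x \<^bold>\<in> A \<^bold>\<and> y \<^bold>\<in> B \<^bold>\<and> is_opair z x y)"
      by (intro forces_ExI[where x="c a"] forces_ExI[where x="d a"])
    with r(1) show "\<exists>r\<in>below q'. r \<tturnstile> (\<^bold>\<exists>x. \<^bold>\<exists>y. x \<^bold>\<in> A \<^bold>\<and> y \<^bold>\<in> B \<^bold>\<and> is_opair z x y)" by blast
  qed
  have 2: "q \<tturnstile> (\<^bold>\<exists>y. maps_to ?F x y)" if q: "q \<in> below p" and x: "q \<tturnstile> x \<^bold>\<in> A" for q x
  proof (rule forces_local)
    fix q' assume q': "q' \<in> below q"
    obtain r a where r: "r \<in> below q'" "a \<in> S" "r \<tturnstile> x \<^bold>= c a"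
      using represents_mono[OF A below_trans[OF q' q]] forces_mono[OF x q'] below_P[OF q']
      by (rule representsE)
    have "r \<tturnstile> maps_to ?F x (d a)"
      using fun_name_maps_to[OF S r(2) below_P[OF r(1)]] eq_sym[OF r(3)] eq_refl by (rule maps_to_cong)
    then show "\<exists>r\<in>below q'. r \<tturnstile> (\<^bold>\<exists>y. maps_to ?F x y)" using r(1) forces_ExI by blast
  qed
  have 3: "q \<tturnstile> y \<^bold>= y'" if q: "q \<in> below p" and x: "q \<tturnstile> maps_to ?F x y" "q \<tturnstile> maps_to ?F x y'" for q x y y'
  proof (rule forces_local)
    fix q' assume q': "q' \<in> below q"
    obtain r a where r: "r \<in> below q'" "a \<in> S" "r \<tturnstile> x \<^bold>= c a" "r \<tturnstile> y \<^bold>= d a"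
      using forces_mono[OF x(1) q'] S below_P[OF q'] by (rule fun_name_maps_toE)
    note rP = below_P[OF r(1)]
    obtain s b where s: "s \<in> below r" "b \<in> S" "s \<tturnstile> x \<^bold>= c b" "s \<tturnstile> y' \<^bold>= d b"
      using forces_mono[OF forces_mono[OF x(2) q'] r(1)] S rP by (rule fun_name_maps_toE)
    have "s \<tturnstile> c a \<^bold>= c b"
      using eq_sym[OF forces_mono[OF r(3) s(1)]] s(3) by (rule eq_trans)
    then have "a = b" using discreteD[OF c below_P[OF s(1)] r(2) s(2)] by blast
    then have "s \<tturnstile> y \<^bold>= d b" using forces_mono[OF r(4) s(1)] by simp
    then have "s \<tturnstile> y \<^bold>= y'" using eq_sym[OF s(4)] by (rule eq_trans)
    then show "\<exists>r\<in>below q'. r \<tturnstile> y \<^bold>= y'" using below_trans[OF s(1) r(1)] by blast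
  qed
  show ?thesis unfolding is_function_def forces_Conj_iff forces_All_iff forces_Imp_iff
    using 1 2 3 by blast
qed

lemma fun_name_injection:
  assumes S: "small S" and A: "represents p c S A" and B: "\<And>a. a \<in> S \<Longrightarrow> p \<tturnstile> d a \<^bold>\<in> B"
    and c: "discrete c S" and d: "discrete d S" and p: "p \<in> P"
  shows "p \<tturnstile> is_injection (fun_name c d S) A B"
proof -
  have "q \<tturnstile> x \<^bold>= x'" if q: "q \<in> below p"
    and x: "q \<tturnstile> maps_to (fun_name c d S) x y" "q \<tturnstile> maps_to (fun_name c d S) x' y" for q x x' y
  proof (rule forces_local)
    fix q' assume q': "q' \<in> below q"
    obtain r a where r: "r \<in> below q'" "a \<in> S" "r \<tturnstile> x \<^bold>= c a" "r \<tturnstile> y \<^bold>= d a"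
      using forces_mono[OF x(1) q'] S below_P[OF q'] by (rule fun_name_maps_toE)
    note rP = below_P[OF r(1)]
    obtain s b where s: "s \<in> below r" "b \<in> S" "s \<tturnstile> x' \<^bold>= c b" "s \<tturnstile> y \<^bold>= d b"
      using forces_mono[OF forces_mono[OF x(2) q'] r(1)] S rP by (rule fun_name_maps_toE)
    have "s \<tturnstile> d a \<^bold>= d b"
      using eq_sym[OF forces_mono[OF r(4) s(1)]] s(4) by (rule eq_trans)
    then have "a = b" using discreteD[OF d below_P[OF s(1)] r(2) s(2)] by blast
    then have "s \<tturnstile> x \<^bold>= c b" using forces_mono[OF r(3) s(1)] by simp
    then have "s \<tturnstile> x \<^bold>= x'" using eq_sym[OF s(3)] by (rule eq_trans)
    then show "\<exists>r\<in>below q'. r \<tturnstile> x \<^bold>= x'" using below_trans[OF s(1) r(1)] by blast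
  qed
  moreover have "p \<tturnstile> is_function (fun_name c d S) A B"
    using S A B c p by (rule fun_name_function)
  ultimately show ?thesis
    unfolding is_injection_def forces_Conj_iff forces_All_iff forces_Imp_iff by blast
qed

abbreviation ck :: "'o::wellorder \<Rightarrow> ('i, 'p) name" where "ck \<equiv> check_ord one"

lemma represents_check:
  fixes \<alpha> :: "'o::wellorder"
  assumes "countable {..<\<alpha>}" "p \<in> P"
  shows "represents p ck {..<\<alpha>} (ck \<alpha>)"
  using represents_ground_set[OF small_countable[OF assms(1)] assms(2), of ck]
  by (simp only: check_ord.simps[of one \<alpha>])

lemma represents_checks:
  fixes S :: "'o::wellorder set"
  assumes "small S" "p \<in> P"
  shows "represents p ck S (check_ords one S)"
  using represents_ground_set[OF assms, of ck] by (simp only: check_ords_def)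

lemma check_less: 
  fixes \<alpha> :: "'o::wellorder"
  assumes "countable {..<\<alpha>}" "p \<in> P" "\<beta> < \<alpha>"
  shows "p \<tturnstile> ck \<beta> \<^bold>\<in> ck \<alpha>"
  using representsI[OF represents_check[OF assms(1,2)]] assms(3) by simp

text \<open>If \<open>\<alpha> \<in> \<alpha>\<close> is forced, then a stronger condition forces \<open>\<alpha> = \<beta>\<close> for some \<open>\<beta> < \<alpha>\<close>, hence \<open>\<beta> \<in> \<beta>\<close>.\<close>
lemma check_not_mem_self:
  fixes \<alpha> :: "'o::wellorder"
  assumes "\<And>\<alpha>::'o. countable {..<\<alpha>}" "p \<in> P"
  shows "\<not> p \<tturnstile> ck \<alpha> \<^bold>\<in> ck \<alpha>"
  using assms(2)
proof (induction \<alpha> arbitrary: p rule: less_induct)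
  case (less \<alpha>)
  show ?case
  proof
    assume m: "p \<tturnstile> ck \<alpha> \<^bold>\<in> ck \<alpha>"
    obtain q \<beta> where q: "q \<in> below p" "\<beta> \<in> {..<\<alpha>}" "q \<tturnstile> ck \<alpha> \<^bold>= ck \<beta>"
      using represents_check[OF assms(1) less.prems] m less.prems by (rule representsE)
    note qP = below_P[OF q(1)]
    have "q \<tturnstile> ck \<beta> \<^bold>\<in> ck \<beta>"
      using mem_cong_right[OF q(3) check_less[OF assms(1) qP]] q(2) by simp
    then show False using less.IH[OF _ qP] q(2) by simp
  qed
qed

lemma check_eq_iff:
  fixes \<alpha> \<beta> :: "'o::wellorder"
  assumes "\<And>\<alpha>::'o. countable {..<\<alpha>}" "p \<in> P" "p \<tturnstile> ck \<alpha> \<^bold>= ck \<beta>"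
  shows "\<alpha> = \<beta>"
proof (rule ccontr)
  assume "\<alpha> \<noteq> \<beta>"
  then consider "\<alpha> < \<beta>" | "\<beta> < \<alpha>" by fastforce
  then show False
  proof cases
    case 1
    from mem_cong_left[OF assms(3) check_less[OF assms(1,2) 1]] show False
      using check_not_mem_self[OF assms(1,2)] by blast
  next
    case 2
    from mem_cong_left[OF eq_sym[OF assms(3)] check_less[OF assms(1,2) 2]] show False
      using check_not_mem_self[OF assms(1,2)] by blast
  qed
qed

lemma discrete_check: "(\<And>\<alpha>::'o::wellorder. countable {..<\<alpha>}) \<Longrightarrow> discrete ck (S :: 'o set)"
  unfolding discrete_def using check_eq_iff by blast

lemma represents_ordinal:
  fixes S :: "'o::wellorder set"
  assumes cnt: "\<And>\<alpha>::'o. countable {..<\<alpha>}" and A: "represents p ck S A"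
    and down: "\<And>a b. a \<in> S \<Longrightarrow> b < a \<Longrightarrow> b \<in> S"
  shows "p \<tturnstile> is_ordinal A"
proof -
  have 1: "r \<tturnstile> y \<^bold>\<in> A" if q: "q \<in> below p" and x: "q \<tturnstile> x \<^bold>\<in> A" and r: "r \<in> below q" and y: "r \<tturnstile> y \<^bold>\<in> x" for q x r y
  proof (rule forces_local)
    fix r1 assume r1: "r1 \<in> below r"
    have r1q: "r1 \<in> below q" using r1 r by (rule below_trans)
    obtain r2 a where r2: "r2 \<in> below r1" "a \<in> S" "r2 \<tturnstile> x \<^bold>= ck a"
      using represents_mono[OF A below_trans[OF r1q q]] forces_mono[OF x r1q] below_P[OF r1] by (rule representsE)
    have r2r: "r2 \<in> below r" using r2(1) r1 by (rule below_trans)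
    note r2P = below_P[OF r2(1)]
    obtain r3 b where r3: "r3 \<in> below r2" "b \<in> {..<a}" "r3 \<tturnstile> y \<^bold>= ck b"
      using represents_check[OF cnt r2P] mem_cong_right[OF r2(3) forces_mono[OF y r2r]] r2P by (rule representsE)
    have "b \<in> S" using down[OF r2(2)] r3(2) by simp
    moreover have "r3 \<in> below p" using r3(1) r2r r q below_trans by blast
    ultimately have "r3 \<tturnstile> ck b \<^bold>\<in> A" using representsI[OF A] forces_mono by blast
    then have "r3 \<tturnstile> y \<^bold>\<in> A" using mem_cong_left[OF eq_sym[OF r3(3)]] by blast
    then show "\<exists>r\<in>below r1. r \<tturnstile> y \<^bold>\<in> A" using below_trans[OF r3(1) r2(1)] by blast
  qed
  have 2: "q \<tturnstile> (x \<^bold>\<in> y \<^bold>\<or> x \<^bold>= y \<^bold>\<or> y \<^bold>\<in> x)" if q: "q \<in> below p" and x: "q \<tturnstile> x \<^bold>\<in> A" "q \<tturnstile> y \<^bold>\<in> A" for q x y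
  proof (rule forces_local)
    fix r1 assume r1: "r1 \<in> below q"
    have r1p: "r1 \<in> below p" using r1 q by (rule below_trans)
    obtain r2 a where r2: "r2 \<in> below r1" "a \<in> S" "r2 \<tturnstile> x \<^bold>= ck a"
      using represents_mono[OF A r1p] forces_mono[OF x(1) r1] below_P[OF r1] by (rule representsE)
    obtain r3 b where r3: "r3 \<in> below r2" "b \<in> S" "r3 \<tturnstile> y \<^bold>= ck b"
      using represents_mono[OF A below_trans[OF r2(1) r1p]] forces_mono[OF x(2) below_trans[OF r2(1) r1]]
        below_P[OF r2(1)] by (rule representsE)
    note r3P = below_P[OF r3(1)] and xa = eq_sym[OF forces_mono[OF r2(3) r3(1)]] and yb = eq_sym[OF r3(3)]
    have "r3 \<tturnstile> (x \<^bold>\<in> y \<^bold>\<or> x \<^bold>= y \<^bold>\<or> y \<^bold>\<in> x)"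
    proof (cases a b rule: linorder_cases)
      case less
      from mem_cong_left[OF xa mem_cong_right[OF yb check_less[OF cnt r3P less]]]
      show ?thesis by (rule forces_DisjI1)
    next
      case equal
      with eq_trans[OF eq_sym[OF xa] yb[unfolded equal[symmetric]]] 
      have "r3 \<tturnstile> x \<^bold>= y" by simp
      then show ?thesis by (intro forces_DisjI2 forces_DisjI1)
    next
      case greater
      from mem_cong_left[OF yb mem_cong_right[OF xa check_less[OF cnt r3P greater]]]
      show ?thesis by (intro forces_DisjI2)
    qed
    then show "\<exists>r\<in>below r1. r \<tturnstile> (x \<^bold>\<in> y \<^bold>\<or> x \<^bold>= y \<^bold>\<or> y \<^bold>\<in> x)" using below_trans[OF r3(1) r2(1)] by blast
  qed
  show ?thesis
    unfolding is_ordinal_def is_subset_def forces_Conj_iff forces_All_iff forces_Imp_iff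
    using 1 2 by blast
qed

lemma countable_nat_below: "countable {..<n :: nat}" by simp

text \<open>All values of a name for a bijection from \<open>k < n\<close> onto \<open>n\<close> are decided by one condition, and the
  decided values would map \<open>k\<close> onto \<open>n\<close> in the ground model.\<close>
lemma finite_ordinal_is_cardinal:
  fixes n :: nat
  assumes p: "p \<in> P"
  shows "p \<tturnstile> is_cardinal (ck n)"
proof -
  have "p \<tturnstile> is_ordinal (ck n)"
    by (rule represents_ordinal[OF countable_nat_below represents_check[OF countable_nat_below p]]) auto
  moreover have False if q: "q \<in> below p" "q \<tturnstile> b \<^bold>\<in> ck n" and r: "r \<in> below q" "r \<tturnstile> (\<^bold>\<exists>F. is_bijection F b (ck n))" for b q r
  proof -
    obtain r1 F where r1: "r1 \<in> below r" "r1 \<tturnstile> is_bijection F b (ck n)"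
      using below_P[OF r(1)] r(2) by (rule forces_ExE)
    have r1q: "r1 \<in> below q" using r1(1) r(1) by (rule below_trans)
    note r1P = below_P[OF r1(1)]
    obtain s k where s: "s \<in> below r1" "k \<in> {..<n}" "s \<tturnstile> b \<^bold>= ck k"
      using represents_check[OF countable_nat_below r1P] forces_mono[OF q(2) r1q] r1P by (rule representsE)
    note sP = below_P[OF s(1)]
    have b: "represents s ck {..<k} b"
      using eq_sym[OF s(3)] represents_check[OF countable_nat_below sP] by (rule represents_cong)
    have F: "s \<tturnstile> is_function F b (ck n)"
      and surj: "s \<tturnstile> (\<^bold>\<forall>y. y \<^bold>\<in> ck n \<^bold>\<longrightarrow> (\<^bold>\<exists>x. maps_to F x y))"
      using forces_mono[OF r1(2) s(1)] unfolding is_bijection_def is_injection_def by auto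
    have "\<exists>t\<in>below s. \<exists>\<phi>. \<forall>i\<in>{..<k}. \<phi> i \<in> {..<n} \<and> t \<tturnstile> maps_to F (ck i) (ck (\<phi> i))"
      by (rule function_decide[OF finite_lessThan representsI[OF b] F represents_check[OF countable_nat_below sP] sP])
    then obtain t \<phi> where t: "t \<in> below s" "\<forall>i\<in>{..<k}. \<phi> i \<in> {..<n} \<and> t \<tturnstile> maps_to F (ck i) (ck (\<phi> i))"
      by blast
    note tP = below_P[OF t(1)]
    have "{..<n} \<subseteq> \<phi> ` {..<k}"
    proof
      fix j assume j: "j \<in> {..<n}"
      then have "t \<tturnstile> ck j \<^bold>\<in> ck n" using check_less[OF countable_nat_below tP] by simp
      then have "t \<tturnstile> (\<^bold>\<exists>x. maps_to F x (ck j))"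
        using surj t(1) unfolding forces_All_iff forces_Imp_iff by blast
      with tP obtain u x where u: "u \<in> below t" "u \<tturnstile> maps_to F x (ck j)" by (rule forces_ExE)
      have us: "u \<in> below s" using u(1) t(1) by (rule below_trans)
      note uP = below_P[OF u(1)]
      obtain v i where v: "v \<in> below u" "i \<in> {..<k}" "v \<tturnstile> x \<^bold>= ck i"
        using represents_mono[OF b us] function_rel(1)[OF forces_mono[OF F us] u(2) uP] uP by (rule representsE)
      note vP = below_P[OF v(1)]
      have "v \<tturnstile> ck (\<phi> i) \<^bold>= ck j"
      proof (rule function_unique[OF _ _ _ vP])
        show "v \<tturnstile> is_function F b (ck n)" using forces_mono[OF F below_trans[OF v(1) us]] .
        show "v \<tturnstile> maps_to F (ck i) (ck (\<phi> i))" using t(2) v(2) forces_mono below_trans[OF v(1) u(1)] by blast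
        show "v \<tturnstile> maps_to F (ck i) (ck j)" using forces_mono[OF u(2) v(1)] v(3) eq_refl by (rule maps_to_cong)
      qed
      then have "\<phi> i = j" using check_eq_iff[OF countable_nat_below vP] by blast
      then show "j \<in> \<phi> ` {..<k}" using v(2) by blast
    qed
    then have "n \<le> k" using surj_card_le[of "{..<k}" "{..<n}" \<phi>] by simp
    with s(2) show False by simp
  qed
  ultimately show ?thesis
    unfolding is_cardinal_def forces_Conj_iff forces_All_iff forces_Imp_iff forces_Neg_iff by blast
qed

end

section \<open>Odd circuits and bipartite graphs\<close>

text \<open>Walks are powers of this relation. Unlike paths they can be concatenated, reversed and mapped
  by homomorphisms.\<close>
definition adj :: "'a set set \<Rightarrow> ('a \<times> 'a) set" where "adj X = {(a, b). {a, b} \<in> X}"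

lemma relpow_hom: "(a, b) \<in> R ^^ n \<Longrightarrow> (\<And>a b. (a, b) \<in> R \<Longrightarrow> (F a, F b) \<in> S) \<Longrightarrow> (F a, F b) \<in> S ^^ n"
  by (induction n arbitrary: b) (simp, fastforce)

lemma adj_relpow_sym: "(a, b) \<in> adj X ^^ n \<Longrightarrow> (b, a) \<in> adj X ^^ n"
proof (induction n arbitrary: b)
  case (Suc n)
  then obtain c where "(a, c) \<in> adj X ^^ n" "(c, b) \<in> adj X" by auto
  then have "(c, a) \<in> adj X ^^ n" "(b, c) \<in> adj X" using Suc.IH by (auto simp: adj_def insert_commute)
  then show ?case by (metis relpow_Suc_I2)
qed simp

lemma circuit_iff: "circuit X vs \<longleftrightarrow>
    distinct vs \<and> vs \<noteq> [] \<and> successively (\<lambda>a b. {a, b} \<in> X) vs \<and> {last vs, hd vs} \<in> X"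
  by (auto simp: circuit_def edge_path_def successively_conv_nth)

lemma successively_relpow:
  "successively (\<lambda>a b. {a, b} \<in> X) vs \<Longrightarrow> vs \<noteq> [] \<Longrightarrow> (hd vs, last vs) \<in> adj X ^^ (length vs - 1)"
proof (induction vs)
  case (Cons a vs)
  show ?case
  proof (cases vs)
    case (Cons b ws)
    then have "(b, last vs) \<in> adj X ^^ length ws" "(a, b) \<in> adj X" using Cons.IH Cons.prems by (auto simp: adj_def)
    then show ?thesis using Cons by (auto intro: relpow_Suc_I2 simp del: relpow.simps)
  qed simp
qed simp

lemma circuit_closed_walk: "circuit X vs \<Longrightarrow> (hd vs, hd vs) \<in> adj X ^^ length vs"
proof -
  assume "circuit X vs"
  then have "(hd vs, last vs) \<in> adj X ^^ (length vs - 1)" "(last vs, hd vs) \<in> adj X" "length vs \<noteq> 0"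
    using successively_relpow[of X vs] by (auto simp: circuit_iff adj_def)
  then show ?thesis using relpow_Suc_I by (cases "length vs") auto
qed

text \<open>A repeated vertex splits a closed walk into two shorter closed walks, and the length of one of
  them is odd.\<close>
lemma odd_closed_list_circuit:
  "vs \<noteq> [] \<Longrightarrow> successively (\<lambda>a b. {a, b} \<in> X) vs \<Longrightarrow> {last vs, hd vs} \<in> X \<Longrightarrow> odd (length vs) \<Longrightarrow>
     \<exists>ws. circuit X ws \<and> odd (length ws) \<and> length ws \<le> length vs"
proof (induction vs rule: length_induct)
  case (1 vs)
  show ?case
  proof (cases "distinct vs")
    case True
    then show ?thesis using 1 unfolding circuit_iff by blast
  next
    case False
    then obtain as x bs cs where vs: "vs = as @ [x] @ bs @ [x] @ cs"
      using not_distinct_decomp by blast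
    let ?w1 = "x # bs" and ?w2 = "as @ x # cs"
    have len: "length vs = length ?w1 + length ?w2" using vs by simp
    have s1: "successively (\<lambda>a b. {a, b} \<in> X) ?w1" "{last ?w1, hd ?w1} \<in> X"
      using 1(3) unfolding vs by (auto simp: successively_append_iff successively_Cons hd_append split: if_splits)
    have s2: "successively (\<lambda>a b. {a, b} \<in> X) ?w2" "{last ?w2, hd ?w2} \<in> X"
      using 1(3,4) unfolding vs by (auto simp: successively_append_iff successively_Cons hd_append split: if_splits)
    from 1(5) len consider "odd (length ?w1)" | "odd (length ?w2)" by fastforce
    then show ?thesis
    proof cases
      case 1
      with "1.IH"[rule_format, of ?w1] s1 len show ?thesis by fastforce
    next
      case 2
      with "1.IH"[rule_format, of ?w2] s2 len show ?thesis by fastforce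
    qed
  qed
qed

lemma odd_closed_walk_circuit:
  assumes "(x, x) \<in> adj X ^^ n" "odd n"
  obtains vs where "circuit X vs" "odd (length vs)" "length vs \<le> n"
proof -
  obtain F where F: "F 0 = x" "F n = x" "\<forall>i<n. (F i, F (Suc i)) \<in> adj X"
    using assms(1) unfolding relpow_fun_conv by blast
  have n: "n > 0" using assms(2) odd_pos by blast
  let ?vs = "map F [0..<n]"
  have "successively (\<lambda>a b. {a, b} \<in> X) ?vs"
    using F(3) by (auto simp: successively_conv_nth adj_def)
  moreover have "{last ?vs, hd ?vs} \<in> X"
  proof -
    have "hd ?vs = F n" "last ?vs = F (n - 1)" using n F by (simp_all add: hd_map last_map)
    then show ?thesis using F(3) n by (auto simp: adj_def dest: spec[of _ "n - 1"])
  qed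
  ultimately show ?thesis using odd_closed_list_circuit[of ?vs X] n assms(2) that by auto
qed

lemma circuit_rotate1: "circuit X vs \<Longrightarrow> circuit X (rotate1 vs)"
proof (cases vs)
  case (Cons a as)
  assume "circuit X vs"
  with Cons show ?thesis
    by (cases as) (auto simp: circuit_iff successively_append_iff successively_Cons split: if_splits)
qed simp

lemma circuit_rotate: "circuit X vs \<Longrightarrow> circuit X (rotate m vs)"
  by (induction m) (auto simp: rotate_Suc circuit_rotate1)

text \<open>Rotating the circuit makes \<open>{x, y}\<close> the edge that closes it. As the length is at least 3, this
  edge does not occur a second time among the remaining ones.\<close>
lemma circuit_edge_cut:
  assumes vs: "circuit X vs" and len: "length vs \<ge> 3" and e: "\<not> circuit (X - {{x, y}}) vs"
  shows "(x, y) \<in> adj (X - {{x, y}}) ^^ (length vs - 1)"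
proof -
  let ?n = "length vs"
  have "\<exists>m. {last (rotate m vs), hd (rotate m vs)} = {x, y}"
  proof (cases "{last vs, hd vs} = {x, y}")
    case True
    then show ?thesis by (intro exI[of _ 0]) simp
  next
    case False
    with vs e obtain k where k: "Suc k < ?n" "{vs ! k, vs ! Suc k} = {x, y}"
      unfolding circuit_iff successively_conv_nth by auto
    have "hd (rotate (Suc k) vs) = vs ! Suc k"
      using k len by (subst hd_rotate_conv_nth) auto
    moreover have "last (rotate (Suc k) vs) = vs ! k"
    proof -
      have ne: "vs \<noteq> []" using len by auto
      have "last (rotate (Suc k) vs) = rotate (Suc k) vs ! (?n - 1)"
        using ne by (simp add: last_conv_nth)
      also have "\<dots> = vs ! ((Suc k + (?n - 1)) mod ?n)" using ne by (intro nth_rotate) simp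
      also have "Suc k + (?n - 1) = k + ?n" using ne by (cases vs) auto
      finally show ?thesis using k by simp
    qed
    ultimately show ?thesis using k(2) by metis
  qed
  then obtain m where m: "{last (rotate m vs), hd (rotate m vs)} = {x, y}" by blast
  define ws where "ws = rotate m vs"
  have ws: "circuit X ws" "length ws = ?n" "ws \<noteq> []"
    using circuit_rotate[OF vs] len unfolding ws_def by auto
  have "{ws ! j, ws ! Suc j} \<noteq> {x, y}" if j: "Suc j < ?n" for j
  proof
    assume "{ws ! j, ws ! Suc j} = {x, y}"
    then have "{ws ! j, ws ! Suc j} = {ws ! (?n - 1), ws ! 0}"
      using m ws by (simp add: ws_def last_conv_nth hd_conv_nth)
    then have "ws ! Suc j = ws ! 0 \<or> ws ! j = ws ! 0 \<and> ws ! Suc j = ws ! (?n - 1)"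
      unfolding doubleton_eq_iff by blast
    moreover have inj: "i = k" if "i < ?n" "k < ?n" "ws ! i = ws ! k" for i k
      using ws that by (simp add: circuit_iff nth_eq_iff_index_eq)
    have "ws ! Suc j \<noteq> ws ! 0" using inj[of "Suc j" 0] j by force
    ultimately have "ws ! j = ws ! 0" "ws ! Suc j = ws ! (?n - 1)" by blast+
    then have "j = 0" "Suc j = ?n - 1" using inj[of j 0] inj[of "Suc j" "?n - 1"] j by linarith+
    then show False using len by linarith
  qed
  then have "successively (\<lambda>a b. {a, b} \<in> X - {{x, y}}) ws"
    using ws unfolding circuit_iff successively_conv_nth by auto
  then have w: "(hd ws, last ws) \<in> adj (X - {{x, y}}) ^^ (?n - 1)"
    using successively_relpow ws by metis
  from m have "hd ws = x \<and> last ws = y \<or> hd ws = y \<and> last ws = x"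
    unfolding ws_def by (auto simp: doubleton_eq_iff)
  then show ?thesis using w adj_relpow_sym by metis
qed

text \<open>Color by the parity of the lengths of walks from a fixed vertex of the connected component: two
  adjacent vertices with the same color would lie on an odd closed walk.\<close>
lemma two_coloring:
  assumes ev: "\<And>vs. circuit X vs \<Longrightarrow> even (length vs)"
  shows "\<exists>col :: 'a \<Rightarrow> bool. \<forall>a b. {a, b} \<in> X \<longrightarrow> col a \<noteq> col b"
proof -
  let ?R = "adj X"
  have no_odd: "even n" if "(x, x) \<in> ?R ^^ n" for x n
    using odd_closed_walk_circuit[OF that] ev by blast
  define root where "root x = (SOME y. (y, x) \<in> ?R\<^sup>*)" for x
  define col where "col x = (\<exists>n. even n \<and> (root x, x) \<in> ?R ^^ n)" for x
  have root: "(root x, x) \<in> ?R\<^sup>*" for x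
    unfolding root_def by (rule someI[of _ x]) simp
  have "col a \<noteq> col b" if "{a, b} \<in> X" for a b
  proof
    assume eq: "col a = col b"
    have ab: "(a, b) \<in> ?R" "(b, a) \<in> ?R" using that by (auto simp: adj_def insert_commute)
    have "(y, a) \<in> ?R\<^sup>* \<longleftrightarrow> (y, b) \<in> ?R\<^sup>*" for y using ab by (meson rtrancl.rtrancl_into_rtrancl)
    then have r: "root a = root b" unfolding root_def by simp
    obtain k l where kl: "(root a, a) \<in> ?R ^^ k" "(root a, b) \<in> ?R ^^ l" "even k \<longleftrightarrow> even l"
    proof (cases "col a")
      case True
      then show ?thesis using eq that r unfolding col_def by metis
    next
      case False
      obtain k l where "(root a, a) \<in> ?R ^^ k" "(root b, b) \<in> ?R ^^ l"
        using root rtrancl_power by metis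
      then show ?thesis using eq False that r unfolding col_def by metis
    qed
    have "(root a, b) \<in> ?R ^^ Suc k" using kl(1) ab(1) by (rule relpow_Suc_I)
    then have "(root a, root a) \<in> ?R ^^ (Suc k + l)"
      using adj_relpow_sym[OF kl(2)] by (auto simp only: relpow_add)
    then show False using no_odd kl(3) by fastforce
  qed
  then show ?thesis by blast
qed

text \<open>In a graph where every vertex has at most one smaller neighbor, this gives a vertex and its
  smaller neighbor different colors.\<close>
function forest_color :: "'a::wellorder set set \<Rightarrow> 'a \<Rightarrow> bool" where
  "forest_color X a = (\<exists>x\<in>{..<a}. {x, a} \<in> X \<and> \<not> forest_color X x)"
  by pat_completeness auto
termination
  by (relation "inv_image {(b, a). b < a} snd") (auto simp: wf)

declare forest_color.simps [simp del]

lemma forest_coloring: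
  fixes X :: "'a::wellorder set set"
  assumes uniq: "\<And>x y a. {x, a} \<in> X \<Longrightarrow> {y, a} \<in> X \<Longrightarrow> x < a \<Longrightarrow> y < a \<Longrightarrow> x = y"
    and e: "{a, b} \<in> X" "a \<noteq> b"
  shows "forest_color X a \<noteq> forest_color X b"
proof -
  have *: "forest_color X b \<noteq> forest_color X a" if "{a, b} \<in> X" "a < b" for a b
    unfolding forest_color.simps[of X b] using that uniq by fastforce
  from e(2) consider "a < b" | "b < a" by fastforce
  then show ?thesis using * e(1) by cases (metis insert_commute)+
qed

section \<open>Conditions\<close>

text \<open>Requirement (2) for paths of length 1. For \<open>r\<close> it is enough to take the color of the edge, which
  gives the largest bound \<open>f r\<close> because \<open>f\<close> is increasing.\<close>
definition chain_linked :: "(nat \<Rightarrow> nat) \<Rightarrow> cond \<Rightarrow> bool" where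
  "chain_linked f p \<longleftrightarrow>
     (\<forall>x y j. {x, y} \<in> g_of p \<and> 1 \<le> j \<and> j + 1 \<le> f (c_of p {x, y}) \<longrightarrow> h_interleaved p 1 j x y)"

text \<open>With \<open>z\<close> the vertex after \<open>x\<close>, each edge of the walk contributes one step on either side of
  \<open>h\<^bsub>j - i\<^esub>(x) < h\<^bsub>j - i + 1\<^esub>(z) < \<dots> < h\<^sub>j(y) < \<dots> < h\<^bsub>j + i - 1\<^esub>(z) < h\<^bsub>j + i\<^esub>(x)\<close>;
  the indices stay in the range where the edges are controlled since \<open>i \<le> j \<le> f r - i\<close>.\<close>
lemma interleaved_walk:
  assumes E: "chain_linked f p" and f: "mono f"
    and w: "(x, y) \<in> adj (Y_of p r) ^^ i" and "1 \<le> i" "i \<le> j" "j + i \<le> f r"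
  shows "h_interleaved p i j x y"
  using w assms(4-6)
proof (induction i arbitrary: x)
  case (Suc i)
  obtain z where z: "(x, z) \<in> adj (Y_of p r)" "(z, y) \<in> adj (Y_of p r) ^^ i"
    using Suc.prems(1) by (metis relpow_Suc_D2)
  have e: "{x, z} \<in> g_of p" "r \<le> c_of p {x, z}" using z(1) by (auto simp: adj_def Y_of_def)
  then have fr: "f r \<le> f (c_of p {x, z})" using f by (simp add: monoD)
  have link: "h_interleaved p 1 k x z" if "1 \<le> k" "k + 1 \<le> f r" for k
    using E e(1) that fr unfolding chain_linked_def by (meson le_trans)
  show ?case
  proof (cases "i = 0")
    case True
    then show ?thesis using link Suc.prems z(2) by auto
  next
    case False
    then obtain a b d where IH: "h_of p (j - i) z = Some a" "h_of p j y = Some b" "h_of p (j + i) z = Some d"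
        "a < b" "b < d"
      using Suc.IH[OF z(2)] Suc.prems unfolding h_interleaved_def by auto
    have "h_interleaved p 1 (j - i) x z" "h_interleaved p 1 (j + i) x z"
      using link[of "j - i"] link[of "j + i"] Suc.prems(3,4) by simp_all
    then obtain a' d' where "h_of p (j - i - 1) x = Some a'" "a' < a" "h_of p (j + i + 1) x = Some d'" "d < d'"
      using IH unfolding h_interleaved_def by auto
    then show ?thesis using IH unfolding h_interleaved_def by auto
  qed
qed simp

lemma connected_by_path_walk: "connected_by_path X i x y \<Longrightarrow> (x, y) \<in> adj X ^^ i"
proof -
  assume "connected_by_path X i x y"
  then obtain vs where vs: "edge_path X vs" "length vs = Suc i" "hd vs = x" "last vs = y"
    unfolding connected_by_path_def by blast
  then have "successively (\<lambda>a b. {a, b} \<in> X) vs" "vs \<noteq> []"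
    by (auto simp: edge_path_def successively_conv_nth)
  from successively_relpow[OF this] vs show ?thesis by simp
qed

text \<open>The requirements on a condition that do not mention \<open>r\<close>.\<close>
definition basic_cond :: "(omega1 \<Rightarrow> omega1 set) \<Rightarrow> cond \<Rightarrow> bool" where
  "basic_cond C p \<longleftrightarrow>
     finite (s_of p) \<and> u_of p \<subseteq> s_of p \<and> (\<forall>\<alpha>\<in>u_of p. limit_ordinal \<alpha>) \<and>
     (\<forall>e\<in>g_of p. e \<subseteq> u_of p \<and> card e = 2) \<and>
     m_of p \<in> u_of p \<rightarrow>\<^sub>E UNIV \<and>
     (\<forall>i \<alpha>. h_of p i \<alpha> = None \<longleftrightarrow> \<alpha> \<notin> u_of p \<or> i \<ge> m_of p \<alpha>) \<and>
     (\<forall>\<alpha>\<in>u_of p. h_separated C p \<alpha>) \<and>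
     c_of p \<in> g_of p \<rightarrow>\<^sub>E UNIV \<and>
     (\<forall>x y \<alpha>. {x, \<alpha>} \<in> g_of p \<and> {y, \<alpha>} \<in> g_of p \<and> x \<noteq> y \<and> x < \<alpha> \<and> y < \<alpha> \<longrightarrow>
        c_of p {x, \<alpha>} \<noteq> c_of p {y, \<alpha>})"

lemma edge_subset: "basic_cond C p \<Longrightarrow> e \<in> g_of p \<Longrightarrow> e \<subseteq> u_of p"
  and edge_card: "basic_cond C p \<Longrightarrow> e \<in> g_of p \<Longrightarrow> card e = 2"
  and u_subset_s: "basic_cond C p \<Longrightarrow> u_of p \<subseteq> s_of p"
  and finite_s: "basic_cond C p \<Longrightarrow> finite (s_of p)"
  and h_None: "basic_cond C p \<Longrightarrow> h_of p i \<alpha> = None \<longleftrightarrow> \<alpha> \<notin> u_of p \<or> i \<ge> m_of p \<alpha>"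
  and h_sep: "basic_cond C p \<Longrightarrow> \<alpha> \<in> u_of p \<Longrightarrow> h_separated C p \<alpha>"
  unfolding basic_cond_def by blast+

text \<open>The description of conditions that all constructions below use. A new edge only requires to
  compare the ordinals attached to its two ends, and odd closed walks, in contrast to odd
  circuits, are preserved by homomorphisms.\<close>
lemma Qf_iff:
  assumes f: "mono f"
  shows "p \<in> Qf C f \<longleftrightarrow> basic_cond C p \<and>
    (\<forall>e\<in>g_of p. \<forall>\<alpha>\<in>e. c_of p e \<le> m_of p \<alpha>) \<and> chain_linked f p \<and>
    (\<forall>r n x. (x, x) \<in> adj (Y_of p r) ^^ n \<and> odd n \<longrightarrow> \<not> n \<le> f r)"
  (is "_ \<longleftrightarrow> ?B \<and> ?M \<and> ?H \<and> ?O")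
proof -
  have Q: "p \<in> Qf C f \<longleftrightarrow> ?B \<and> (\<forall>r.
        (\<forall>\<alpha>\<in>u_of p. (\<exists>e\<in>g_of p. \<alpha> \<in> e \<and> c_of p e \<ge> r) \<longrightarrow> m_of p \<alpha> \<ge> r) \<and>
        (\<forall>i x y. i \<ge> 1 \<and> connected_by_path (Y_of p r) i x y \<longrightarrow>
           (\<forall>j. i \<le> j \<and> j + i \<le> f r \<longrightarrow> h_interleaved p i j x y)) \<and>
        (\<forall>vs. circuit (Y_of p r) vs \<and> odd (length vs) \<longrightarrow> \<not> length vs \<le> f r))"
    (is "_ \<longleftrightarrow> _ \<and> ?R") unfolding Qf_def basic_cond_def by simp
  have "?R \<longleftrightarrow> ?M \<and> ?H \<and> ?O" if B: ?B
  proof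
    assume R: ?R
    have R1: "r \<le> m_of p \<alpha>" if "\<alpha> \<in> u_of p" "e \<in> g_of p" "\<alpha> \<in> e" "r \<le> c_of p e" for r \<alpha> e
      using spec[OF R, of r] that by meson
    have R2: "h_interleaved p i j x y"
      if "i \<ge> 1" "connected_by_path (Y_of p r) i x y" "i \<le> j" "j + i \<le> f r" for r i x y j
      using spec[OF R, of r] that by meson
    have R3: "\<not> length vs \<le> f r" if "circuit (Y_of p r) vs" "odd (length vs)" for r vs
      using spec[OF R, of r] that by meson
    have ?M using R1 edge_subset[OF B] by blast
    moreover have ?H unfolding chain_linked_def
    proof (intro allI impI; elim conjE)
      fix x y j assume e: "{x, y} \<in> g_of p" "1 \<le> j" "j + 1 \<le> f (c_of p {x, y})"
      then have "x \<noteq> y" using edge_card[OF B] by fastforce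
      with e have "connected_by_path (Y_of p (c_of p {x, y})) 1 x y"
        unfolding connected_by_path_def edge_path_def Y_of_def by (intro exI[of _ "[x, y]"]) auto
      then show "h_interleaved p 1 j x y" using R2 e(2,3) by blast
    qed
    moreover have ?O
    proof (intro allI impI notI; elim conjE)
      fix r n x assume "(x, x) \<in> adj (Y_of p r) ^^ n" "odd n" "n \<le> f r"
      then show False using R3 by (metis odd_closed_walk_circuit le_trans)
    qed
    ultimately show "?M \<and> ?H \<and> ?O" by blast
  next
    assume A: "?M \<and> ?H \<and> ?O"
    show ?R
    proof (intro allI conjI impI ballI; (elim conjE bexE)?)
      fix r \<alpha> e assume "e \<in> g_of p" "\<alpha> \<in> e" "r \<le> c_of p e"
      then show "r \<le> m_of p \<alpha>" using A le_trans by blast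
    next
      fix r i x y j assume "1 \<le> i" "connected_by_path (Y_of p r) i x y" "i \<le> j" "j + i \<le> f r"
      then show "h_interleaved p i j x y"
        using interleaved_walk[OF _ f connected_by_path_walk] A by blast
    next
      fix r vs assume "circuit (Y_of p r) vs" "odd (length vs)"
      then show "\<not> length vs \<le> f r" using circuit_closed_walk A by blast
    qed
  qed
  then show ?thesis unfolding Q by (rule conj_cong[OF refl])
qed

lemma Qf_basic: "p \<in> Qf C f \<Longrightarrow> basic_cond C p"
  unfolding Qf_def basic_cond_def by simp

lemma h_Some: "basic_cond C p \<Longrightarrow> \<alpha> \<in> u_of p \<Longrightarrow> i < m_of p \<alpha> \<Longrightarrow> \<exists>a. h_of p i \<alpha> = Some a"
  using h_None[of C p i \<alpha>] by (cases "h_of p i \<alpha>") auto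

lemma edge_ne: "basic_cond C p \<Longrightarrow> {x, y} \<in> g_of p \<Longrightarrow> x \<noteq> y"
  using edge_card by fastforce

lemma finite_g: "basic_cond C p \<Longrightarrow> finite (g_of p)"
proof -
  assume p: "basic_cond C p"
  have "g_of p \<subseteq> Pow (s_of p)" using edge_subset[OF p] u_subset_s[OF p] by blast
  then show ?thesis using finite_s[OF p] finite_subset by blast
qed

lemma extends_refl: "basic_cond C p \<Longrightarrow> extends p p"
  unfolding extends_def basic_cond_def by blast

lemma extends_trans: "extends r q \<Longrightarrow> extends q p \<Longrightarrow> extends r p"
proof -
  assume A: "extends r q" and B: "extends q p"
  have s: "s_of p \<subseteq> s_of q" "s_of q \<subseteq> s_of r" using A B by (simp_all add: extends_def)
  have u: "u_of p = u_of q \<inter> s_of p" "u_of q = u_of r \<inter> s_of q" using A B by (simp_all add: extends_def)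
  have g: "g_of p = {e \<in> g_of q. e \<subseteq> s_of p}" "g_of q = {e \<in> g_of r. e \<subseteq> s_of q}"
    using A B by (simp_all add: extends_def)
  have "u_of p = u_of r \<inter> s_of p" using s u by blast
  moreover have "g_of p = {e \<in> g_of r. e \<subseteq> s_of p}" using s g by blast
  moreover have "m_of p \<alpha> \<le> m_of r \<alpha>" "i < m_of p \<alpha> \<Longrightarrow> h_of r i \<alpha> = h_of p i \<alpha>" if "\<alpha> \<in> u_of p" for \<alpha> i
  proof -
    have "\<alpha> \<in> u_of q" using that u by blast
    then have m: "m_of p \<alpha> \<le> m_of q \<alpha>" "m_of q \<alpha> \<le> m_of r \<alpha>"
      "\<And>i. i < m_of p \<alpha> \<Longrightarrow> h_of q i \<alpha> = h_of p i \<alpha>" "\<And>i. i < m_of q \<alpha> \<Longrightarrow> h_of r i \<alpha> = h_of q i \<alpha>"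
      using A B that by (simp_all add: extends_def)
    then show "m_of p \<alpha> \<le> m_of r \<alpha>" "i < m_of p \<alpha> \<Longrightarrow> h_of r i \<alpha> = h_of p i \<alpha>" by auto
  qed
  moreover have "c_of r e = c_of p e" if "e \<in> g_of p" for e
  proof -
    have "e \<in> g_of q" using that g by blast
    then show ?thesis using A B that by (simp add: extends_def)
  qed
  ultimately show "extends r p" using s by (simp add: extends_def)
qed

lemma top_cond_Qf:
  assumes f: "mono f"
  shows "top_cond \<in> Qf C f"
proof -
  have "adj (Y_of top_cond r) = {}" for r by (simp add: adj_def Y_of_def top_cond_def)
  then have "\<not> (x, x) \<in> adj (Y_of top_cond r) ^^ n" if "odd n" for x r n
    using odd_pos[OF that] by (simp add: relpow_empty)
  moreover have "basic_cond C top_cond" by (simp add: basic_cond_def top_cond_def)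
  moreover have "chain_linked f top_cond" by (simp add: chain_linked_def top_cond_def)
  moreover have "g_of top_cond = {}" by (simp add: top_cond_def)
  ultimately show ?thesis unfolding Qf_iff[OF f] by blast
qed

lemma extends_top:
  assumes p: "basic_cond C p"
  shows "extends p top_cond"
proof -
  have "e \<noteq> {}" if "e \<in> g_of p" for e using edge_card[OF p that] by auto
  then show ?thesis by (auto simp: extends_def top_cond_def)
qed

text \<open>Extensions keep \<open>g \<inter> [s]\<^sup>2\<close>. Therefore enlarging \<open>s\<close>, but not \<open>u\<close>, makes the
  new elements isolated vertices of the generic graph; in particular it decides the graph on \<open>w\<close>.\<close>
lemma extend_s:
  assumes f: "mono f" and p: "p \<in> Qf C f" and w: "finite w"
  shows "\<exists>q\<in>Qf C f. extends q p \<and> w \<subseteq> s_of q"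
proof (intro bexI conjI)
  let ?q = "p\<lparr>s_of := s_of p \<union> w\<rparr>"
  show "?q \<in> Qf C f" using p w
    unfolding Qf_iff[OF f] basic_cond_def chain_linked_def Y_of_def h_separated_def h_interleaved_def by auto
  show "extends ?q p" "w \<subseteq> s_of ?q" using Qf_basic[OF p] unfolding extends_def basic_cond_def by auto
qed

lemma add_vertex:
  assumes f: "mono f" and p: "p \<in> Qf C f" and \<alpha>: "limit_ordinal \<alpha>" "\<alpha> \<notin> s_of p"
  shows "\<exists>q\<in>Qf C f. extends q p \<and> \<alpha> \<in> u_of q"
proof (intro bexI conjI)
  let ?q = "p\<lparr>s_of := insert \<alpha> (s_of p), u_of := insert \<alpha> (u_of p), m_of := (m_of p)(\<alpha> := 0)\<rparr>"
  have b: "basic_cond C p" using p by (rule Qf_basic)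
  have \<alpha>u: "\<alpha> \<notin> u_of p" using \<alpha>(2) u_subset_s[OF b] by blast
  have h\<alpha>: "h_of p i \<alpha> = None" for i using \<alpha>u h_None[OF b] by blast
  have "h_separated C ?q \<beta>" if "\<beta> \<in> u_of ?q" for \<beta>
    using that h_sep[OF b, of \<beta>] h\<alpha> by (cases "\<beta> = \<alpha>") (auto simp: h_separated_def)
  moreover have "h_of ?q i \<beta> = None \<longleftrightarrow> \<beta> \<notin> u_of ?q \<or> i \<ge> m_of ?q \<beta>" for i \<beta>
    using h_None[OF b, of i \<beta>] h\<alpha> by auto
  moreover have "m_of ?q \<in> u_of ?q \<rightarrow>\<^sub>E UNIV" using b unfolding basic_cond_def by (auto simp: PiE_def extensional_def)
  ultimately have "basic_cond C ?q"
    using b \<alpha>(1) unfolding basic_cond_def by simp blast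
  moreover have "\<forall>e\<in>g_of ?q. \<forall>\<beta>\<in>e. c_of ?q e \<le> m_of ?q \<beta>"
    using p edge_subset[OF b] \<alpha>u unfolding Qf_iff[OF f] by auto
  moreover have "chain_linked f ?q" using p unfolding Qf_iff[OF f] chain_linked_def h_interleaved_def by simp
  moreover have "Y_of ?q = Y_of p" by (simp add: Y_of_def fun_eq_iff)
  ultimately show "?q \<in> Qf C f"
    using p unfolding Qf_iff[OF f] by simp
  show "extends ?q p" "\<alpha> \<in> u_of ?q"
    using b \<alpha> \<alpha>u unfolding extends_def basic_cond_def by auto
qed

lemma limit_ordinal_between: "limit_ordinal \<alpha> \<Longrightarrow> \<beta> < \<alpha> \<Longrightarrow> \<exists>\<gamma>. \<beta> < \<gamma> \<and> \<gamma> < \<alpha>"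
  unfolding limit_ordinal_def by blast

lemma h_interleaved_mono:
  "h_interleaved p i j x y \<Longrightarrow> (\<And>i \<beta> d. h_of p i \<beta> = Some d \<Longrightarrow> h_of q i \<beta> = Some d) \<Longrightarrow> h_interleaved q i j x y"
  unfolding h_interleaved_def by blast

text \<open>More values \<open>h\<^sub>i(\<alpha>)\<close> cannot violate (2), because (2) concerns only values that it already
  requires to be defined. There is room for a further value since \<open>C\<^sub>\<alpha>\<close> is cofinal in the limit \<open>\<alpha>\<close>.\<close>
lemma raise_m:
  assumes f: "mono f" and p: "p \<in> Qf C f" and \<alpha>: "\<alpha> \<in> u_of p"
    and C: "C \<alpha> \<subseteq> {..<\<alpha>}" "\<And>\<beta>. \<beta> < \<alpha> \<Longrightarrow> \<exists>\<gamma>\<in>C \<alpha>. \<beta> < \<gamma>"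
  shows "\<exists>q\<in>Qf C f. extends q p \<and> \<alpha> \<in> u_of q \<and> m_of q \<alpha> \<ge> N \<and> g_of q = g_of p \<and> c_of q = c_of p"
proof (induction N)
  case 0
  then show ?case using p \<alpha> extends_refl[OF Qf_basic[OF p]] by blast
next
  case (Suc N)
  then obtain q where q: "q \<in> Qf C f" "extends q p" "\<alpha> \<in> u_of q" "m_of q \<alpha> \<ge> N" "g_of q = g_of p" "c_of q = c_of p"
    by blast
  have b: "basic_cond C q" using q(1) by (rule Qf_basic)
  let ?m = "m_of q \<alpha>"
  have lim: "limit_ordinal \<alpha>" using b q(3) unfolding basic_cond_def by blast
  have sep: "h_separated C q \<alpha>" using b q(3) by (rule h_sep)
  have "\<exists>\<beta><\<alpha>. (?m = 0 \<longrightarrow> \<beta> = (LEAST \<gamma>. \<gamma> \<in> C \<alpha>)) \<and> (\<forall>i. ?m = Suc i \<longrightarrow> h_of q i \<alpha> = Some \<beta>)"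
  proof (cases ?m)
    case 0
    obtain \<gamma> where "\<gamma> \<in> C \<alpha>" using C(2) lim unfolding limit_ordinal_def by blast
    then have "(LEAST \<gamma>. \<gamma> \<in> C \<alpha>) \<in> C \<alpha>" by (rule LeastI)
    then show ?thesis using C(1) 0 by auto
  next
    case (Suc i)
    then obtain a where "h_of q i \<alpha> = Some a" using h_Some[OF b q(3)] by auto
    then show ?thesis using sep Suc unfolding h_separated_def by auto
  qed
  then obtain \<beta> where \<beta>: "\<beta> < \<alpha>" "?m = 0 \<longrightarrow> \<beta> = (LEAST \<gamma>. \<gamma> \<in> C \<alpha>)" "\<forall>i. ?m = Suc i \<longrightarrow> h_of q i \<alpha> = Some \<beta>"
    by (elim exE conjE) (rule that)
  obtain \<gamma> where \<gamma>: "\<gamma> \<in> C \<alpha>" "\<beta> < \<gamma>" using C(2) \<beta>(1) by blast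
  then obtain a where a: "\<gamma> < a" "a < \<alpha>" using C(1) limit_ordinal_between[OF lim] by auto
  let ?q = "q\<lparr>m_of := (m_of q)(\<alpha> := Suc ?m), h_of := (\<lambda>i \<beta>. if \<beta> = \<alpha> \<and> i = ?m then Some a else h_of q i \<beta>)\<rparr>"
  have hN: "h_of q i \<alpha> = None" if "i \<ge> ?m" for i using that h_None[OF b] by blast
  have "h_separated C ?q \<alpha>"
    unfolding h_separated_def
  proof (intro conjI allI impI; (elim conjE)?)
    fix i b assume "h_of ?q i \<alpha> = Some b"
    then show "b < \<alpha>" using a sep unfolding h_separated_def by (cases "i = ?m") auto
  next
    fix b assume "h_of ?q 0 \<alpha> = Some b"
    then show "(LEAST \<gamma>. \<gamma> \<in> C \<alpha>) < b"
      using a \<beta>(2) \<gamma>(2) sep unfolding h_separated_def by (cases "?m = 0") auto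
  next
    fix i b d assume h: "h_of ?q i \<alpha> = Some b" "h_of ?q (Suc i) \<alpha> = Some d"
    then have i: "Suc i \<le> ?m" using hN[of "Suc i"] by (cases "Suc i \<le> ?m") auto
    show "b < d" "\<exists>\<gamma>\<in>C \<alpha>. b < \<gamma> \<and> \<gamma> < d"
    proof (atomize (full), cases "Suc i = ?m")
      case True
      then have "b = \<beta>" "d = a" using h \<beta>(3) by auto
      then show "b < d \<and> (\<exists>\<gamma>\<in>C \<alpha>. b < \<gamma> \<and> \<gamma> < d)" using a \<gamma> by auto
    next
      case False
      then have "h_of q i \<alpha> = Some b" "h_of q (Suc i) \<alpha> = Some d" using h i by auto
      then show "b < d \<and> (\<exists>\<gamma>\<in>C \<alpha>. b < \<gamma> \<and> \<gamma> < d)" using sep unfolding h_separated_def by blast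
    qed
  qed
  moreover have "h_separated C ?q \<beta>" if "\<beta> \<in> u_of q" "\<beta> \<noteq> \<alpha>" for \<beta>
    using h_sep[OF b that(1)] that(2) unfolding h_separated_def by auto
  ultimately have "\<And>\<beta>. \<beta> \<in> u_of q \<Longrightarrow> h_separated C ?q \<beta>" by (case_tac "\<beta> = \<alpha>") (simp_all only:)
  then have S: "\<forall>\<beta>\<in>u_of ?q. h_separated C ?q \<beta>" by simp
  have N: "\<forall>i \<beta>. h_of ?q i \<beta> = None \<longleftrightarrow> \<beta> \<notin> u_of ?q \<or> i \<ge> m_of ?q \<beta>"
    using h_None[OF b] q(3) by auto
  have M: "m_of ?q \<in> u_of ?q \<rightarrow>\<^sub>E UNIV"
    using b q(3) unfolding basic_cond_def by (auto simp: PiE_def extensional_def)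
  have bq: "basic_cond C ?q"
    unfolding basic_cond_def by (intro conjI S N M) (use b in \<open>simp_all add: basic_cond_def\<close>)
  have hm: "h_of ?q i \<beta> = Some d" if "h_of q i \<beta> = Some d" for i \<beta> d using that hN by auto
  have "chain_linked f ?q"
    unfolding chain_linked_def
  proof (intro allI impI)
    fix x y j assume "{x, y} \<in> g_of ?q \<and> 1 \<le> j \<and> j + 1 \<le> f (c_of ?q {x, y})"
    then have "h_interleaved q 1 j x y" using q(1) unfolding Qf_iff[OF f] chain_linked_def by simp
    then show "h_interleaved ?q 1 j x y" using hm by (rule h_interleaved_mono)
  qed
  moreover have "\<forall>e\<in>g_of ?q. \<forall>\<beta>\<in>e. c_of ?q e \<le> m_of ?q \<beta>"
    using q(1) unfolding Qf_iff[OF f] by (auto simp: le_SucI)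
  ultimately have Q: "?q \<in> Qf C f" using q(1) bq unfolding Qf_iff[OF f] Y_of_def by simp
  have "extends ?q q" using extends_refl[OF b] q(3) unfolding extends_def by auto
  then have "extends ?q p" using q(2) extends_trans by blast
  with Q q show ?case by (intro bexI[of _ ?q]) auto
qed

section \<open>Amalgamation of a condition with a copy of it\<close>

definition restr :: "cond \<Rightarrow> omega1 set \<Rightarrow> cond" where
  "restr p D = \<lparr>s_of = s_of p \<inter> D, u_of = u_of p \<inter> D, g_of = {e \<in> g_of p. e \<subseteq> D},
     m_of = restrict (m_of p) (u_of p \<inter> D), h_of = (\<lambda>i \<beta>. if \<beta> \<in> D then h_of p i \<beta> else None),
     c_of = restrict (c_of p) {e \<in> g_of p. e \<subseteq> D}\<rparr>"

lemma h_separated_cong: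
  "(\<And>i. h_of q i \<beta> = h_of p i \<beta>) \<Longrightarrow> h_separated C q \<beta> \<longleftrightarrow> h_separated C p \<beta>"
  unfolding h_separated_def by simp

definition amalgam :: "cond \<Rightarrow> cond \<Rightarrow> omega1 \<Rightarrow> omega1 \<Rightarrow> nat \<Rightarrow> cond" where
  "amalgam p1 p2 x \<alpha> r = \<lparr>s_of = s_of p1 \<union> s_of p2, u_of = u_of p1 \<union> u_of p2,
     g_of = insert {x, \<alpha>} (g_of p1 \<union> g_of p2),
     m_of = (\<lambda>\<beta>. if \<beta> \<in> u_of p1 then m_of p1 \<beta> else m_of p2 \<beta>),
     h_of = (\<lambda>i \<beta>. if \<beta> \<in> u_of p1 then h_of p1 i \<beta> else h_of p2 i \<beta>),
     c_of = (\<lambda>e. if e = {x, \<alpha>} then r else if e \<in> g_of p1 then c_of p1 e else c_of p2 e)\<rparr>"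

text \<open>The condition \<open>p1\<close> is a copy of \<open>p2\<close> over their common part, the root. The vertex \<open>x\<close> corresponds to
  \<open>\<alpha>\<close>, and \<open>\<phi>\<close> folds the copy onto \<open>p2\<close>. The ordinals attached to \<open>x\<close> and \<open>\<alpha>\<close> alternate, as (2) demands for
  the new edge \<open>{x, \<alpha>}\<close>. The last assumption places the root below \<open>h\<^sub>0(\<alpha>)\<close>; it keeps \<open>\<alpha>\<close> far away from the
  root.\<close>
locale amalgamation =
  fixes C :: "omega1 \<Rightarrow> omega1 set" and f :: "nat \<Rightarrow> nat" and p1 p2 :: cond
    and x \<alpha> :: omega1 and r :: nat and \<phi> :: "omega1 \<Rightarrow> omega1"
  assumes f: "strict_mono f"
    and p1: "p1 \<in> Qf C f" and p2: "p2 \<in> Qf C f"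
    and agree: "restr p1 (s_of p1 \<inter> s_of p2) = restr p2 (s_of p1 \<inter> s_of p2)"
    and x: "x \<in> u_of p1" "x \<notin> s_of p2" and \<alpha>: "\<alpha> \<in> u_of p2" "\<alpha> \<notin> s_of p1" and less: "x < \<alpha>"
    and above: "\<And>d v. d \<in> s_of p1 \<inter> s_of p2 \<Longrightarrow> v \<in> s_of p1 - s_of p2 \<Longrightarrow> d < v"
    and colors: "\<And>e. e \<in> g_of p2 \<Longrightarrow> c_of p2 e < r"
    and fold_x: "\<phi> x = \<alpha>" and fold_root: "\<And>d. d \<in> s_of p1 \<inter> s_of p2 \<Longrightarrow> \<phi> d = d"
    and fold_edge: "\<And>e. e \<in> g_of p1 \<Longrightarrow> \<phi> ` e \<in> g_of p2 \<and> c_of p2 (\<phi> ` e) = c_of p1 e"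
    and inter1: "\<And>i. i \<le> f r \<Longrightarrow> \<exists>a b. h_of p1 i x = Some a \<and> h_of p2 i \<alpha> = Some b \<and> a < b"
    and inter2: "\<And>i. i < f r \<Longrightarrow> \<exists>a b. h_of p2 i \<alpha> = Some a \<and> h_of p1 (Suc i) x = Some b \<and> a < b"
    and low: "\<And>d. d \<in> s_of p1 \<inter> s_of p2 \<Longrightarrow> \<exists>b. h_of p2 0 \<alpha> = Some b \<and> d < b"
begin

abbreviation "D \<equiv> s_of p1 \<inter> s_of p2"
abbreviation "q \<equiv> amalgam p1 p2 x \<alpha> r"

lemma mono_f: "mono f" using f by (rule strict_mono_mono)
lemma b1: "basic_cond C p1" using p1 by (rule Qf_basic)
lemma b2: "basic_cond C p2" using p2 by (rule Qf_basic)

lemma us1: "\<beta> \<in> u_of p1 \<Longrightarrow> \<beta> \<in> s_of p1" using u_subset_s[OF b1] by blast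
lemma us2: "\<beta> \<in> u_of p2 \<Longrightarrow> \<beta> \<in> s_of p2" using u_subset_s[OF b2] by blast
lemma gs1: "e \<in> g_of p1 \<Longrightarrow> e \<subseteq> s_of p1" using edge_subset[OF b1] us1 by blast
lemma gs2: "e \<in> g_of p2 \<Longrightarrow> e \<subseteq> s_of p2" using edge_subset[OF b2] us2 by blast

lemma agree_u: "\<beta> \<in> D \<Longrightarrow> \<beta> \<in> u_of p1 \<longleftrightarrow> \<beta> \<in> u_of p2"
  using arg_cong[OF agree, of u_of] by (auto simp: restr_def)
lemma agree_g: "e \<subseteq> D \<Longrightarrow> e \<in> g_of p1 \<longleftrightarrow> e \<in> g_of p2"
  using arg_cong[OF agree, of g_of] by (auto simp: restr_def)
lemma agree_m: "\<beta> \<in> D \<Longrightarrow> \<beta> \<in> u_of p1 \<Longrightarrow> m_of p1 \<beta> = m_of p2 \<beta>"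
  using fun_cong[OF arg_cong[OF agree, of m_of], of \<beta>] agree_u[of \<beta>] by (simp add: restr_def)
lemma agree_h: "\<beta> \<in> D \<Longrightarrow> h_of p1 i \<beta> = h_of p2 i \<beta>"
  using fun_cong[OF fun_cong[OF arg_cong[OF agree, of h_of], of i], of \<beta>] by (simp add: restr_def)
lemma agree_c: "e \<subseteq> D \<Longrightarrow> e \<in> g_of p1 \<Longrightarrow> c_of p1 e = c_of p2 e"
  using fun_cong[OF arg_cong[OF agree, of c_of], of e] agree_g[of e] by (simp add: restr_def)

lemma new_edge: "{x, \<alpha>} \<notin> g_of p1" "{x, \<alpha>} \<notin> g_of p2"
  using gs1[of "{x, \<alpha>}"] gs2[of "{x, \<alpha>}"] x \<alpha> by blast+

lemma m1: "\<beta> \<in> u_of p1 \<Longrightarrow> m_of q \<beta> = m_of p1 \<beta>" and h1: "\<beta> \<in> u_of p1 \<Longrightarrow> h_of q i \<beta> = h_of p1 i \<beta>"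
  by (simp_all add: amalgam_def)
lemma m2: "\<beta> \<in> u_of p2 \<Longrightarrow> m_of q \<beta> = m_of p2 \<beta>" and h2: "\<beta> \<in> u_of p2 \<Longrightarrow> h_of q i \<beta> = h_of p2 i \<beta>"
  using agree_m[of \<beta>] agree_h[of \<beta>] us1[of \<beta>] us2[of \<beta>] by (auto simp: amalgam_def)
lemma c1: "e \<in> g_of p1 \<Longrightarrow> c_of q e = c_of p1 e"
  using new_edge(1) by (auto simp: amalgam_def)
lemma c2: "e \<in> g_of p2 \<Longrightarrow> c_of q e = c_of p2 e"
  using new_edge(2) agree_c[of e] gs1[of e] gs2[of e] by (auto simp: amalgam_def)
lemma c_new: "c_of q {x, \<alpha>} = r" by (simp add: amalgam_def)
lemma g_q: "g_of q = insert {x, \<alpha>} (g_of p1 \<union> g_of p2)" and u_q: "u_of q = u_of p1 \<union> u_of p2"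
  and s_q: "s_of q = s_of p1 \<union> s_of p2"
  by (simp_all add: amalgam_def)

text \<open>The new vertices of \<open>p1\<close> lie above the root, so the smaller neighbors of a root vertex in \<open>p1\<close>
  belong to the root as well.\<close>
lemma lower_edge: "{y, \<beta>} \<in> g_of p1 \<Longrightarrow> \<beta> \<in> s_of p2 \<Longrightarrow> y < \<beta> \<Longrightarrow> {y, \<beta>} \<in> g_of p2"
proof -
  assume e: "{y, \<beta>} \<in> g_of p1" "\<beta> \<in> s_of p2" "y < \<beta>"
  then have "y \<in> s_of p1" "\<beta> \<in> s_of p1" using gs1 by blast+
  moreover from this have "y \<in> s_of p2" using above[of \<beta> y] e less_asym[of y \<beta>] by blast
  ultimately show ?thesis using agree_g[of "{y, \<beta>}"] e by simp
qed

lemma new_edge_lower: "{y, \<beta>} = {x, \<alpha>} \<Longrightarrow> y < \<beta> \<Longrightarrow> y = x \<and> \<beta> = \<alpha>"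
  using less by (auto simp: doubleton_eq_iff)

lemma color_inj2:
  assumes e: "{y, \<beta>} \<in> g_of q" "{z, \<beta>} \<in> g_of p1 \<union> g_of p2" "y \<noteq> z" "y < \<beta>" "z < \<beta>"
  shows "c_of q {y, \<beta>} \<noteq> c_of q {z, \<beta>}"
proof -
  have i1: "c_of p1 {y, \<beta>} \<noteq> c_of p1 {z, \<beta>}" if "{y, \<beta>} \<in> g_of p1" "{z, \<beta>} \<in> g_of p1"
    using b1 that e(3-5) unfolding basic_cond_def by blast
  have i2: "c_of p2 {y, \<beta>} \<noteq> c_of p2 {z, \<beta>}" if "{y, \<beta>} \<in> g_of p2" "{z, \<beta>} \<in> g_of p2"
    using b2 that e(3-5) unfolding basic_cond_def by blast
  from e(1) consider "{y, \<beta>} = {x, \<alpha>}" | "{y, \<beta>} \<in> g_of p1" | "{y, \<beta>} \<in> g_of p2" unfolding g_q by blast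
  then show ?thesis
  proof cases
    case 1
    then have "y = x" "\<beta> = \<alpha>" using new_edge_lower[OF 1 e(4)] by auto
    then have "{z, \<beta>} \<in> g_of p2" using e(2) gs1[of "{z, \<beta>}"] \<alpha>(2) by auto
    then show ?thesis using colors c2 c_new 1 by fastforce
  next
    case 2
    show ?thesis
    proof (cases "{z, \<beta>} \<in> g_of p1")
      case True
      then show ?thesis using c1 2 i1 by simp
    next
      case False
      then have z: "{z, \<beta>} \<in> g_of p2" using e(2) by blast
      then have "{y, \<beta>} \<in> g_of p2" using lower_edge[OF 2 _ e(4)] gs2 by blast
      then show ?thesis using c2 z i2 by simp
    qed
  next
    case 3
    show ?thesis
    proof (cases "{z, \<beta>} \<in> g_of p2")
      case True
      then show ?thesis using c2 3 i2 by simp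
    next
      case False
      then have z: "{z, \<beta>} \<in> g_of p1" using e(2) by blast
      have "\<beta> \<in> s_of p2" using gs2[OF 3] by blast
      with False show ?thesis using lower_edge[OF z _ e(5)] by blast
    qed
  qed
qed

lemma basic_q: "basic_cond C q"
proof -
  have S: "\<forall>\<beta>\<in>u_of q. h_separated C q \<beta>"
  proof
    fix \<beta> assume "\<beta> \<in> u_of q"
    then consider "\<beta> \<in> u_of p1" | "\<beta> \<in> u_of p2" unfolding u_q by blast
    then show "h_separated C q \<beta>"
    proof cases
      case 1
      then show ?thesis using h_separated_cong[OF h1] h_sep[OF b1] by blast
    next
      case 2
      then show ?thesis using h_separated_cong[OF h2] h_sep[OF b2] by blast
    qed
  qed
  have N: "\<forall>i \<beta>. h_of q i \<beta> = None \<longleftrightarrow> \<beta> \<notin> u_of q \<or> i \<ge> m_of q \<beta>"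
    using h_None[OF b1] h_None[OF b2] by (auto simp: amalgam_def)
  have E: "\<forall>e\<in>g_of q. e \<subseteq> u_of q \<and> card e = 2"
    unfolding g_q u_q using x \<alpha> less edge_subset[OF b1] edge_subset[OF b2] edge_card[OF b1] edge_card[OF b2] by auto
  have M: "m_of q \<in> u_of q \<rightarrow>\<^sub>E UNIV"
    using b1 b2 unfolding basic_cond_def by (auto simp: amalgam_def PiE_def extensional_def)
  have Cx: "c_of q \<in> g_of q \<rightarrow>\<^sub>E UNIV"
    using b1 b2 unfolding basic_cond_def by (auto simp: amalgam_def PiE_def extensional_def)
  have I: "\<forall>y z \<beta>. {y, \<beta>} \<in> g_of q \<and> {z, \<beta>} \<in> g_of q \<and> y \<noteq> z \<and> y < \<beta> \<and> z < \<beta> \<longrightarrow> c_of q {y, \<beta>} \<noteq> c_of q {z, \<beta>}"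
  proof (intro allI impI; elim conjE)
    fix y z \<beta> assume e: "{y, \<beta>} \<in> g_of q" "{z, \<beta>} \<in> g_of q" "y \<noteq> z" "y < \<beta>" "z < \<beta>"
    show "c_of q {y, \<beta>} \<noteq> c_of q {z, \<beta>}"
    proof (cases "{z, \<beta>} = {x, \<alpha>}")
      case False
      then have "{z, \<beta>} \<in> g_of p1 \<union> g_of p2" using e(2) unfolding g_q by blast
      from color_inj2[OF e(1) this e(3-5)] show ?thesis .
    next
      case True
      then have "z = x" "\<beta> = \<alpha>" using new_edge_lower[OF True e(5)] by auto
      then have "{y, \<beta>} \<noteq> {x, \<alpha>}" using e(3) new_edge_lower[OF _ e(4)] by auto
      then have "{y, \<beta>} \<in> g_of p1 \<union> g_of p2" using e(1) unfolding g_q by blast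
      from color_inj2[OF e(2) this e(3)[symmetric] e(5,4)] show ?thesis by simp
    qed
  qed
  have L: "\<forall>\<beta>\<in>u_of q. limit_ordinal \<beta>" using b1 b2 unfolding basic_cond_def u_q by (simp add: ball_Un)
  have F: "finite (s_of q)" "u_of q \<subseteq> s_of q"
    unfolding s_q u_q using finite_s[OF b1] finite_s[OF b2] us1 us2 by auto
  show ?thesis unfolding basic_cond_def by (intro conjI F L E M N S Cx I)
qed

lemma chain_linked_q: "chain_linked f q"
  unfolding chain_linked_def
proof (intro allI impI; elim conjE)
  fix y z j assume e: "{y, z} \<in> g_of q" and j: "1 \<le> j" "j + 1 \<le> f (c_of q {y, z})"
  from e consider "{y, z} = {x, \<alpha>}" | "{y, z} \<in> g_of p1" | "{y, z} \<in> g_of p2" unfolding g_q by blast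
  then show "h_interleaved q 1 j y z"
  proof cases
    case 2
    then have "h_interleaved p1 1 j y z"
      using p1 j c1 unfolding Qf_iff[OF mono_f] chain_linked_def by simp
    moreover have "h_of q i \<beta> = Some d" if "h_of p1 i \<beta> = Some d" for i \<beta> d
      using that h1 h_None[OF b1, of i \<beta>] by auto
    ultimately show ?thesis by (rule h_interleaved_mono)
  next
    case 3
    then have "h_interleaved p2 1 j y z"
      using p2 j c2 unfolding Qf_iff[OF mono_f] chain_linked_def by simp
    moreover have "h_of q i \<beta> = Some d" if "h_of p2 i \<beta> = Some d" for i \<beta> d
      using that h2 h_None[OF b2, of i \<beta>] by auto
    ultimately show ?thesis by (rule h_interleaved_mono)
  next
    case 1
    then have jr: "1 \<le> j" "j + 1 \<le> f r" using j c_new by auto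
    obtain i where i: "j = Suc i" using jr by (cases j) auto
    obtain a0 b0 where 0: "h_of p1 i x = Some a0" "h_of p2 i \<alpha> = Some b0" "a0 < b0"
      using inter1[of i] jr i by auto
    obtain a1 b1 where 1: "h_of p1 (Suc i) x = Some a1" "h_of p2 (Suc i) \<alpha> = Some b1" "a1 < b1"
      using inter1[of "Suc i"] jr i by auto
    obtain a2 b2 where 2: "h_of p1 (Suc (Suc i)) x = Some a2" "h_of p2 (Suc (Suc i)) \<alpha> = Some b2" "a2 < b2"
      using inter1[of "Suc (Suc i)"] jr i by auto
    have 3: "b0 < a1" using inter2[of i] jr i 0 1 by auto
    have 4: "b1 < a2" using inter2[of "Suc i"] jr i 1 2 by auto
    note less_trans[OF 0(3) less_trans[OF 3 1(3)]] less_trans[OF 1(3) less_trans[OF 4 2(3)]]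
    then have "h_interleaved q 1 j x \<alpha>" "h_interleaved q 1 j \<alpha> x"
      unfolding h_interleaved_def i using 0 1 2 3 4 h1[OF x(1)] h2[OF \<alpha>(1)] by auto
    moreover have "y = x \<and> z = \<alpha> \<or> y = \<alpha> \<and> z = x"
      using \<open>{y, z} = {x, \<alpha>}\<close> by (auto simp: doubleton_eq_iff)
    ultimately show ?thesis by blast
  qed
qed

text \<open>On all edges except \<open>{x, \<alpha>}\<close>, which it collapses to \<open>\<alpha>\<close>, this map is a homomorphism onto \<open>p2\<close>
  that preserves colors.\<close>
definition fold :: "omega1 \<Rightarrow> omega1" where "fold v = (if v \<in> s_of p1 then \<phi> v else v)"

lemma fold2: "v \<in> s_of p2 \<Longrightarrow> fold v = v"
  unfolding fold_def using fold_root by auto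

lemma fold_old_edge:
  assumes "(a, b) \<in> adj (Y_of q k - {{x, \<alpha>}})"
  shows "(fold a, fold b) \<in> adj (Y_of p2 k)"
proof -
  have e: "{a, b} \<in> g_of p1 \<union> g_of p2" "k \<le> c_of q {a, b}"
    using assms unfolding adj_def Y_of_def g_q by auto
  show ?thesis
  proof (cases "{a, b} \<in> g_of p1")
    case True
    then have "a \<in> s_of p1" "b \<in> s_of p1" using gs1 by blast+
    then have "{fold a, fold b} = \<phi> ` {a, b}" by (simp add: fold_def)
    then show ?thesis using fold_edge[OF True] e(2) c1[OF True] by (simp add: adj_def Y_of_def)
  next
    case False
    then have g: "{a, b} \<in> g_of p2" using e(1) by blast
    then have "fold a = a" "fold b = b" using gs2 fold2 by blast+
    then show ?thesis using g e(2) c2[OF g] by (simp add: adj_def Y_of_def)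
  qed
qed

lemma fold_walk: "(a, b) \<in> adj (Y_of q k - {{x, \<alpha>}}) ^^ n \<Longrightarrow> (fold a, fold b) \<in> adj (Y_of p2 k) ^^ n"
  using relpow_hom[where F=fold] fold_old_edge by blast

lemma fold_ends: "fold x = \<alpha>" "fold \<alpha> = \<alpha>"
  using fold_x x \<alpha> us1 by (auto simp: fold_def)

text \<open>By (2) such a walk gives \<open>h\<^sub>0(\<alpha>) < h\<^sub>l(d)\<close>, although \<open>h\<^sub>l(d) < d < h\<^sub>0(\<alpha>)\<close>.\<close>
lemma no_short_walk_to_root:
  assumes w: "(\<alpha>, d) \<in> adj (Y_of p2 k) ^^ l" and d: "d \<in> D" and l: "2 * l \<le> f k"
  shows False
proof -
  have "l \<noteq> 0" using w d \<alpha>(2) by (cases l) auto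
  then have "h_interleaved p2 l l \<alpha> d"
    using p2 w l unfolding Qf_iff[OF mono_f] by (intro interleaved_walk[OF _ mono_f]) auto
  then obtain a b where a: "h_of p2 0 \<alpha> = Some a" "h_of p2 l d = Some b" "a < b"
    unfolding h_interleaved_def by auto
  have "d \<in> u_of p2" using a(2) h_None[OF b2, of l d] by auto
  then have "b < d" using h_sep[OF b2] a(2) unfolding h_separated_def by blast
  then show False using a low[OF d] by auto
qed

text \<open>Without the new edge a walk from \<open>x\<close> to \<open>\<alpha>\<close> has to pass through the root. Both of its parts fold to
  walks in \<open>p2\<close> between \<open>\<alpha>\<close> and the same root vertex, and one of them has at most half the length.\<close>
lemma no_short_walk_across:
  assumes w: "(x, \<alpha>) \<in> adj (Y_of q k - {{x, \<alpha>}}) ^^ n" and n: "n \<le> f k"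
  shows False
proof -
  let ?R = "adj (Y_of q k - {{x, \<alpha>}})"
  obtain v where v: "v 0 = x" "v n = \<alpha>" "\<forall>i<n. (v i, v (Suc i)) \<in> ?R"
    using w unfolding relpow_fun_conv by blast
  define i where "i = (LEAST i. v i \<in> s_of p2)"
  have n2: "v n \<in> s_of p2" using v(2) \<alpha>(1) us2 by simp
  have i: "v i \<in> s_of p2" "i \<le> n" unfolding i_def using n2 by (rule LeastI, rule Least_le)
  have "i \<noteq> 0" using i(1) v(1) x(2) by (cases i) auto
  then obtain j where j: "i = Suc j" by (cases i) auto
  then have "v j \<notin> s_of p2" using not_less_Least[of j "\<lambda>i. v i \<in> s_of p2"] unfolding i_def by simp
  moreover have "(v j, v i) \<in> ?R" using v(3) i(2) j by auto
  ultimately have "{v j, v i} \<in> g_of p1"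
    using gs2[of "{v j, v i}"] unfolding adj_def Y_of_def g_q by auto
  then have d: "v i \<in> D" using gs1 i(1) by blast
  have "(v 0, v i) \<in> ?R ^^ i" unfolding relpow_fun_conv using v(3) i(2) by (intro exI[of _ v]) auto
  from fold_walk[OF this] have w1: "(\<alpha>, v i) \<in> adj (Y_of p2 k) ^^ i" using v(1) fold_ends fold2[OF i(1)] by simp
  have "(v i, v n) \<in> ?R ^^ (n - i)"
    unfolding relpow_fun_conv using v(3) i(2) by (intro exI[of _ "\<lambda>j. v (i + j)"]) auto
  from adj_relpow_sym[OF fold_walk[OF this]] have w2: "(\<alpha>, v i) \<in> adj (Y_of p2 k) ^^ (n - i)"
    using v(2) fold_ends fold2[OF i(1)] by simp
  have "2 * i \<le> f k \<or> 2 * (n - i) \<le> f k" using n i(2) by linarith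
  then show False using no_short_walk_to_root[OF w1 d] no_short_walk_to_root[OF w2 d] by blast
qed

text \<open>Take an odd circuit of the amalgam. If it avoids the new edge, it folds to an odd closed walk of
  \<open>p2\<close>; otherwise, removing the new edge leaves a short walk from \<open>x\<close> to \<open>\<alpha>\<close>.\<close>
lemma no_odd_closed_walk:
  assumes w: "(v, v) \<in> adj (Y_of q k) ^^ n" "odd n"
  shows "\<not> n \<le> f k"
proof
  assume n: "n \<le> f k"
  obtain vs where vs: "circuit (Y_of q k) vs" "odd (length vs)" "length vs \<le> n"
    using w by (rule odd_closed_walk_circuit)
  have "length vs \<noteq> 1"
  proof
    assume "length vs = 1"
    then obtain a where "vs = [a]" by (cases vs) auto
    then have "{a} \<in> g_of q" using vs(1) by (simp add: circuit_iff Y_of_def)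
    then show False using edge_card[OF basic_q] by force
  qed
  then have len: "3 \<le> length vs" using vs(2) by presburger
  show False
  proof (cases "circuit (Y_of q k - {{x, \<alpha>}}) vs")
    case True
    have "(fold (hd vs), fold (hd vs)) \<in> adj (Y_of p2 k) ^^ length vs"
      using fold_walk[OF circuit_closed_walk[OF True]] .
    moreover have "length vs \<le> f k" using vs(3) n by linarith
    ultimately show False using p2 vs(2) unfolding Qf_iff[OF mono_f] by meson
  next
    case False
    have "(x, \<alpha>) \<in> adj (Y_of q k - {{x, \<alpha>}}) ^^ (length vs - 1)"
      using vs(1) len False by (rule circuit_edge_cut)
    then show False by (rule no_short_walk_across) (use vs n in linarith)
  qed
qed

lemma amalgam_cond: "q \<in> Qf C f"
proof -
  have "c_of q e \<le> m_of q \<beta>" if e: "e \<in> g_of q" "\<beta> \<in> e" for e \<beta>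
  proof -
    from e(1) consider "e = {x, \<alpha>}" | "e \<in> g_of p1" | "e \<in> g_of p2" unfolding g_q by blast
    then show ?thesis
    proof cases
      case 1
      obtain a b where "h_of p1 (f r) x = Some a" "h_of p2 (f r) \<alpha> = Some b" using inter1[of "f r"] by auto
      then have "f r < m_of p1 x" "f r < m_of p2 \<alpha>"
        using h_None[OF b1, of "f r" x] h_None[OF b2, of "f r" \<alpha>] by auto
      moreover have "r \<le> f r" using f by (rule strict_mono_imp_increasing)
      ultimately show ?thesis using 1 e(2) c_new m1[OF x(1)] m2[OF \<alpha>(1)] by auto
    next
      case 2
      then have "\<beta> \<in> u_of p1" using edge_subset[OF b1] e(2) by blast
      then show ?thesis using p1 2 e(2) m1 c1 unfolding Qf_iff[OF mono_f] by simp
    next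
      case 3
      then have "\<beta> \<in> u_of p2" using edge_subset[OF b2] e(2) by blast
      then show ?thesis using p2 3 e(2) m2 c2 unfolding Qf_iff[OF mono_f] by simp
    qed
  qed
  then show ?thesis
    unfolding Qf_iff[OF mono_f] using basic_q chain_linked_q no_odd_closed_walk by blast
qed

lemma amalgam_extends1: "extends q p1"
proof -
  have "u_of p1 = u_of q \<inter> s_of p1" unfolding u_q using us1 us2 agree_u by blast
  moreover have "g_of p1 = {e \<in> g_of q. e \<subseteq> s_of p1}"
  proof -
    have "e \<in> g_of p1" if "e \<in> g_of p2" "e \<subseteq> s_of p1" for e
      using that gs2[OF that(1)] agree_g[of e] by blast
    then show ?thesis unfolding g_q using gs1 \<alpha>(2) by auto
  qed
  ultimately show ?thesis
    unfolding extends_def using m1 h1 c1 s_q by simp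
qed

lemma amalgam_extends2: "extends q p2"
proof -
  have "u_of p2 = u_of q \<inter> s_of p2" unfolding u_q using us1 us2 agree_u by blast
  moreover have "g_of p2 = {e \<in> g_of q. e \<subseteq> s_of p2}"
  proof -
    have "e \<in> g_of p2" if "e \<in> g_of p1" "e \<subseteq> s_of p2" for e
      using that gs1[OF that(1)] agree_g[of e] by blast
    then show ?thesis unfolding g_q using gs2 x(2) by auto
  qed
  ultimately show ?thesis
    unfolding extends_def using m2 h2 c2 s_q by simp
qed

end

text \<open>One bit for each color \<open>i < r\<close>, where the edges of color \<open>i\<close> form a forest, and one bit for the
  edges of color at least \<open>r\<close>. A circuit inside \<open>w\<close> has at most \<open>f r\<close> vertices, so the graph of the latter
  has no odd circuits.\<close>
lemma condition_coloring:
  assumes f: "mono f" and p: "p \<in> Qf C f" and w: "finite w" "card w \<le> f r"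
    and y: "y \<subseteq> g_of p" "\<And>e. e \<in> y \<Longrightarrow> e \<subseteq> w"
  shows "\<exists>\<phi>. (\<forall>a. \<phi> a < (2::nat) ^ (r + 1)) \<and> (\<forall>a b. {a, b} \<in> y \<longrightarrow> \<phi> a \<noteq> \<phi> b)"
proof -
  have b: "basic_cond C p" using p by (rule Qf_basic)
  \<comment> \<open>The edges that the last bit has to color.\<close>
  define Z where "Z = {e \<in> y. r \<le> c_of p e}"
  have "even (length vs)" if vs: "circuit Z vs" for vs
  proof (rule ccontr)
    assume odd: "odd (length vs)"
    have "circuit (Y_of p r) vs" using vs y(1) unfolding circuit_iff Z_def Y_of_def
      by (auto elim!: successively_mono)
    then have "\<not> length vs \<le> f r"
      using odd circuit_closed_walk p unfolding Qf_iff[OF f] by blast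
    moreover have "set vs \<subseteq> w"
    proof
      fix v assume "v \<in> set vs"
      then obtain k where k: "k < length vs" "v = vs ! k" by (metis in_set_conv_nth)
      have "\<exists>e\<in>Z. v \<in> e"
      proof (cases "Suc k < length vs")
        case True
        then have "{vs ! k, vs ! Suc k} \<in> Z" using vs unfolding circuit_def edge_path_def by blast
        then show ?thesis using k by blast
      next
        case False
        then have "k = length vs - 1" using k by linarith
        then have "v = last vs" using k by (metis last_conv_nth length_greater_0_conv less_nat_zero_code list.size(3))
        then show ?thesis using vs unfolding circuit_def by blast
      qed
      then show "v \<in> w" using y(2) unfolding Z_def by blast
    qed
    then have "card (set vs) \<le> card w" using w(1) by (intro card_mono)
    then have "length vs \<le> card w" using vs unfolding circuit_iff by (simp add: distinct_card)
    ultimately show False using w(2) by linarith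
  qed
  from two_coloring[OF this] obtain col :: "omega1 \<Rightarrow> bool" where col: "\<forall>a b. {a, b} \<in> Z \<longrightarrow> col a \<noteq> col b"
    by (rule exE)
  define bit where "bit i a = (if i < r then forest_color {e \<in> y. c_of p e = i} a else col a)" for i a
  have bit: "\<exists>i\<le>r. bit i a \<noteq> bit i b'" if e: "{a, b'} \<in> y" for a b'
  proof (cases "c_of p {a, b'} < r")
    case True
    let ?i = "c_of p {a, b'}"
    have "forest_color {e \<in> y. c_of p e = ?i} a \<noteq> forest_color {e \<in> y. c_of p e = ?i} b'"
    proof (rule forest_coloring)
      show "{a, b'} \<in> {e \<in> y. c_of p e = ?i}" using e by simp
      show "a \<noteq> b'" using e y(1) edge_ne[OF b] by blast
      fix x z \<beta> assume "{x, \<beta>} \<in> {e \<in> y. c_of p e = ?i}" "{z, \<beta>} \<in> {e \<in> y. c_of p e = ?i}" "x < \<beta>" "z < \<beta>"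
      then have "{x, \<beta>} \<in> g_of p" "{z, \<beta>} \<in> g_of p" "c_of p {x, \<beta>} = c_of p {z, \<beta>}" "x < \<beta>" "z < \<beta>"
        using y(1) by auto
      then show "x = z" using b unfolding basic_cond_def by blast
    qed
    then show ?thesis using True unfolding bit_def by (intro exI[of _ ?i]) simp
  next
    case False
    then have "col a \<noteq> col b'" using col e unfolding Z_def by auto
    then show ?thesis unfolding bit_def by (intro exI[of _ r]) simp
  qed
  obtain h where h: "bij_betw h (Pow {..r}) {0..<card (Pow {..r})}"
    using ex_bij_betw_finite_nat[of "Pow {..r}"] by auto
  define \<phi> where "\<phi> a = h {i. i \<le> r \<and> bit i a}" for a
  have "\<phi> a < 2 ^ (r + 1)" for a
  proof -
    have "h {i. i \<le> r \<and> bit i a} \<in> {0..<card (Pow {..r})}"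
      using h by (rule bij_betwE[rule_format]) auto
    then show ?thesis unfolding \<phi>_def by (simp add: card_Pow)
  qed
  moreover have "\<phi> a \<noteq> \<phi> b'" if e: "{a, b'} \<in> y" for a b'
  proof
    assume "\<phi> a = \<phi> b'"
    then have "{i. i \<le> r \<and> bit i a} = {i. i \<le> r \<and> bit i b'}"
      unfolding \<phi>_def using h by (intro inj_onD[OF bij_betw_imp_inj_on[OF h]]) auto
    then show False using bit[OF e] by blast
  qed
  ultimately show ?thesis by blast
qed

section \<open>Reflection below guessed ordinals\<close>

lemma countable_bounded_omega1:
  assumes "countable S" shows "\<exists>b::omega1. \<forall>a\<in>S. a < b"
proof (rule ccontr)
  assume "\<nexists>b. \<forall>a\<in>S. a < b"
  then have "UNIV = (\<Union>a\<in>S. {..a})" by (auto simp: not_less)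
  moreover have "countable {..a}" for a :: omega1
  proof -
    have "{..a} = insert a {..<a}" by auto
    then show ?thesis using countable_initial_segment_omega1 by simp
  qed
  ultimately have "countable (UNIV :: omega1 set)" using assms by (metis countable_UN)
  then show False using uncountable_omega1 by blast
qed

lemma limit_of_sequence:
  fixes a :: "nat \<Rightarrow> omega1"
  assumes inc: "\<And>n. a n < a (Suc n)"
  obtains \<delta> where "limit_ordinal \<delta>" "\<And>n. a n < \<delta>" "\<And>\<beta>. \<beta> < \<delta> \<Longrightarrow> \<exists>n. \<beta> \<le> a n"
proof -
  define \<delta> where "\<delta> = (LEAST b. \<forall>n. a n < b)"
  have "\<exists>b. \<forall>n. a n < b" using countable_bounded_omega1[of "range a"] by auto
  then have "\<forall>n. a n < \<delta>" unfolding \<delta>_def by (rule LeastI_ex)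
  then have 1: "\<And>n. a n < \<delta>" by blast
  have 2: "\<exists>n. \<beta> \<le> a n" if "\<beta> < \<delta>" for \<beta>
    using not_less_Least[of \<beta> "\<lambda>b. \<forall>n. a n < b"] that unfolding \<delta>_def by (auto simp: not_less)
  have "limit_ordinal \<delta>" unfolding limit_ordinal_def
  proof (intro conjI allI impI)
    show "\<exists>\<beta>. \<beta> < \<delta>" using 1 by blast
    fix \<beta> assume "\<beta> < \<delta>"
    then obtain n where "\<beta> \<le> a n" using 2 by blast
    then have "\<beta> < a (Suc n)" using inc[of n] by (rule le_less_trans)
    then show "\<exists>\<gamma>. \<beta> < \<gamma> \<and> \<gamma> < \<delta>" using 1 by blast
  qed
  then show ?thesis using 1 2 by (rule that)
qed

lemma finite_below_limit:
  assumes \<delta>: "limit_ordinal \<delta>" and A: "finite A" "\<And>a. a \<in> A \<Longrightarrow> a < \<delta>"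
  shows "\<exists>\<beta><\<delta>. \<forall>a\<in>A. a < \<beta>"
  using A
proof (induction A)
  case empty
  then show ?case using \<delta> unfolding limit_ordinal_def by auto
next
  case (insert a A)
  then obtain \<beta> where \<beta>: "\<beta> < \<delta>" "\<forall>x\<in>A. x < \<beta>" by auto
  have "max a \<beta> < \<delta>" using \<beta>(1) insert.prems[of a] by simp
  then obtain \<gamma> where "max a \<beta> < \<gamma>" "\<gamma> < \<delta>" using limit_ordinal_between[OF \<delta>] by blast
  then show ?case using \<beta>(2) by (intro exI[of _ \<gamma>]) (auto dest: less_trans)
qed

text \<open>A countable set of arguments has bounded values, so closing off \<open>\<omega>\<close> times above a given ordinal
  leads to a closure point.\<close>
lemma club_closure_points:
  fixes S :: "omega1 \<Rightarrow> 's set" and F :: "'s \<Rightarrow> omega1"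
  assumes cnt: "\<And>\<delta>. countable (S \<delta>)" and mono: "\<And>\<beta> \<delta>. \<beta> \<le> \<delta> \<Longrightarrow> S \<beta> \<subseteq> S \<delta>"
    and cont: "\<And>\<delta> t. limit_ordinal \<delta> \<Longrightarrow> t \<in> S \<delta> \<Longrightarrow> \<exists>\<beta><\<delta>. t \<in> S \<beta>"
  shows "club {\<delta>. limit_ordinal \<delta> \<and> \<gamma>\<^sub>0 < \<delta> \<and> (\<forall>t\<in>S \<delta>. F t < \<delta>)}"
  unfolding club_def
proof (intro conjI allI impI)
  fix \<alpha> :: omega1
  have "\<exists>b. \<beta> < b \<and> (\<forall>t\<in>S \<beta>. F t < b)" for \<beta>
    using countable_bounded_omega1[of "insert \<beta> (F ` S \<beta>)"] cnt[of \<beta>] by auto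
  then obtain step where step: "\<And>\<beta>. \<beta> < step \<beta>" "\<And>\<beta> t. t \<in> S \<beta> \<Longrightarrow> F t < step \<beta>" by metis
  define a where "a = rec_nat (max \<alpha> \<gamma>\<^sub>0) (\<lambda>_. step)"
  have a: "a 0 = max \<alpha> \<gamma>\<^sub>0" "\<And>n. a (Suc n) = step (a n)" by (simp_all add: a_def)
  obtain \<delta> where \<delta>: "limit_ordinal \<delta>" "\<And>n. a n < \<delta>" "\<And>\<beta>. \<beta> < \<delta> \<Longrightarrow> \<exists>n. \<beta> \<le> a n"
    by (rule limit_of_sequence[of a]) (use a step in auto)
  have "F t < \<delta>" if t: "t \<in> S \<delta>" for t
  proof -
    obtain \<beta> where \<beta>: "\<beta> < \<delta>" "t \<in> S \<beta>" using cont[OF \<delta>(1) t] by blast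
    obtain n where "\<beta> \<le> a n" using \<delta>(3)[OF \<beta>(1)] by blast
    then have "t \<in> S (a n)" using mono \<beta>(2) by blast
    then have "F t < a (Suc n)" using step(2) a(2) by simp
    then show ?thesis using \<delta>(2) by (rule less_trans)
  qed
  moreover have "\<alpha> < \<delta>" "\<gamma>\<^sub>0 < \<delta>" using \<delta>(2)[of 0] a(1) by auto
  ultimately show "\<exists>\<beta>\<in>{\<delta>. limit_ordinal \<delta> \<and> \<gamma>\<^sub>0 < \<delta> \<and> (\<forall>t\<in>S \<delta>. F t < \<delta>)}. \<alpha> < \<beta>"
    using \<delta>(1) by blast
next
  let ?E = "{\<delta>. limit_ordinal \<delta> \<and> \<gamma>\<^sub>0 < \<delta> \<and> (\<forall>t\<in>S \<delta>. F t < \<delta>)}"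
  fix \<delta> assume A: "limit_ordinal \<delta> \<and> (\<forall>\<beta><\<delta>. \<exists>\<gamma>\<in>?E. \<beta> < \<gamma> \<and> \<gamma> < \<delta>)"
  then obtain \<beta> where "\<beta> < \<delta>" unfolding limit_ordinal_def by blast
  then have "\<gamma>\<^sub>0 < \<delta>" using A less_trans by blast
  moreover have "F t < \<delta>" if t: "t \<in> S \<delta>" for t
  proof -
    obtain \<beta> where \<beta>: "\<beta> < \<delta>" "t \<in> S \<beta>" using cont[OF _ t] A by blast
    then obtain \<gamma> where "\<gamma> \<in> ?E" "\<beta> < \<gamma>" "\<gamma> < \<delta>" using A by blast
    then have "t \<in> S \<gamma>" using mono[OF less_imp_le, of \<beta> \<gamma>] \<beta>(2) by blast
    then show ?thesis using \<open>\<gamma> \<in> ?E\<close> \<open>\<gamma> < \<delta>\<close> by (auto dest: less_trans)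
  qed
  ultimately show "\<delta> \<in> ?E" using A by blast
qed

text \<open>The property \<open>\<Phi>\<close> preceded by \<open>k\<close> quantifiers ``for every \<open>\<gamma>\<close> there is a finite block above
  \<open>\<gamma>\<close>''. Such a prefix holds when the blocks of an actual configuration are separated by ordinals
  of elementary submodels, and it allows to choose the blocks anew in other places.\<close>
primrec often :: "('t \<Rightarrow> omega1 set list \<Rightarrow> bool) \<Rightarrow> nat \<Rightarrow> 't \<Rightarrow> omega1 set list \<Rightarrow> bool" where
  "often \<Phi> 0 \<tau> Bs = \<Phi> \<tau> Bs"
| "often \<Phi> (Suc k) \<tau> Bs = (\<forall>\<gamma>. \<exists>B. finite B \<and> (\<forall>b\<in>B. \<gamma> < b) \<and> often \<Phi> k \<tau> (Bs @ [B]))"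

definition fin_below :: "omega1 \<Rightarrow> omega1 set set" where
  "fin_below \<delta> = {B. finite B \<and> B \<subseteq> {..<\<delta>}}"

lemma countable_fin_below: "countable (fin_below \<delta>)"
  unfolding fin_below_def using countable_Collect_finite_subset[OF countable_initial_segment_omega1] .

lemma fin_below_mono: "\<beta> \<le> \<delta> \<Longrightarrow> fin_below \<beta> \<subseteq> fin_below \<delta>"
  unfolding fin_below_def by (auto intro: less_le_trans)

lemma fin_below_cont: "limit_ordinal \<delta> \<Longrightarrow> B \<in> fin_below \<delta> \<Longrightarrow> \<exists>\<beta><\<delta>. B \<in> fin_below \<beta>"
  using finite_below_limit[of \<delta> B] unfolding fin_below_def by auto

lemma fin_below_lists_cont:
  assumes \<delta>: "limit_ordinal \<delta>" and "Bs \<in> lists (fin_below \<delta>)" shows "\<exists>\<beta><\<delta>. Bs \<in> lists (fin_below \<beta>)"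
  using assms(2)
proof (induction Bs)
  case Nil
  then show ?case using \<delta> unfolding limit_ordinal_def by auto
next
  case (Cons B Bs)
  then obtain \<beta>1 \<beta>2 where b: "\<beta>1 < \<delta>" "B \<in> fin_below \<beta>1" "\<beta>2 < \<delta>" "Bs \<in> lists (fin_below \<beta>2)"
    using fin_below_cont[OF \<delta>, of B] by auto
  have "B \<in> fin_below (max \<beta>1 \<beta>2)" "Bs \<in> lists (fin_below (max \<beta>1 \<beta>2))"
    using b fin_below_mono[of \<beta>1 "max \<beta>1 \<beta>2"] lists_mono[OF fin_below_mono[of \<beta>2 "max \<beta>1 \<beta>2"]] by auto
  then show ?case using b by (intro exI[of _ "max \<beta>1 \<beta>2"]) auto
qed

text \<open>The value \<open>b\<close> of a Skolem function for \<open>often\<close>: below \<open>b\<close> there is either a block that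
  witnesses it above \<open>\<gamma>\<close>, or a threshold \<open>\<gamma>'\<close> above which no block does.\<close>
definition witness_bound :: "('t \<Rightarrow> omega1 set list \<Rightarrow> bool) \<Rightarrow> nat \<Rightarrow> 't \<Rightarrow> omega1 set list \<Rightarrow> omega1 \<Rightarrow> omega1 \<Rightarrow> bool" where
  "witness_bound \<Phi> k \<tau> Bs \<gamma> b \<longleftrightarrow>
     (often \<Phi> (Suc k) \<tau> Bs \<longrightarrow> (\<exists>B. finite B \<and> B \<subseteq> {\<gamma><..<b} \<and> often \<Phi> k \<tau> (Bs @ [B]))) \<and>
     (\<not> often \<Phi> (Suc k) \<tau> Bs \<longrightarrow> (\<exists>\<gamma>'<b. \<forall>B. finite B \<and> B \<subseteq> {\<gamma>'<..} \<longrightarrow> \<not> often \<Phi> k \<tau> (Bs @ [B])))"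

lemma witness_bound_exists: "\<exists>b. witness_bound \<Phi> k \<tau> Bs \<gamma> b"
proof (cases "often \<Phi> (Suc k) \<tau> Bs")
  case True
  then obtain B where B: "finite B" "\<forall>b\<in>B. \<gamma> < b" "often \<Phi> k \<tau> (Bs @ [B])" by auto
  obtain b where "\<forall>a\<in>B. a < b" using countable_bounded_omega1[OF countable_finite[OF B(1)]] by blast
  then have "B \<subseteq> {\<gamma><..<b}" using B(2) by auto
  then show ?thesis unfolding witness_bound_def using True B by blast
next
  case False
  then have "\<exists>\<gamma>'. \<forall>B. \<not> (finite B \<and> (\<forall>b\<in>B. \<gamma>' < b) \<and> often \<Phi> k \<tau> (Bs @ [B]))"
    by (simp only: often.simps not_all not_ex)
  then obtain \<gamma>' where \<gamma>': "\<And>B. finite B \<Longrightarrow> (\<forall>b\<in>B. \<gamma>' < b) \<Longrightarrow> \<not> often \<Phi> k \<tau> (Bs @ [B])" by blast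
  obtain b where "\<gamma>' < b" using countable_bounded_omega1[of "{\<gamma>'}"] by auto
  moreover have "\<forall>B. finite B \<and> B \<subseteq> {\<gamma>'<..} \<longrightarrow> \<not> often \<Phi> k \<tau> (Bs @ [B])" using \<gamma>' by auto
  ultimately show ?thesis unfolding witness_bound_def using False by blast
qed

text \<open>The closure points of the Skolem functions for parameters in \<open>T \<delta>\<close>; they take the
  role of ordinals \<open>M \<inter> \<omega>\<^sub>1\<close> for countable elementary submodels \<open>M\<close>.\<close>
definition reflecting :: "('t \<Rightarrow> omega1 set list \<Rightarrow> bool) \<Rightarrow> (omega1 \<Rightarrow> 't set) \<Rightarrow> omega1 \<Rightarrow> bool" where
  "reflecting \<Phi> T \<delta> \<longleftrightarrow> limit_ordinal \<delta> \<and>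
     (\<forall>k. \<forall>\<tau>\<in>T \<delta>. \<forall>Bs\<in>lists (fin_below \<delta>). \<forall>\<gamma><\<delta>. \<exists>b<\<delta>. witness_bound \<Phi> k \<tau> Bs \<gamma> b)"

lemma club_superset_guess:
  assumes "club_guessing C" "club D" "D \<subseteq> E"
  obtains \<alpha> where "limit_ordinal \<alpha>" "C \<alpha> \<subseteq> E" "C \<alpha> \<subseteq> {..<\<alpha>}" "\<And>\<beta>. \<beta> < \<alpha> \<Longrightarrow> \<exists>\<gamma>\<in>C \<alpha>. \<beta> < \<gamma>"
proof -
  obtain \<alpha> where \<alpha>: "limit_ordinal \<alpha>" "C \<alpha> \<subseteq> D" using assms(1,2) unfolding club_guessing_def by blast
  then have "C \<alpha> \<subseteq> {..<\<alpha>}" "\<And>\<beta>. \<beta> < \<alpha> \<Longrightarrow> \<exists>\<gamma>\<in>C \<alpha>. \<beta> < \<gamma>" using assms(1) unfolding club_guessing_def by blast+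
  with \<alpha> assms(3) show ?thesis by (intro that) auto
qed

lemma guess_reflecting:
  fixes T :: "omega1 \<Rightarrow> 't set"
  assumes C: "club_guessing C" and cnt: "\<And>\<delta>. countable (T \<delta>)" and mono: "\<And>\<beta> \<delta>. \<beta> \<le> \<delta> \<Longrightarrow> T \<beta> \<subseteq> T \<delta>"
    and cont: "\<And>\<delta> t. limit_ordinal \<delta> \<Longrightarrow> t \<in> T \<delta> \<Longrightarrow> \<exists>\<beta><\<delta>. t \<in> T \<beta>"
  obtains \<alpha> where "limit_ordinal \<alpha>" "C \<alpha> \<subseteq> {\<delta>. \<gamma>\<^sub>0 < \<delta> \<and> reflecting \<Phi> T \<delta>}" "C \<alpha> \<subseteq> {..<\<alpha>}"
    "\<And>\<beta>. \<beta> < \<alpha> \<Longrightarrow> \<exists>\<gamma>\<in>C \<alpha>. \<beta> < \<gamma>"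
proof -
  define S where "S \<delta> = (UNIV :: nat set) \<times> T \<delta> \<times> lists (fin_below \<delta>) \<times> {..<\<delta>}" for \<delta>
  have "\<exists>F. \<forall>k \<tau> Bs \<gamma>. witness_bound \<Phi> k \<tau> Bs \<gamma> (F (k, \<tau>, Bs, \<gamma>))"
    by (rule exI[of _ "\<lambda>(k, \<tau>, Bs, \<gamma>). SOME b. witness_bound \<Phi> k \<tau> Bs \<gamma> b"])
       (simp add: someI_ex[OF witness_bound_exists])
  then obtain F where F: "\<And>k \<tau> Bs \<gamma>. witness_bound \<Phi> k \<tau> Bs \<gamma> (F (k, \<tau>, Bs, \<gamma>))" by blast
  have D: "club {\<delta>. limit_ordinal \<delta> \<and> \<gamma>\<^sub>0 < \<delta> \<and> (\<forall>t\<in>S \<delta>. F t < \<delta>)}"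
  proof (rule club_closure_points)
    show "countable (S \<delta>)" for \<delta>
      unfolding S_def by (intro countable_SIGMA countable_lists countable_fin_below cnt countable_initial_segment_omega1 countableI_type)
    show "S \<beta> \<subseteq> S \<delta>" if "\<beta> \<le> \<delta>" for \<beta> \<delta>
      unfolding S_def using mono[OF that] lists_mono[OF fin_below_mono[OF that]] that
      by (intro Sigma_mono) auto
    show "\<exists>\<beta><\<delta>. t \<in> S \<beta>" if \<delta>: "limit_ordinal \<delta>" and t: "t \<in> S \<delta>" for \<delta> t
    proof -
      obtain k \<tau> Bs \<gamma> where e: "t = (k, \<tau>, Bs, \<gamma>)" "\<tau> \<in> T \<delta>" "Bs \<in> lists (fin_below \<delta>)" "\<gamma> < \<delta>"
        using t unfolding S_def by blast
      obtain b1 where b1: "b1 < \<delta>" "\<tau> \<in> T b1" using cont[OF \<delta> e(2)] by blast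
      obtain b2 where b2: "b2 < \<delta>" "Bs \<in> lists (fin_below b2)" using fin_below_lists_cont[OF \<delta> e(3)] by blast
      obtain b where b: "b < \<delta>" "\<forall>a\<in>{b1, b2, \<gamma>}. a < b"
        using finite_below_limit[OF \<delta>, of "{b1, b2, \<gamma>}"] b1(1) b2(1) e(4) by auto
      have "b1 \<le> b" "b2 \<le> b" "\<gamma> < b" using b(2) by (simp_all add: less_imp_le)
      then have "\<tau> \<in> T b" "Bs \<in> lists (fin_below b)" "\<gamma> < b"
        using mono[of b1 b] lists_mono[OF fin_below_mono[of b2 b]] b1(2) b2(2) by blast+
      then show ?thesis using b(1) unfolding e S_def by blast
    qed
  qed
  have sub: "{\<delta>. limit_ordinal \<delta> \<and> \<gamma>\<^sub>0 < \<delta> \<and> (\<forall>t\<in>S \<delta>. F t < \<delta>)} \<subseteq> {\<delta>. \<gamma>\<^sub>0 < \<delta> \<and> reflecting \<Phi> T \<delta>}"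
  proof
    fix \<delta> assume "\<delta> \<in> {\<delta>. limit_ordinal \<delta> \<and> \<gamma>\<^sub>0 < \<delta> \<and> (\<forall>t\<in>S \<delta>. F t < \<delta>)}"
    then have \<delta>: "limit_ordinal \<delta>" "\<gamma>\<^sub>0 < \<delta>" "\<And>t. t \<in> S \<delta> \<Longrightarrow> F t < \<delta>" by auto
    have "\<exists>b<\<delta>. witness_bound \<Phi> k \<tau> Bs \<gamma> b" if "\<tau> \<in> T \<delta>" "Bs \<in> lists (fin_below \<delta>)" "\<gamma> < \<delta>" for k \<tau> Bs \<gamma>
    proof -
      have "(k, \<tau>, Bs, \<gamma>) \<in> S \<delta>" using that unfolding S_def by blast
      then show ?thesis using \<delta>(3) F by blast
    qed
    then show "\<delta> \<in> {\<delta>. \<gamma>\<^sub>0 < \<delta> \<and> reflecting \<Phi> T \<delta>}" using \<delta>(1,2) unfolding reflecting_def by blast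
  qed
  obtain \<alpha> where "limit_ordinal \<alpha>" "C \<alpha> \<subseteq> {\<delta>. \<gamma>\<^sub>0 < \<delta> \<and> reflecting \<Phi> T \<delta>}" "C \<alpha> \<subseteq> {..<\<alpha>}"
    "\<And>\<beta>. \<beta> < \<alpha> \<Longrightarrow> \<exists>\<gamma>\<in>C \<alpha>. \<beta> < \<gamma>"
    using C D sub by (rule club_superset_guess) blast
  then show ?thesis by (rule that)
qed

text \<open>The given blocks \<open>A i\<close> are separated by reflecting ordinals. If, for the initial part below \<open>\<epsilon> i\<close>,
  the next block could not be found arbitrarily high, then by reflection a threshold for this would lie
  below \<open>\<epsilon> i\<close>, and \<open>A i\<close> contradicts it. Hence \<open>often\<close> holds for the empty list, and the new blocks \<open>B i\<close>
  can be chosen one after the other between \<open>\<gamma> i\<close> and \<open>\<epsilon> i\<close>.\<close>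
lemma reflection:
  fixes T :: "omega1 \<Rightarrow> 't set"
  assumes mono: "\<And>\<beta> \<delta>. \<beta> \<le> \<delta> \<Longrightarrow> T \<beta> \<subseteq> T \<delta>"
    and \<epsilon>: "\<And>i. i \<le> N \<Longrightarrow> reflecting \<Phi> T (\<epsilon> i)" "\<And>i. i < N \<Longrightarrow> \<epsilon> i < \<epsilon> (Suc i)" and \<tau>: "\<tau> \<in> T (\<epsilon> 0)"
    and A: "\<And>i. i \<le> N \<Longrightarrow> finite (A i)" "\<And>i a. i \<le> N \<Longrightarrow> a \<in> A i \<Longrightarrow> \<epsilon> i \<le> a"
      "\<And>i a. i < N \<Longrightarrow> a \<in> A i \<Longrightarrow> a < \<epsilon> (Suc i)" "\<Phi> \<tau> (map A [0..<Suc N])"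
    and \<gamma>: "\<And>i. i \<le> N \<Longrightarrow> \<gamma> i < \<epsilon> i"
  obtains B where "\<And>i b. i \<le> N \<Longrightarrow> b \<in> B i \<Longrightarrow> \<gamma> i < b \<and> b < \<epsilon> i" "\<Phi> \<tau> (map B [0..<Suc N])"
proof -
  have \<epsilon>_le: "\<epsilon> i \<le> \<epsilon> j" if "i \<le> j" "j \<le> N" for i j
    using that
  proof (induction j rule: dec_induct)
    case (step n)
    then have "\<epsilon> i \<le> \<epsilon> n" "\<epsilon> n < \<epsilon> (Suc n)" using \<epsilon>(2)[of n] by simp_all
    then show ?case by (meson le_less_trans less_imp_le)
  qed simp
  have \<tau>i: "\<tau> \<in> T (\<epsilon> i)" if "i \<le> N" for i using \<tau> mono[OF \<epsilon>_le[of 0 i]] that by auto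
  have wb: "\<exists>b<\<epsilon> i. witness_bound \<Phi> k \<tau> Bs (\<gamma> i) b" if "i \<le> N" "Bs \<in> lists (fin_below (\<epsilon> i))" for i k Bs
    using \<epsilon>(1)[OF that(1)] \<tau>i[OF that(1)] that(2) \<gamma>[OF that(1)] unfolding reflecting_def by blast
  have down: "often \<Phi> k \<tau> (map A [0..<Suc N - k])" if "k \<le> Suc N" for k
    using that
  proof (induction k)
    case 0
    then show ?case using A(4) by simp
  next
    case (Suc k)
    define i where "i = N - k"
    have i: "i \<le> N" "Suc N - k = Suc i" "Suc N - Suc k = i" using Suc.prems unfolding i_def by auto
    have IH: "often \<Phi> k \<tau> (map A [0..<i] @ [A i])" using Suc i by simp
    have "map A [0..<i] \<in> lists (fin_below (\<epsilon> i))"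
    proof -
      have "A j \<in> fin_below (\<epsilon> i)" if "j < i" for j
      proof -
        have "\<epsilon> (Suc j) \<le> \<epsilon> i" "finite (A j)" using \<epsilon>_le A(1) that i(1) by simp_all
        moreover have "a < \<epsilon> (Suc j)" if "a \<in> A j" for a using A(3) that \<open>j < i\<close> i(1) by simp
        ultimately show ?thesis unfolding fin_below_def by (auto intro: less_le_trans)
      qed
      then show ?thesis by auto
    qed
    from wb[OF i(1) this] obtain b where b: "b < \<epsilon> i" "witness_bound \<Phi> k \<tau> (map A [0..<i]) (\<gamma> i) b" by blast
    have "often \<Phi> (Suc k) \<tau> (map A [0..<i])"
    proof (rule ccontr)
      assume "\<not> often \<Phi> (Suc k) \<tau> (map A [0..<i])"
      then obtain \<gamma>' where \<gamma>': "\<gamma>' < b" "\<And>B. finite B \<Longrightarrow> B \<subseteq> {\<gamma>'<..} \<Longrightarrow> \<not> often \<Phi> k \<tau> (map A [0..<i] @ [B])"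
        using b(2) unfolding witness_bound_def by blast
      have "A i \<subseteq> {\<gamma>'<..}"
        using A(2)[OF i(1)] less_trans[OF \<gamma>'(1) b(1)] by (auto intro: less_le_trans)
      then show False using \<gamma>'(2) A(1)[OF i(1)] IH by blast
    qed
    then show ?case unfolding i(3) .
  qed
  have up: "\<exists>B. (\<forall>j<i. finite (B j) \<and> B j \<subseteq> {\<gamma> j<..<\<epsilon> j}) \<and> often \<Phi> (Suc N - i) \<tau> (map B [0..<i])" if "i \<le> Suc N" for i
    using that
  proof (induction i)
    case 0
    then show ?case using down[of "Suc N"] by simp
  next
    case (Suc i)
    then have iN: "i \<le> N" by simp
    obtain B where B: "\<And>j. j < i \<Longrightarrow> finite (B j) \<and> B j \<subseteq> {\<gamma> j<..<\<epsilon> j}" "often \<Phi> (Suc N - i) \<tau> (map B [0..<i])"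
      using Suc by auto
    have k: "Suc N - i = Suc (N - i)" using iN by simp
    have "map B [0..<i] \<in> lists (fin_below (\<epsilon> i))"
    proof -
      have "B j \<in> fin_below (\<epsilon> i)" if "j < i" for j
      proof -
        have "\<epsilon> j \<le> \<epsilon> i" using \<epsilon>_le that iN by simp
        then have "{\<gamma> j<..<\<epsilon> j} \<subseteq> {..<\<epsilon> i}" by (auto intro: less_le_trans)
        then show ?thesis using B(1)[OF that] unfolding fin_below_def by blast
      qed
      then show ?thesis by auto
    qed
    from wb[OF iN this] obtain b where b: "b < \<epsilon> i" "witness_bound \<Phi> (N - i) \<tau> (map B [0..<i]) (\<gamma> i) b" by blast
    then obtain B' where B': "finite B'" "B' \<subseteq> {\<gamma> i<..<b}" "often \<Phi> (N - i) \<tau> (map B [0..<i] @ [B'])"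
      using B(2) unfolding witness_bound_def k by blast
    have "map (B(i := B')) [0..<Suc i] = map B [0..<i] @ [B']" by simp
    then have "often \<Phi> (Suc N - Suc i) \<tau> (map (B(i := B')) [0..<Suc i])" using B'(3) by simp
    moreover have "finite ((B(i := B')) j) \<and> (B(i := B')) j \<subseteq> {\<gamma> j<..<\<epsilon> j}" if "j < Suc i" for j
    proof (cases "j = i")
      case True
      have "{\<gamma> i<..<b} \<subseteq> {\<gamma> i<..<\<epsilon> i}" using b(1) by (auto intro: less_trans)
      then have "B' \<subseteq> {\<gamma> i<..<\<epsilon> i}" using B'(2) by blast
      then show ?thesis using True B'(1) by simp
    next
      case False
      then show ?thesis using B(1)[of j] that by simp
    qed
    ultimately show ?case by blast
  qed
  obtain B where B: "\<And>j. j < Suc N \<Longrightarrow> finite (B j) \<and> B j \<subseteq> {\<gamma> j<..<\<epsilon> j}" "often \<Phi> (Suc N - Suc N) \<tau> (map B [0..<Suc N])"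
    using up[of "Suc N"] by blast
  show ?thesis
  proof (rule that)
    show "\<gamma> i < b \<and> b < \<epsilon> i" if "i \<le> N" "b \<in> B i" for i b using B(1)[of i] that by auto
    show "\<Phi> \<tau> (map B [0..<Suc N])" using B(2) by simp
  qed
qed

text \<open>This contains all conditions and all restrictions of conditions, and counting it only involves
  finite sets.\<close>
definition finite_data :: "cond set" where
  "finite_data = {p. finite (s_of p) \<and> u_of p \<subseteq> s_of p \<and> g_of p \<subseteq> Pow (s_of p) \<and>
     m_of p \<in> extensional (u_of p) \<and> c_of p \<in> extensional (g_of p) \<and>
     (\<forall>i \<alpha> a. h_of p i \<alpha> = Some a \<longrightarrow> \<alpha> \<in> u_of p \<and> i < m_of p \<alpha> \<and> a < \<alpha>)}"

lemma restr_finite_data: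
  assumes p: "basic_cond C p" shows "restr p D \<in> finite_data"
proof -
  have "\<alpha> \<in> u_of p \<and> i < m_of p \<alpha> \<and> a < \<alpha>" if "h_of p i \<alpha> = Some a" for i \<alpha> a
  proof -
    have u: "\<alpha> \<in> u_of p" "i < m_of p \<alpha>" using that h_None[OF p, of i \<alpha>] by (simp_all add: not_le)
    then show ?thesis using h_sep[OF p u(1)] that unfolding h_separated_def by blast
  qed
  moreover have "v \<in> s_of p" if "v \<in> e" "e \<in> g_of p" for v e
    using edge_subset[OF p that(2)] u_subset_s[OF p] that(1) by blast
  ultimately show ?thesis
    using finite_s[OF p] u_subset_s[OF p]
    unfolding finite_data_def restr_def by (auto split: if_splits)
qed

lemma restr_self:
  assumes p: "basic_cond C p" shows "restr p (s_of p) = p"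
proof -
  have "u_of p \<inter> s_of p = u_of p" using u_subset_s[OF p] by blast
  moreover have "{e \<in> g_of p. e \<subseteq> s_of p} = g_of p" using edge_subset[OF p] u_subset_s[OF p] by blast
  moreover have "m_of p \<in> extensional (u_of p)" "c_of p \<in> extensional (g_of p)"
    using p unfolding basic_cond_def by (simp_all add: PiE_def)
  moreover have "(\<lambda>i \<beta>. if \<beta> \<in> s_of p then h_of p i \<beta> else None) = h_of p"
  proof (intro ext)
    fix i \<beta>
    have "h_of p i \<beta> = None" if "\<beta> \<notin> s_of p" using that h_None[OF p] u_subset_s[OF p] by blast
    then show "(if \<beta> \<in> s_of p then h_of p i \<beta> else None) = h_of p i \<beta>" by simp
  qed
  ultimately show ?thesis by (simp add: restr_def extensional_restrict)
qed

lemma countable_finite_data: "countable {p \<in> finite_data. s_of p \<subseteq> {..<\<delta>}}" (is "countable ?X")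
proof -
  let ?fin = "\<lambda>X. {A. finite A \<and> A \<subseteq> X}"
  define code where "code p = (s_of p, u_of p, g_of p, (\<lambda>\<alpha>. (\<alpha>, m_of p \<alpha>)) ` u_of p,
      {(i, \<alpha>, a). h_of p i \<alpha> = Some a}, (\<lambda>e. (e, c_of p e)) ` g_of p)" for p :: cond
  define R where "R = ?fin {..<\<delta>} \<times> ?fin {..<\<delta>} \<times> ?fin (?fin {..<\<delta>}) \<times> ?fin ({..<\<delta>} \<times> (UNIV :: nat set)) \<times>
      ?fin ((UNIV :: nat set) \<times> {..<\<delta>} \<times> {..<\<delta>}) \<times> ?fin (?fin {..<\<delta>} \<times> (UNIV :: nat set))"
  have "countable R"
    unfolding R_def by (intro countable_SIGMA countable_Collect_finite_subset countable_initial_segment_omega1 countableI_type)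
  moreover have "code ` ?X \<subseteq> R"
  proof
    fix z assume "z \<in> code ` ?X"
    then obtain p where p: "p \<in> finite_data" "s_of p \<subseteq> {..<\<delta>}" "z = code p" by blast
    have s: "finite (s_of p)" "u_of p \<subseteq> s_of p" "g_of p \<subseteq> Pow (s_of p)"
      and h: "\<And>i \<alpha> a. h_of p i \<alpha> = Some a \<Longrightarrow> \<alpha> \<in> u_of p \<and> i < m_of p \<alpha> \<and> a < \<alpha>"
      using p(1) unfolding finite_data_def by auto
    have fu: "finite (u_of p)" and fg: "finite (g_of p)"
      using s finite_subset by blast+
    have "{(i, \<alpha>, a). h_of p i \<alpha> = Some a} \<subseteq> (\<lambda>(\<alpha>, i). (i, \<alpha>, the (h_of p i \<alpha>))) ` (SIGMA \<alpha>:u_of p. {..<m_of p \<alpha>})"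
      using h by force
    then have fh: "finite {(i, \<alpha>, a). h_of p i \<alpha> = Some a}"
      by (rule finite_subset) (intro finite_imageI finite_SigmaI fu finite_lessThan)
    have "{(i, \<alpha>, a). h_of p i \<alpha> = Some a} \<subseteq> UNIV \<times> {..<\<delta>} \<times> {..<\<delta>}"
    proof clarsimp
      fix i \<alpha> a assume "h_of p i \<alpha> = Some a"
      from h[OF this] have "\<alpha> \<in> s_of p" "a < \<alpha>" using s(2) by auto
      then show "\<alpha> < \<delta> \<and> a < \<delta>" using p(2) by (auto intro: less_trans)
    qed
    moreover have "g_of p \<subseteq> ?fin {..<\<delta>}" using s p(2) finite_subset by blast
    ultimately show "z \<in> R"
      unfolding p(3) code_def R_def using s p(2) fu fg fh by auto
  qed
  ultimately have "countable (code ` ?X)" using countable_subset by blast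
  moreover have "inj_on code ?X"
  proof (rule inj_onI)
    fix p q assume "p \<in> ?X" "q \<in> ?X" and e: "code p = code q"
    then have pq: "p \<in> finite_data" "q \<in> finite_data" by auto
    have su: "s_of p = s_of q" "u_of p = u_of q" "g_of p = g_of q" using e unfolding code_def by auto
    have m: "m_of p = m_of q"
    proof
      fix \<alpha> show "m_of p \<alpha> = m_of q \<alpha>"
      proof (cases "\<alpha> \<in> u_of p")
        case True
        then have "(\<alpha>, m_of p \<alpha>) \<in> (\<lambda>\<alpha>. (\<alpha>, m_of p \<alpha>)) ` u_of p" by blast
        also have "\<dots> = (\<lambda>\<alpha>. (\<alpha>, m_of q \<alpha>)) ` u_of q" using e unfolding code_def by blast
        finally have "(\<alpha>, m_of p \<alpha>) \<in> (\<lambda>\<alpha>. (\<alpha>, m_of q \<alpha>)) ` u_of q" .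
        then show ?thesis by auto
      next
        case False
        then show ?thesis using pq su unfolding finite_data_def extensional_def by auto
      qed
    qed
    have c: "c_of p = c_of q"
    proof
      fix a show "c_of p a = c_of q a"
      proof (cases "a \<in> g_of p")
        case True
        then have "(a, c_of p a) \<in> (\<lambda>e. (e, c_of p e)) ` g_of p" by blast
        also have "\<dots> = (\<lambda>e. (e, c_of q e)) ` g_of q" using e unfolding code_def by blast
        finally have "(a, c_of p a) \<in> (\<lambda>e. (e, c_of q e)) ` g_of q" .
        then show ?thesis by auto
      next
        case False
        then show ?thesis using pq su unfolding finite_data_def extensional_def by auto
      qed
    qed
    have hh: "{(i, \<alpha>, a). h_of p i \<alpha> = Some a} = {(i, \<alpha>, a). h_of q i \<alpha> = Some a}"
      using e unfolding code_def by blast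
    have hS: "h_of p i \<alpha> = Some a \<longleftrightarrow> h_of q i \<alpha> = Some a" for i \<alpha> a
    proof -
      have "(i, \<alpha>, a) \<in> {(i, \<alpha>, a). h_of p i \<alpha> = Some a} \<longleftrightarrow> (i, \<alpha>, a) \<in> {(i, \<alpha>, a). h_of q i \<alpha> = Some a}"
        unfolding hh ..
      then show ?thesis by simp
    qed
    have "h_of p i \<alpha> = h_of q i \<alpha>" for i \<alpha>
    proof (cases "h_of q i \<alpha>")
      case None
      then have "h_of p i \<alpha> \<noteq> Some a" for a using hS by simp
      then have "h_of p i \<alpha> = None" by (metis not_None_eq)
      then show ?thesis using None by simp
    next
      case (Some a)
      then have "h_of p i \<alpha> = Some a" using hS by blast
      then show ?thesis using Some by simp
    qed
    then have h: "h_of p = h_of q" by (intro ext)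
    show "p = q" using su m c h by (intro cond.equality) auto
  qed
  ultimately show ?thesis by (rule countable_image_inj_on)
qed

lemma omega1_times_nat: "\<exists>j :: omega1 \<times> nat \<Rightarrow> omega1. inj j"
proof -
  include cardinal_syntax
  have inf: "infinite (UNIV :: omega1 set)" using uncountable_omega1 countable_finite by blast
  have "|UNIV :: nat set| \<le>o |UNIV :: omega1 set|"
    using inf infinite_iff_card_of_nat by blast
  then have "|(UNIV :: omega1 set) \<times> (UNIV :: nat set)| =o |UNIV :: omega1 set|"
    using card_of_Times_infinite[OF inf, of "UNIV :: nat set"] by auto
  then have "|(UNIV :: omega1 set) \<times> (UNIV :: nat set)| \<le>o |UNIV :: omega1 set|" by (rule ordIso_imp_ordLeq)
  then show ?thesis unfolding card_of_ordLeq[symmetric] by (auto simp: UNIV_Times_UNIV)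
qed

lemma small_Sigma:
  assumes A: "small A" and B: "\<And>a. a \<in> A \<Longrightarrow> countable (B a)"
  shows "small (Sigma A B)"
proof -
  obtain j :: "_ \<Rightarrow> omega1" where j: "inj_on j A" using A unfolding small_def by blast
  obtain k :: "omega1 \<times> nat \<Rightarrow> omega1" where k: "inj k" using omega1_times_nat by blast
  let ?F = "\<lambda>(a, b). k (j a, to_nat_on (B a) b)"
  have "inj_on ?F (Sigma A B)"
  proof (rule inj_onI, clarify)
    fix a b a' b' assume ab: "a \<in> A" "b \<in> B a" "a' \<in> A" "b' \<in> B a'"
      and e: "k (j a, to_nat_on (B a) b) = k (j a', to_nat_on (B a') b')"
    then have e': "j a = j a'" "to_nat_on (B a) b = to_nat_on (B a') b'" using injD[OF k e] by auto
    have "a = a'" using inj_onD[OF j e'(1)] ab by blast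
    moreover from this have "b = b'" using e'(2) ab inj_on_to_nat_on[OF B[OF ab(1)]] by (auto dest: inj_onD)
    ultimately show "a = a' \<and> b = b'" by blast
  qed
  then show ?thesis unfolding small_def by blast
qed

lemma small_subset: "small B \<Longrightarrow> A \<subseteq> B \<Longrightarrow> small A"
  unfolding small_def using inj_on_subset by blast

lemma small_UNIV_omega1: "small (S :: omega1 set)"
  unfolding small_def by (rule exI[of _ id]) simp

lemma small_Qf: "small (Qf C f)"
proof (rule small_subset)
  let ?S = "Sigma UNIV (\<lambda>\<delta>. {p \<in> finite_data. s_of p \<subseteq> {..<\<delta>}})"
  show "small (snd ` ?S)"
    by (intro small_image small_Sigma small_UNIV_omega1 countable_finite_data)
  show "Qf C f \<subseteq> snd ` ?S"
  proof
    fix p assume "p \<in> Qf C f"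
    then have b: "basic_cond C p" by (rule Qf_basic)
    obtain \<delta> where "\<forall>a\<in>s_of p. a < \<delta>" using countable_bounded_omega1[OF countable_finite[OF finite_s[OF b]]] by blast
    then have "(\<delta>, p) \<in> ?S" using restr_finite_data[OF b, of "s_of p"] restr_self[OF b] by auto
    then show "p \<in> snd ` ?S" by force
  qed
qed

definition rank :: "'a::linorder set \<Rightarrow> 'a \<Rightarrow> nat" where "rank s v = card {w \<in> s. w < v}"

lemma rank_inj: "finite s \<Longrightarrow> inj_on (rank s) s"
proof (rule linorder_inj_onI)
  fix v w assume "finite s" "v < w" "v \<in> s" "w \<in> s"
  then have "rank s v < rank s w" unfolding rank_def by (intro psubset_card_mono) auto
  then show "rank s v \<noteq> rank s w" by simp
qed auto

text \<open>The colored graph up to the order isomorphism of its vertex set with a natural number.\<close>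
definition shape :: "cond \<Rightarrow> (nat set \<times> nat) set" where
  "shape q = (\<lambda>e. (rank (s_of q) ` e, c_of q e)) ` g_of q"

text \<open>Vertices with the same position correspond to each other. The set \<open>D\<close> is fixed because it is an
  initial segment of both vertex sets.\<close>
lemma shape_fold:
  assumes b: "basic_cond C q1" "basic_cond C q2" and sh: "shape q1 = shape q2"
    and x: "rank (s_of q1) x = rank (s_of q2) \<alpha>" "\<alpha> \<in> s_of q2"
    and D: "D \<subseteq> s_of q1" "D \<subseteq> s_of q2"
    and init: "\<And>d v. d \<in> D \<Longrightarrow> v \<in> s_of q1 - D \<Longrightarrow> d < v" "\<And>d v. d \<in> D \<Longrightarrow> v \<in> s_of q2 - D \<Longrightarrow> d < v"
  obtains \<phi> where "\<phi> x = \<alpha>" "\<And>d. d \<in> D \<Longrightarrow> \<phi> d = d"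
    "\<And>e. e \<in> g_of q1 \<Longrightarrow> \<phi> ` e \<in> g_of q2 \<and> c_of q2 (\<phi> ` e) = c_of q1 e"
proof
  define \<phi> where "\<phi> v = inv_into (s_of q2) (rank (s_of q2)) (rank (s_of q1) v)" for v
  have inj: "inj_on (rank (s_of q2)) (s_of q2)" using finite_s[OF b(2)] by (rule rank_inj)
  show "\<phi> x = \<alpha>" unfolding \<phi>_def x(1) using inj x(2) by (rule inv_into_f_f)
  show "\<phi> d = d" if d: "d \<in> D" for d
  proof -
    have "{w \<in> s_of q1. w < d} = {w \<in> D. w < d}" using D(1) init(1)[OF d] by (auto dest: less_asym)
    moreover have "{w \<in> s_of q2. w < d} = {w \<in> D. w < d}" using D(2) init(2)[OF d] by (auto dest: less_asym)
    ultimately have "rank (s_of q1) d = rank (s_of q2) d" unfolding rank_def by simp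
    moreover have "d \<in> s_of q2" using d D(2) by blast
    ultimately show ?thesis unfolding \<phi>_def using inj by (simp add: inv_into_f_f)
  qed
  show "\<phi> ` e \<in> g_of q2 \<and> c_of q2 (\<phi> ` e) = c_of q1 e" if e: "e \<in> g_of q1" for e
  proof -
    have "(rank (s_of q1) ` e, c_of q1 e) \<in> shape q2" using e unfolding sh[symmetric] by (simp add: shape_def)
    then obtain e' where e': "e' \<in> g_of q2" "rank (s_of q1) ` e = rank (s_of q2) ` e'" "c_of q1 e = c_of q2 e'"
      unfolding shape_def by blast
    have "e' \<subseteq> s_of q2" using edge_subset[OF b(2) e'(1)] u_subset_s[OF b(2)] by blast
    then have "inv_into (s_of q2) (rank (s_of q2)) ` rank (s_of q2) ` e' = e'"
      using inj by (intro inv_into_image_cancel)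
    moreover have "\<phi> ` e = inv_into (s_of q2) (rank (s_of q2)) ` rank (s_of q1) ` e"
      unfolding \<phi>_def by (simp add: image_image)
    ultimately show ?thesis using e' by simp
  qed
qed

section \<open>Equal values on an edge\<close>

text \<open>The parameters of the reflection argument: a root below \<open>\<delta>\<close>, a shape, the position of a vertex
  and the value decided for it. They are countable in number.\<close>
definition types_below :: "omega1 \<Rightarrow> (cond \<times> (nat set \<times> nat) set \<times> nat \<times> nat) set" where
  "types_below \<delta> = {p \<in> finite_data. s_of p \<subseteq> {..<\<delta>}} \<times>
     {A. finite A \<and> A \<subseteq> {B. finite B \<and> B \<subseteq> UNIV} \<times> UNIV} \<times> UNIV \<times> UNIV"

lemma countable_types_below: "countable (types_below \<delta>)"
  unfolding types_below_def
  by (intro countable_SIGMA countable_finite_data countable_Collect_finite_subset countableI_type)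

lemma types_below_mono: "\<beta> \<le> \<delta> \<Longrightarrow> types_below \<beta> \<subseteq> types_below \<delta>"
  unfolding types_below_def by (intro Sigma_mono) (auto intro: less_le_trans)

lemma types_below_cont:
  assumes "limit_ordinal \<delta>" "t \<in> types_below \<delta>" shows "\<exists>\<beta><\<delta>. t \<in> types_below \<beta>"
proof -
  obtain p t' where t: "t = (p, t')" by (cases t)
  then have "finite (s_of p)" "\<And>a. a \<in> s_of p \<Longrightarrow> a < \<delta>"
    using assms(2) unfolding types_below_def finite_data_def by auto
  from finite_below_limit[OF assms(1) this] obtain \<beta> where "\<beta> < \<delta>" "\<forall>a\<in>s_of p. a < \<beta>" by blast
  then show ?thesis using assms(2) t unfolding types_below_def by (intro exI[of _ \<beta>]) auto
qed

lemma finite_shape: "basic_cond C q \<Longrightarrow> shape q \<in> {A. finite A \<and> A \<subseteq> {B. finite B \<and> B \<subseteq> UNIV} \<times> UNIV}"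
proof -
  assume b: "basic_cond C q"
  have "finite (rank (s_of q) ` e)" if "e \<in> g_of q" for e
    using edge_card[OF b that] by (intro finite_imageI) (metis card.infinite zero_neq_numeral)
  then show ?thesis using finite_g[OF b] unfolding shape_def by auto
qed

text \<open>The condition \<open>q\<close> has type \<open>\<tau>\<close> with distinguished vertex \<open>x\<close>, its vertices outside the root lie in the
  blocks, and the blocks contain \<open>h\<^sub>0(x)\<close>, \<open>h\<^sub>1(x)\<close>, \<dots>, \<open>x\<close> in this order.\<close>
definition realizes ::
  "cond set \<Rightarrow> (omega1 \<Rightarrow> nat \<Rightarrow> cond set) \<Rightarrow> cond \<times> (nat set \<times> nat) set \<times> nat \<times> nat \<Rightarrow> omega1 set list \<Rightarrow> cond \<Rightarrow> omega1 \<Rightarrow> bool" where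
  "realizes Q A \<tau> Bs q x \<longleftrightarrow> (case \<tau> of (p\<^sub>0, sh, rk, n) \<Rightarrow>
     q \<in> Q \<and> q \<in> A x n \<and> x \<in> u_of q \<and> s_of p\<^sub>0 \<subseteq> s_of q \<and> restr q (s_of p\<^sub>0) = p\<^sub>0 \<and>
     (\<forall>d\<in>s_of p\<^sub>0. \<forall>v\<in>s_of q - s_of p\<^sub>0. d < v) \<and> shape q = sh \<and> rank (s_of q) x = rk \<and>
     s_of q - s_of p\<^sub>0 \<subseteq> \<Union> (set Bs) \<and> (\<forall>i. Suc i < length Bs \<longrightarrow> (\<exists>a\<in>Bs ! i. h_of q i x = Some a)) \<and>
     x \<in> Bs ! (length Bs - 1))"

text \<open>The elements of \<open>C\<^sub>\<alpha>\<close> that separate the ordinals attached to \<open>\<alpha>\<close>, followed by one that lies above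
  all elements of \<open>X\<close> below \<open>\<alpha>\<close>.\<close>
lemma separating_sequence:
  fixes h :: "nat \<Rightarrow> omega1"
  assumes lim: "limit_ordinal \<alpha>" and C: "C \<alpha> \<subseteq> {..<\<alpha>}" "\<And>\<beta>. \<beta> < \<alpha> \<Longrightarrow> \<exists>\<gamma>\<in>C \<alpha>. \<beta> < \<gamma>"
    and q: "h_separated C q \<alpha>" and h: "\<And>i. i < N \<Longrightarrow> h_of q i \<alpha> = Some (h i)" and X: "finite X"
  obtains \<epsilon> where "\<And>i. i \<le> N \<Longrightarrow> \<epsilon> i \<in> C \<alpha>" "\<And>i. i < N \<Longrightarrow> \<epsilon> i < h i" "\<And>i. i < N \<Longrightarrow> h i < \<epsilon> (Suc i)"
    "\<And>v. v \<in> X \<Longrightarrow> v < \<alpha> \<Longrightarrow> v < \<epsilon> N"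
proof (cases N)
  case 0
  have "\<exists>\<beta><\<alpha>. \<forall>v\<in>{v \<in> X. v < \<alpha>}. v < \<beta>"
    by (rule finite_below_limit[OF lim]) (use X in simp_all)
  then obtain \<beta> where \<beta>: "\<beta> < \<alpha>" "\<forall>v\<in>{v \<in> X. v < \<alpha>}. v < \<beta>" by blast
  obtain \<gamma> where \<gamma>: "\<gamma> \<in> C \<alpha>" "\<beta> < \<gamma>" using C(2)[OF \<beta>(1)] by blast
  then have "v < \<gamma>" if "v \<in> X" "v < \<alpha>" for v using \<beta>(2) that by (auto intro: less_trans)
  then show ?thesis using 0 by (intro that[of "\<lambda>_. \<gamma>"]) (use \<gamma> in auto)
next
  case (Suc M)
  have h\<alpha>: "h i < \<alpha>" if "i < N" for i using q h[OF that] unfolding h_separated_def by blast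
  have "\<exists>\<beta><\<alpha>. \<forall>v\<in>insert (h M) {v \<in> X. v < \<alpha>}. v < \<beta>"
    by (rule finite_below_limit[OF lim]) (use X h\<alpha>[of M] Suc in auto)
  then obtain \<beta> where \<beta>: "\<beta> < \<alpha>" "\<forall>v\<in>insert (h M) {v \<in> X. v < \<alpha>}. v < \<beta>" by blast
  then obtain \<gamma> where \<gamma>: "\<gamma> \<in> C \<alpha>" "\<beta> < \<gamma>" using C(2) by blast
  have \<gamma>': "h M < \<gamma>" "\<And>v. v \<in> X \<Longrightarrow> v < \<alpha> \<Longrightarrow> v < \<gamma>" using \<beta>(2) \<gamma>(2) less_trans by blast+
  have "\<exists>e\<in>C \<alpha>. h i < e \<and> e < h (Suc i)" if "Suc i < N" for i
    using q h[of i] h[of "Suc i"] that unfolding h_separated_def by (meson Suc_lessD)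
  then obtain e where e: "\<And>i. Suc i < N \<Longrightarrow> e i \<in> C \<alpha> \<and> h i < e i \<and> e i < h (Suc i)" by metis
  have C0: "(LEAST \<gamma>. \<gamma> \<in> C \<alpha>) \<in> C \<alpha>" using \<gamma>(1) by (rule LeastI)
  define \<epsilon> where "\<epsilon> i = (case i of 0 \<Rightarrow> LEAST \<gamma>. \<gamma> \<in> C \<alpha> | Suc j \<Rightarrow> if Suc j < N then e j else \<gamma>)" for i
  show ?thesis
  proof (rule that)
    show "\<epsilon> i \<in> C \<alpha>" if "i \<le> N" for i using C0 e \<gamma>(1) unfolding \<epsilon>_def by (cases i) auto
    show "\<epsilon> i < h i" if "i < N" for i
    proof (cases i)
      case 0
      then show ?thesis using q h[OF that] unfolding h_separated_def \<epsilon>_def by auto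
    next
      case (Suc j)
      then show ?thesis using e[of j] that unfolding \<epsilon>_def by auto
    qed
    show "h i < \<epsilon> (Suc i)" if "i < N" for i
    proof (cases "Suc i < N")
      case True
      then show ?thesis using e[of i] unfolding \<epsilon>_def by auto
    next
      case False
      then have "i = M" using that Suc by simp
      then show ?thesis using False \<gamma>'(1) unfolding \<epsilon>_def by simp
    qed
    show "v < \<epsilon> N" if "v \<in> X" "v < \<alpha>" for v using \<gamma>'(2)[OF that] Suc unfolding \<epsilon>_def by simp
  qed
qed

lemma largest_index:
  fixes \<epsilon> :: "nat \<Rightarrow> 'a::linorder"
  assumes "\<epsilon> 0 \<le> v"
  obtains i where "i \<le> N" "\<epsilon> i \<le> v" "i < N \<longrightarrow> v < \<epsilon> (Suc i)"
  using assms
proof (induction N arbitrary: thesis)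
  case 0
  then show ?case by blast
next
  case (Suc N)
  show ?case
  proof (cases "\<epsilon> (Suc N) \<le> v")
    case True
    then show ?thesis using Suc.prems(1)[of "Suc N"] by simp
  next
    case False
    obtain i where "i \<le> N" "\<epsilon> i \<le> v" "i < N \<longrightarrow> v < \<epsilon> (Suc i)" using Suc.IH[OF _ Suc.prems(2)] by blast
    then show ?thesis using Suc.prems(1)[of i] False by (cases "i = N") (auto simp: not_le)
  qed
qed

text \<open>The set \<open>A \<alpha> n\<close> stands for the conditions that decide the value \<open>n\<close> for \<open>\<alpha>\<close>. A condition that decides a
  value for a well-chosen \<open>\<alpha>\<close> is reflected to a copy that decides the same value for a smaller \<open>x\<close>, and
  the two are amalgamated along a new edge.\<close>
theorem same_value_on_edge:
  fixes A :: "omega1 \<Rightarrow> nat \<Rightarrow> cond set"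
  assumes C: "club_guessing C" and f: "strict_mono f" and p: "p \<in> Qf C f"
    and down: "\<And>\<alpha> n q q'. q \<in> A \<alpha> n \<Longrightarrow> q' \<in> Qf C f \<Longrightarrow> extends q' q \<Longrightarrow> q' \<in> A \<alpha> n"
    and dense: "\<And>\<alpha> q. q \<in> Qf C f \<Longrightarrow> extends q p \<Longrightarrow> \<exists>q'\<in>Qf C f. extends q' q \<and> (\<exists>n. q' \<in> A \<alpha> n)"
  shows "\<exists>q\<in>Qf C f. extends q p \<and> (\<exists>x \<alpha> n. x < \<alpha> \<and> {x, \<alpha>} \<in> g_of q \<and> q \<in> A x n \<and> q \<in> A \<alpha> n)"
proof -
  let ?Q = "{q \<in> Qf C f. extends q p}"
  have mf: "mono f" using f by (rule strict_mono_mono)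
  obtain \<gamma>\<^sub>0 where \<gamma>\<^sub>0: "\<forall>a\<in>s_of p. a < \<gamma>\<^sub>0"
    using countable_bounded_omega1[OF countable_finite[OF finite_s[OF Qf_basic[OF p]]]] by blast
  define \<Phi> where "\<Phi> \<tau> Bs \<longleftrightarrow> (\<exists>q x. realizes ?Q A \<tau> Bs q x)" for \<tau> Bs
  obtain \<alpha> where lim: "limit_ordinal \<alpha>" and Crefl: "C \<alpha> \<subseteq> {\<delta>. \<gamma>\<^sub>0 < \<delta> \<and> reflecting \<Phi> types_below \<delta>}"
    and C\<alpha>: "C \<alpha> \<subseteq> {..<\<alpha>}" "\<And>\<beta>. \<beta> < \<alpha> \<Longrightarrow> \<exists>\<gamma>\<in>C \<alpha>. \<beta> < \<gamma>"
    using C countable_types_below types_below_mono types_below_cont by (rule guess_reflecting) blast+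
  have "\<alpha> \<notin> s_of p"
  proof
    assume "\<alpha> \<in> s_of p"
    then have "\<alpha> < \<gamma>\<^sub>0" using \<gamma>\<^sub>0 by blast
    then obtain \<gamma> where "\<gamma> \<in> C \<alpha>" using C\<alpha>(2) lim unfolding limit_ordinal_def by blast
    then have "\<gamma>\<^sub>0 < \<gamma>" "\<gamma> < \<alpha>" using Crefl C\<alpha>(1) by blast+
    then show False using \<open>\<alpha> < \<gamma>\<^sub>0\<close> by (meson less_asym less_trans)
  qed
  then obtain q0 where q0: "q0 \<in> Qf C f" "extends q0 p" "\<alpha> \<in> u_of q0"
    using add_vertex[OF mf p lim] by blast
  then obtain q1 n where q1: "q1 \<in> Qf C f" "extends q1 q0" "q1 \<in> A \<alpha> n" using dense by blast
  have u1: "\<alpha> \<in> u_of q1" using q0(3) q1(2) unfolding extends_def by blast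
  \<comment> \<open>The color of the edge to be added.\<close>
  obtain r where r: "\<And>e. e \<in> g_of q1 \<Longrightarrow> c_of q1 e < r"
    using finite_imageI[OF finite_g[OF Qf_basic[OF q1(1)]], of "c_of q1"]
    by (meson finite_nat_iff_bounded imageI lessThan_iff subsetD)
  \<comment> \<open>Requirement (2) for an edge of color \<open>r\<close> involves the values with index at most \<open>f r\<close>.\<close>
  define N where "N = Suc (f r)"
  obtain q2 where q2: "q2 \<in> Qf C f" "extends q2 q1" "\<alpha> \<in> u_of q2" "N \<le> m_of q2 \<alpha>" "g_of q2 = g_of q1" "c_of q2 = c_of q1"
    using raise_m[OF mf q1(1) u1 C\<alpha>] by blast
  have q2p: "extends q2 p" using extends_trans q2(2) q1(2) q0(2) by blast
  have q2A: "q2 \<in> A \<alpha> n" using down[OF q1(3) q2(1,2)] .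
  have b2: "basic_cond C q2" using q2(1) by (rule Qf_basic)
  define h where "h i = the (h_of q2 i \<alpha>)" for i
  have h: "h_of q2 i \<alpha> = Some (h i)" if "i < N" for i
    using h_Some[OF b2 q2(3), of i] that q2(4) unfolding h_def by auto
  define X where "X = s_of q2 \<union> h ` {..<N}"
  have finX: "finite X" unfolding X_def using finite_s[OF b2] by simp
  obtain \<epsilon> where \<epsilon>C: "\<And>i. i \<le> N \<Longrightarrow> \<epsilon> i \<in> C \<alpha>" and \<epsilon>h: "\<And>i. i < N \<Longrightarrow> \<epsilon> i < h i" "\<And>i. i < N \<Longrightarrow> h i < \<epsilon> (Suc i)"
    and \<epsilon>X: "\<And>v. v \<in> X \<Longrightarrow> v < \<alpha> \<Longrightarrow> v < \<epsilon> N"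
    using lim C\<alpha> h_sep[OF b2 q2(3)] h finX by (rule separating_sequence) blast+
  have \<epsilon>\<alpha>: "\<epsilon> i < \<alpha>" if "i \<le> N" for i using \<epsilon>C[OF that] C\<alpha>(1) by blast
  have \<epsilon>_refl: "reflecting \<Phi> types_below (\<epsilon> i)" if "i \<le> N" for i using \<epsilon>C[OF that] Crefl by blast
  have \<epsilon>_lim: "limit_ordinal (\<epsilon> i)" if "i \<le> N" for i using \<epsilon>_refl[OF that] unfolding reflecting_def by blast
  have \<epsilon>_less: "\<epsilon> i < \<epsilon> (Suc i)" if "i < N" for i using \<epsilon>h[OF that] by (rule less_trans)
  \<comment> \<open>The root, which the copy will share with \<open>q2\<close>; the blocks \<open>Bl i\<close> below divide the rest.\<close>
  define D where "D = s_of q2 \<inter> {..<\<epsilon> 0}"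
  define p0 where "p0 = restr q2 D"
  have sp0: "s_of p0 = D" unfolding p0_def restr_def D_def by auto
  define \<tau> where "\<tau> = (p0, shape q2, rank (s_of q2) \<alpha>, n)"
  have \<tau>: "\<tau> \<in> types_below (\<epsilon> 0)"
  proof -
    have "p0 \<in> {p \<in> finite_data. s_of p \<subseteq> {..<\<epsilon> 0}}"
      using restr_finite_data[OF b2, of D] sp0 unfolding p0_def D_def by auto
    then show ?thesis using finite_shape[OF b2] unfolding \<tau>_def types_below_def by blast
  qed
  define Bl where "Bl i = {v \<in> X. \<epsilon> i \<le> v \<and> (i < N \<longrightarrow> v < \<epsilon> (Suc i))}" for i
  have len: "length (map B [0..<Suc N]) = Suc N" for B :: "nat \<Rightarrow> omega1 set" by simp
  have nth: "map B [0..<Suc N] ! i = B i" if "i \<le> N" for B :: "nat \<Rightarrow> omega1 set" and i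
    using that by (subst nth_map) (auto simp del: upt_Suc)
  have uni: "v \<in> \<Union> (set (map B [0..<Suc N])) \<longleftrightarrow> (\<exists>i\<le>N. v \<in> B i)" for B :: "nat \<Rightarrow> omega1 set" and v
    by (auto simp del: upt_Suc simp: less_Suc_eq_le)
  have real2: "realizes ?Q A \<tau> (map Bl [0..<Suc N]) q2 \<alpha>"
  proof -
    have "s_of q2 - D \<subseteq> \<Union> (set (map Bl [0..<Suc N]))"
    proof
      fix v assume v: "v \<in> s_of q2 - D"
      then have "\<epsilon> 0 \<le> v" unfolding D_def by auto
      then obtain i where "i \<le> N" "\<epsilon> i \<le> v" "i < N \<longrightarrow> v < \<epsilon> (Suc i)" by (rule largest_index[where N=N])
      then have "v \<in> Bl i" using v unfolding Bl_def X_def by blast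
      then show "v \<in> \<Union> (set (map Bl [0..<Suc N]))" unfolding uni using \<open>i \<le> N\<close> by blast
    qed
    moreover have "\<exists>a\<in>map Bl [0..<Suc N] ! i. h_of q2 i \<alpha> = Some a" if "Suc i < length (map Bl [0..<Suc N])" for i
    proof -
      have i: "i < N" using that unfolding len by simp
      have "h i \<in> Bl i" unfolding Bl_def X_def using \<epsilon>h[OF i] i by (auto intro: less_imp_le)
      then show ?thesis using h[OF i] nth[of i Bl] i by auto
    qed
    moreover have "\<alpha> \<in> map Bl [0..<Suc N] ! (length (map Bl [0..<Suc N]) - 1)"
    proof -
      have "\<alpha> \<in> Bl N" unfolding Bl_def X_def using q2(3) u_subset_s[OF b2] \<epsilon>\<alpha>[of N] by (auto intro: less_imp_le)
      then show ?thesis unfolding len using nth[of N Bl] by simp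
    qed
    moreover have "\<forall>d\<in>D. \<forall>v\<in>s_of q2 - D. d < v" unfolding D_def by (auto intro: less_le_trans)
    moreover have "D \<subseteq> s_of q2" unfolding D_def by blast
    ultimately show ?thesis
      unfolding realizes_def \<tau>_def prod.case sp0 using q2(1,3) q2p q2A p0_def by blast
  qed
  \<comment> \<open>Choosing block \<open>i\<close> of the copy between \<open>\<gamma> i\<close> and \<open>\<epsilon> i\<close> makes it disjoint from \<open>q2\<close> and lets the
    values of \<open>h\<close> alternate.\<close>
  have "\<exists>\<beta>. i \<le> N \<longrightarrow> \<beta> < \<epsilon> i \<and> (\<forall>v\<in>X. v < \<epsilon> i \<longrightarrow> v < \<beta>)" for i
  proof (cases "i \<le> N")
    case True
    have "\<exists>\<beta><\<epsilon> i. \<forall>v\<in>{v \<in> X. v < \<epsilon> i}. v < \<beta>"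
      by (rule finite_below_limit[OF \<epsilon>_lim[OF True]]) (use finX in simp_all)
    then show ?thesis by blast
  qed simp
  then obtain \<gamma> where \<gamma>: "\<And>i. i \<le> N \<Longrightarrow> \<gamma> i < \<epsilon> i" "\<And>i v. i \<le> N \<Longrightarrow> v \<in> X \<Longrightarrow> v < \<epsilon> i \<Longrightarrow> v < \<gamma> i" by metis
  have \<Phi>2: "\<Phi> \<tau> (map Bl [0..<Suc N])" unfolding \<Phi>_def using real2 by blast
  have Bl: "finite (Bl i)" "a \<in> Bl i \<Longrightarrow> \<epsilon> i \<le> a" "i < N \<Longrightarrow> a \<in> Bl i \<Longrightarrow> a < \<epsilon> (Suc i)" for i a
    unfolding Bl_def using finX by simp_all
  obtain B where B: "\<And>i b. i \<le> N \<Longrightarrow> b \<in> B i \<Longrightarrow> \<gamma> i < b \<and> b < \<epsilon> i" "\<Phi> \<tau> (map B [0..<Suc N])"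
    using reflection[where T=types_below and \<Phi>=\<Phi> and \<tau>=\<tau> and \<epsilon>=\<epsilon> and N=N and A=Bl and \<gamma>=\<gamma>,
        OF types_below_mono \<epsilon>_refl \<epsilon>_less \<tau> Bl(1) Bl(2) Bl(3) \<Phi>2 \<gamma>(1)]
    by blast
  then obtain q x where "realizes ?Q A \<tau> (map B [0..<Suc N]) q x" unfolding \<Phi>_def by blast
  then have q: "q \<in> Qf C f" "extends q p" "q \<in> A x n" "x \<in> u_of q" "D \<subseteq> s_of q" "restr q D = p0"
    and above: "\<And>d v. d \<in> D \<Longrightarrow> v \<in> s_of q - D \<Longrightarrow> d < v"
    and sh: "shape q = shape q2" "rank (s_of q) x = rank (s_of q2) \<alpha>"
    and cover: "s_of q - D \<subseteq> \<Union> (set (map B [0..<Suc N]))"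
    and hB: "\<And>i. Suc i < length (map B [0..<Suc N]) \<Longrightarrow> \<exists>a\<in>map B [0..<Suc N] ! i. h_of q i x = Some a"
    and xB: "x \<in> map B [0..<Suc N] ! (length (map B [0..<Suc N]) - 1)"
    unfolding realizes_def \<tau>_def prod.case sp0 by blast+
  have bq: "basic_cond C q" using q(1) by (rule Qf_basic)
  have apart: "v \<notin> X" if "i \<le> N" "v \<in> B i" for v i
  proof
    assume "v \<in> X"
    have "\<gamma> i < v" "v < \<epsilon> i" using B(1)[OF that] by auto
    then show False using \<gamma>(2)[OF that(1) \<open>v \<in> X\<close>] by (meson less_asym)
  qed
  have new: "\<exists>i\<le>N. v \<in> B i" if "v \<in> s_of q - D" for v using cover that unfolding uni[symmetric] by blast
  have root: "s_of q \<inter> s_of q2 = D"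
  proof
    show "s_of q \<inter> s_of q2 \<subseteq> D"
    proof
      fix v assume v: "v \<in> s_of q \<inter> s_of q2"
      show "v \<in> D"
      proof (rule ccontr)
        assume "v \<notin> D"
        then obtain i where "i \<le> N" "v \<in> B i" using new v by blast
        then show False using apart v unfolding X_def by blast
      qed
    qed
    show "D \<subseteq> s_of q \<inter> s_of q2" using q(5) unfolding D_def by blast
  qed
  have xN: "x \<in> B N" using xB unfolding len using nth[of N B] by simp
  have x2: "x \<notin> s_of q2" using apart[OF _ xN] unfolding X_def by blast
  have x\<alpha>: "x < \<alpha>" using B(1)[OF _ xN] \<epsilon>\<alpha>[of N] by (auto intro: less_trans)
  have \<alpha>q: "\<alpha> \<notin> s_of q"
  proof
    assume "\<alpha> \<in> s_of q"
    have "\<alpha> \<notin> D" using \<epsilon>\<alpha>[of 0] unfolding D_def by (auto dest: less_asym)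
    then obtain i where "i \<le> N" "\<alpha> \<in> B i" using new \<open>\<alpha> \<in> s_of q\<close> by blast
    then show False using apart q2(3) u_subset_s[OF b2] unfolding X_def by blast
  qed
  have hq: "\<exists>a. h_of q i x = Some a \<and> \<gamma> i < a \<and> a < \<epsilon> i" if "i < N" for i
  proof -
    have "\<exists>a\<in>map B [0..<Suc N] ! i. h_of q i x = Some a" using hB[of i] that unfolding len by simp
    moreover have "i \<le> N" using that by simp
    ultimately obtain a where "a \<in> B i" "h_of q i x = Some a" using nth[of i B] by metis
    then show ?thesis using B(1)[of i a] that by auto
  qed
  have \<alpha>2: "\<alpha> \<in> s_of q2" using q2(3) u_subset_s[OF b2] by blast
  have D2: "D \<subseteq> s_of q2" "\<And>d v. d \<in> D \<Longrightarrow> v \<in> s_of q2 - D \<Longrightarrow> d < v"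
    unfolding D_def by (auto intro: less_le_trans)
  obtain \<phi> where \<phi>: "\<phi> x = \<alpha>" "\<And>d. d \<in> D \<Longrightarrow> \<phi> d = d"
    "\<And>e. e \<in> g_of q \<Longrightarrow> \<phi> ` e \<in> g_of q2 \<and> c_of q2 (\<phi> ` e) = c_of q e"
    using bq b2 sh \<alpha>2 q(5) D2(1) above D2(2) by (rule shape_fold) blast+
  interpret amalgamation C f q q2 x \<alpha> r \<phi>
  proof
    show "restr q (s_of q \<inter> s_of q2) = restr q2 (s_of q \<inter> s_of q2)" unfolding root using q(6) p0_def by simp
    show "d < v" if "d \<in> s_of q \<inter> s_of q2" "v \<in> s_of q - s_of q2" for d v
    proof -
      have "v \<in> s_of q - D" using that(2) D2(1) by blast
      then show ?thesis using above that(1) unfolding root by blast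
    qed
    show "c_of q2 e < r" if "e \<in> g_of q2" for e using r that q2(5,6) by simp
    show "\<phi> d = d" if "d \<in> s_of q \<inter> s_of q2" for d using \<phi>(2) that unfolding root .
    show "\<exists>a b. h_of q i x = Some a \<and> h_of q2 i \<alpha> = Some b \<and> a < b" if "i \<le> f r" for i
    proof -
      have i: "i < N" using that unfolding N_def by simp
      then obtain a where "h_of q i x = Some a" "a < \<epsilon> i" using hq by blast
      then show ?thesis using h[OF i] \<epsilon>h(1)[OF i] by (auto intro: less_trans)
    qed
    show "\<exists>a b. h_of q2 i \<alpha> = Some a \<and> h_of q (Suc i) x = Some b \<and> a < b" if "i < f r" for i
    proof -
      have i: "i < N" "Suc i < N" using that unfolding N_def by simp_all
      obtain b where b: "h_of q (Suc i) x = Some b" "\<gamma> (Suc i) < b" using hq[OF i(2)] by blast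
      have "h i \<in> X" unfolding X_def using i by blast
      then have "h i < \<gamma> (Suc i)" using \<gamma>(2)[of "Suc i" "h i"] \<epsilon>h(2)[OF i(1)] i by simp
      then show ?thesis using h[OF i(1)] b by (auto intro: less_trans)
    qed
    show "\<exists>b. h_of q2 0 \<alpha> = Some b \<and> d < b" if "d \<in> s_of q \<inter> s_of q2" for d
    proof -
      have "0 < N" unfolding N_def by simp
      moreover have "d < \<epsilon> 0" using that unfolding root D_def by blast
      ultimately show ?thesis using h[of 0] \<epsilon>h(1)[of 0] by (auto intro: less_trans)
    qed
  qed (fact f q(1) q2(1) q(4) x2 q2(3) \<alpha>q x\<alpha> \<phi>(1) \<phi>(3))+
  let ?r = "amalgam q q2 x \<alpha> r"
  have "extends ?r p" using amalgam_extends2 q2p by (rule extends_trans)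
  moreover have "?r \<in> A x n" using q(3) amalgam_cond amalgam_extends1 by (rule down)
  moreover have "?r \<in> A \<alpha> n" using q2A amalgam_cond amalgam_extends2 by (rule down)
  moreover have "{x, \<alpha>} \<in> g_of ?r" by (simp add: g_q)
  ultimately show ?thesis using amalgam_cond x\<alpha> by blast
qed

section \<open>The generic graph in the extension\<close>

locale generic_extension =
  fixes C :: "omega1 \<Rightarrow> omega1 set" and f :: "nat \<Rightarrow> nat" and \<iota> :: "omega1 \<Rightarrow> 'i"
  assumes guess: "club_guessing C" and f: "strict_mono f" and inj: "inj \<iota>"

sublocale generic_extension \<subseteq> small_forcing "Qf C f" extends top_cond \<iota>
proof
  have mf: "mono f" using f by (rule strict_mono_mono)
  show "extends p p" if "p \<in> Qf C f" for p using extends_refl[OF Qf_basic[OF that]] .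
  show "extends r p" if "extends r q" "extends q p" for p q r using that by (rule extends_trans)
  show "top_cond \<in> Qf C f" using mf by (rule top_cond_Qf)
  show "extends p top_cond" if "p \<in> Qf C f" for p using extends_top[OF Qf_basic[OF that]] .
  show "inj \<iota>" by (rule inj)
qed

context generic_extension begin

abbreviation forced :: "cond \<Rightarrow> ('i, cond) name sentence \<Rightarrow> bool"  (infix "\<tturnstile>" 49) where
  "p \<tturnstile> A \<equiv> forces (Qf C f) extends A p"

lemma mono_f: "mono f" using f by (rule strict_mono_mono)

abbreviation edge_name :: "omega1 set \<Rightarrow> ('i, cond) name" where "edge_name e \<equiv> check_ords top_cond e"
abbreviation X :: "('i, cond) name" where "X \<equiv> generic_graph C f"

lemma belowD: "q \<in> below p \<Longrightarrow> extends q p" by (simp add: below_def)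
lemma belowI: "q \<in> Qf C f \<Longrightarrow> extends q p \<Longrightarrow> q \<in> below p" by (simp add: below_def)

lemma elems_generic_graph: "elems X = {(edge_name e, p) | e p. p \<in> Qf C f \<and> e \<in> g_of p}"
proof -
  let ?S = "{(edge_name e, p) | e p. p \<in> Qf C f \<and> e \<in> g_of p}"
  have "?S = (\<lambda>(p, e). (edge_name e, p)) ` (SIGMA p:Qf C f. g_of p)" by force
  moreover have "small (SIGMA p:Qf C f. g_of p)"
    by (rule small_Sigma[OF small_Qf]) (use finite_g[OF Qf_basic] countable_finite in blast)
  ultimately have "small ?S" by (simp only: small_image)
  then show ?thesis unfolding generic_graph_def by (rule elems_name_of_set) auto
qed

lemma represents_edge_name: "finite e \<Longrightarrow> p \<in> Qf C f \<Longrightarrow> represents p ck e (edge_name e)"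
  by (intro represents_checks small_countable countable_finite)

lemma represents_omega1: "p \<in> Qf C f \<Longrightarrow> represents p ck (UNIV :: omega1 set) omega1_name"
  unfolding omega1_name_def by (rule represents_checks[OF small_UNIV_omega1])

lemma represents_omega: "p \<in> Qf C f \<Longrightarrow> represents p ck (UNIV :: nat set) omega_name"
  unfolding omega_name_def by (rule represents_checks[OF small_countable]) auto

lemma check_omega1_eq: "p \<in> Qf C f \<Longrightarrow> p \<tturnstile> ck (\<alpha> :: omega1) \<^bold>= ck \<beta> \<Longrightarrow> \<alpha> = \<beta>"
  using check_eq_iff[OF countable_initial_segment_omega1] .

lemma edge_name_inj:
  assumes p: "p \<in> Qf C f" and e: "finite e" "finite e'" "p \<tturnstile> edge_name e \<^bold>= edge_name e'"
  shows "e = e'"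
proof -
  have sub: "a \<in> e2" if ab: "finite e1" "finite e2" "p \<tturnstile> edge_name e1 \<^bold>= edge_name e2" "a \<in> e1" for e1 e2 a
  proof -
    have "p \<tturnstile> ck a \<^bold>\<in> edge_name e2"
      using mem_cong_right[OF ab(3) representsI[OF represents_edge_name[OF ab(1) p] ab(4)]] .
    with represents_edge_name[OF ab(2) p] obtain q b where q: "q \<in> below p" "b \<in> e2" "q \<tturnstile> ck a \<^bold>= ck b"
      using p by (rule representsE)
    then show ?thesis using check_omega1_eq[OF below_P[OF q(1)] q(3)] by simp
  qed
  show ?thesis using sub[OF e] sub[OF e(2,1) eq_sym[OF e(3)]] by blast
qed

lemma generic_edgeE:
  assumes "p \<tturnstile> e \<^bold>\<in> X" "p \<in> Qf C f"
  obtains q a b where "q \<in> below p" "{a, b} \<in> g_of q" "a \<noteq> b" "q \<tturnstile> e \<^bold>= edge_name {a, b}"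
proof -
  obtain q w t where q: "q \<in> below p" "(w, t) \<in> elems X" "q \<in> below t" "q \<tturnstile> e \<^bold>= w"
    using assms by (rule mem_elemsE)
  then obtain e' where e': "w = edge_name e'" "t \<in> Qf C f" "e' \<in> g_of t" unfolding elems_generic_graph by blast
  obtain a b where ab: "e' = {a, b}" "a \<noteq> b"
    using edge_card[OF Qf_basic[OF e'(2)] e'(3)] by (auto simp: card_2_iff)
  have "e' \<in> g_of q" using belowD[OF q(3)] e'(3) unfolding extends_def by blast
  then show ?thesis using that q(1,4) e'(1) ab by blast
qed

text \<open>An edge that is forced into the generic graph occurs in some stronger condition, and
  extensions do not add edges inside \<open>s\<close>.\<close>
lemma generic_edge_decided:
  assumes "p \<tturnstile> edge_name e \<^bold>\<in> X" "p \<in> Qf C f" "e \<subseteq> s_of p"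
  shows "e \<in> g_of p"
proof -
  have fe: "finite e" using assms(3) finite_s[OF Qf_basic[OF assms(2)]] finite_subset by blast
  obtain q a b where q: "q \<in> below p" "{a, b} \<in> g_of q" "q \<tturnstile> edge_name e \<^bold>= edge_name {a, b}"
    using assms(1,2) by (rule generic_edgeE)
  have "e = {a, b}" using edge_name_inj[OF below_P[OF q(1)] fe _ q(3)] by simp
  then show ?thesis using belowD[OF q(1)] q(2) assms(3) unfolding extends_def by blast
qed

lemma generic_edgeI: "e \<in> g_of p \<Longrightarrow> p \<in> Qf C f \<Longrightarrow> p \<tturnstile> edge_name e \<^bold>\<in> X"
  by (rule mem_elems[OF _ below_refl]) (auto simp: elems_generic_graph)

lemma edge_name_upair: "p \<in> Qf C f \<Longrightarrow> p \<tturnstile> is_upair (edge_name {a, b}) (ck a) (ck b)"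
  by (intro represents_upair represents_edge_name) simp_all

lemma edge_endpoints:
  assumes p: "p \<in> Qf C f" and e: "p \<tturnstile> e \<^bold>= edge_name {a, b}" "p \<tturnstile> is_upair e x y"
    and xy: "p \<tturnstile> x \<^bold>= ck c" "p \<tturnstile> y \<^bold>= ck d"
  shows "a = c \<and> b = d \<or> a = d \<and> b = c"
proof -
  have 1: "p \<tturnstile> is_upair (edge_name {a, b}) (ck c) (ck d)" using p e(1) xy e(2) by (rule upair_cong)
  obtain q where q: "q \<in> below p" "q \<tturnstile> ck a \<^bold>= ck c \<and> q \<tturnstile> ck b \<^bold>= ck d \<or> q \<tturnstile> ck a \<^bold>= ck d \<and> q \<tturnstile> ck b \<^bold>= ck c"
    using p edge_name_upair[OF p] 1 by (rule upair_eqE)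
  then show ?thesis using check_omega1_eq[OF below_P[OF q(1)]] by blast
qed

lemma generic_graph_is_graph:
  assumes p: "p \<in> Qf C f" shows "p \<tturnstile> is_graph omega1_name X"
proof -
  have "q \<tturnstile> (\<^bold>\<exists>x. \<^bold>\<exists>y. x \<^bold>\<in> omega1_name \<^bold>\<and> y \<^bold>\<in> omega1_name \<^bold>\<and> \<^bold>\<not> (x \<^bold>= y) \<^bold>\<and> is_upair e x y)"
    (is "q \<tturnstile> ?E") if q: "q \<in> below p" "q \<tturnstile> e \<^bold>\<in> X" for q e
  proof (rule forces_local)
    fix q' assume q': "q' \<in> below q"
    obtain r a b where r: "r \<in> below q'" "{a, b} \<in> g_of r" "a \<noteq> b" "r \<tturnstile> e \<^bold>= edge_name {a, b}"
      using forces_mono[OF q(2) q'] below_P[OF q'] by (rule generic_edgeE)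
    note rP = below_P[OF r(1)]
    have "r \<tturnstile> ck a \<^bold>\<in> omega1_name" "r \<tturnstile> ck b \<^bold>\<in> omega1_name"
      using representsI[OF represents_omega1[OF rP]] by blast+
    moreover have "r \<tturnstile> \<^bold>\<not> (ck a \<^bold>= ck b)"
      unfolding forces_Neg_iff using check_omega1_eq below_P r(3) by blast
    moreover have "r \<tturnstile> is_upair e (ck a) (ck b)"
      using upair_cong[OF rP eq_sym[OF r(4)] eq_refl eq_refl edge_name_upair[OF rP]] .
    ultimately have "r \<tturnstile> (ck a \<^bold>\<in> omega1_name \<^bold>\<and> ck b \<^bold>\<in> omega1_name \<^bold>\<and> \<^bold>\<not> (ck a \<^bold>= ck b) \<^bold>\<and> is_upair e (ck a) (ck b))"
      by simp
    then have "r \<tturnstile> ?E" by (intro forces_ExI[where x="ck a"] forces_ExI[where x="ck b"])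
    with r(1) show "\<exists>r\<in>below q'. r \<tturnstile> ?E" by blast
  qed
  then show ?thesis unfolding is_graph_def forces_All_iff forces_Imp_iff by blast
qed

lemma discrete_comp:
  assumes "\<And>\<alpha>::'o::wellorder. countable {..<\<alpha>}" "inj_on \<phi> S"
  shows "discrete (\<lambda>a. ck (\<phi> a :: 'o)) S"
  unfolding discrete_def using check_eq_iff[OF assms(1)] inj_onD[OF assms(2)] by blast

lemma countable_ordinal_embeds:
  assumes p: "p \<in> Qf C f" and b: "represents p ck {..<\<beta> :: omega1} b"
  shows "p \<tturnstile> is_countable omega_name b"
proof -
  define e where "e = to_nat_on {..<\<beta>}"
  have "p \<tturnstile> is_injection (fun_name ck (\<lambda>a. ck (e a)) {..<\<beta>}) b omega_name"
  proof (rule fun_name_injection)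
    show "small {..<\<beta>}" by (rule small_UNIV_omega1)
    show "p \<tturnstile> ck (e a) \<^bold>\<in> omega_name" if "a \<in> {..<\<beta>}" for a
      using representsI[OF represents_omega[OF p]] by blast
    show "discrete ck {..<\<beta>}" using countable_initial_segment_omega1 by (rule discrete_check)
    show "discrete (\<lambda>a. ck (e a)) {..<\<beta>}"
      unfolding e_def using countable_nat_below inj_on_to_nat_on[OF countable_initial_segment_omega1] by (rule discrete_comp)
  qed (fact b p)+
  then show ?thesis unfolding is_countable_def embeds_def by (rule forces_ExI)
qed

text \<open>The sentence \<open>V \<alpha> i\<close> expresses that \<open>i\<close> is a value, or a preimage, of \<open>\<alpha>\<close> under a function in the
  extension.\<close>
lemma collision:
  fixes V :: "omega1 \<Rightarrow> 'b \<Rightarrow> ('i, cond) name sentence"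
  assumes p: "p \<in> Qf C f" and S: "countable S"
    and dense: "\<And>\<alpha> q. q \<in> below p \<Longrightarrow> \<exists>r\<in>below q. \<exists>i\<in>S. r \<tturnstile> V \<alpha> i"
  obtains q x \<alpha> i where "q \<in> below p" "x < \<alpha>" "{x, \<alpha>} \<in> g_of q" "q \<tturnstile> V x i" "q \<tturnstile> V \<alpha> i"
proof -
  let ?A = "\<lambda>\<alpha> n. {q. q \<tturnstile> V \<alpha> (from_nat_into S n)}"
  have "\<exists>q\<in>Qf C f. extends q p \<and> (\<exists>x \<alpha> n. x < \<alpha> \<and> {x, \<alpha>} \<in> g_of q \<and> q \<in> ?A x n \<and> q \<in> ?A \<alpha> n)"
  proof (rule same_value_on_edge[OF guess f p])
    show "q' \<in> ?A \<alpha> n" if "q \<in> ?A \<alpha> n" "q' \<in> Qf C f" "extends q' q" for \<alpha> n q q'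
      using forces_mono[OF _ belowI[OF that(2,3)]] that(1) by blast
    show "\<exists>q'\<in>Qf C f. extends q' q \<and> (\<exists>n. q' \<in> ?A \<alpha> n)" if q: "q \<in> Qf C f" "extends q p" for \<alpha> q
    proof -
      obtain r i where r: "r \<in> below q" "i \<in> S" "r \<tturnstile> V \<alpha> i" using dense[OF belowI[OF q]] by blast
      obtain n where "from_nat_into S n = i" using from_nat_into_surj[OF S r(2)] by blast
      then show ?thesis using r(3) below_P[OF r(1)] belowD[OF r(1)] by blast
    qed
  qed
  then show ?thesis using that belowI by blast
qed

lemma omega1_ordinal: "p \<in> Qf C f \<Longrightarrow> p \<tturnstile> is_ordinal omega1_name"
  by (rule represents_ordinal[OF countable_initial_segment_omega1 represents_omega1]) auto

lemma omega1_uncountable: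
  assumes p: "p \<in> Qf C f" shows "p \<tturnstile> \<^bold>\<not> is_countable omega_name omega1_name"
  unfolding forces_Neg_iff
proof (intro ballI notI)
  fix q assume q: "q \<in> below p" "q \<tturnstile> is_countable omega_name omega1_name"
  obtain r F where r: "r \<in> below q" "r \<tturnstile> is_injection F omega1_name omega_name"
    using below_P[OF q(1)] q(2) unfolding is_countable_def embeds_def by (rule forces_ExE)
  note rP = below_P[OF r(1)]
  have F: "r \<tturnstile> is_function F omega1_name omega_name" using r(2) unfolding is_injection_def by simp
  obtain s and x \<alpha> :: omega1 and n :: nat where s: "s \<in> below r" "x < \<alpha>" "s \<tturnstile> maps_to F (ck x) (ck n)" "s \<tturnstile> maps_to F (ck \<alpha>) (ck n)"
  proof (rule collision[OF rP countableI_type])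
    show "\<exists>t\<in>below s. \<exists>n\<in>UNIV :: nat set. t \<tturnstile> maps_to F (ck \<alpha>) (ck n)" if s: "s \<in> below r" for \<alpha> :: omega1 and s
    proof -
      note sP = below_P[OF s]
      obtain t and n :: nat where "t \<in> below s" "n \<in> UNIV" "t \<tturnstile> maps_to F (ck \<alpha>) (ck n)"
        using forces_mono[OF F s] representsI[OF represents_omega1[OF sP] UNIV_I] represents_omega[OF sP] sP
        by (rule function_value)
      then show ?thesis by blast
    qed
  qed
  have "s \<tturnstile> ck x \<^bold>= ck \<alpha>"
    using forces_mono[OF r(2) s(1)] s(3,4) below_refl[OF below_P[OF s(1)]]
    unfolding is_injection_def forces_Conj_iff forces_All_iff forces_Imp_iff by blast
  then show False using check_omega1_eq[OF below_P[OF s(1)]] s(2) by blast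
qed

lemma omega1_members:
  assumes "p \<in> Qf C f" "p \<tturnstile> b \<^bold>\<in> omega1_name"
  obtains q \<beta> where "q \<in> below p" "represents q ck {..<\<beta> :: omega1} b"
proof -
  obtain q and \<beta> :: omega1 where q: "q \<in> below p" "\<beta> \<in> UNIV" "q \<tturnstile> b \<^bold>= ck \<beta>"
    using represents_omega1[OF assms(1)] assms(2,1) by (rule representsE)
  have "represents q ck {..<\<beta>} b"
    using eq_sym[OF q(3)] represents_check[OF countable_initial_segment_omega1 below_P[OF q(1)]] by (rule represents_cong)
  with q(1) show ?thesis by (rule that)
qed

lemma first_uncountable:
  assumes p: "p \<in> Qf C f" shows "p \<tturnstile> is_first_uncountable omega_name omega1_name"
proof -
  have "q \<tturnstile> is_countable omega_name b" if q: "q \<in> below p" "q \<tturnstile> b \<^bold>\<in> omega1_name" for q b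
  proof (rule forces_local)
    fix q' assume q': "q' \<in> below q"
    obtain r \<beta> where r: "r \<in> below q'" "represents r ck {..<\<beta> :: omega1} b"
      using below_P[OF q'] forces_mono[OF q(2) q'] by (rule omega1_members)
    then show "\<exists>r\<in>below q'. r \<tturnstile> is_countable omega_name b"
      using countable_ordinal_embeds[OF below_P[OF r(1)] r(2)] by blast
  qed
  then show ?thesis
    unfolding is_first_uncountable_def forces_Conj_iff forces_All_iff forces_Imp_iff
    using omega1_ordinal[OF p] omega1_uncountable[OF p] by blast
qed

text \<open>Decide for each \<open>\<alpha>\<close> an element of a countable ordinal that is mapped to \<open>\<alpha>\<close>. The same element for
  two different \<open>\<alpha>\<close> contradicts single-valuedness.\<close>
lemma no_bijection_onto_omega1:
  assumes p: "p \<in> Qf C f" and b: "p \<tturnstile> b \<^bold>\<in> omega1_name" and F: "p \<tturnstile> is_bijection F b omega1_name"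
  shows False
proof -
  obtain q \<beta> where q: "q \<in> below p" "represents q ck {..<\<beta> :: omega1} b" using p b by (rule omega1_members)
  note qP = below_P[OF q(1)]
  have Fq: "q \<tturnstile> is_function F b omega1_name"
    and surj: "q \<tturnstile> (\<^bold>\<forall>y. y \<^bold>\<in> omega1_name \<^bold>\<longrightarrow> (\<^bold>\<exists>x. maps_to F x y))"
    using forces_mono[OF F q(1)] unfolding is_bijection_def is_injection_def by auto
  obtain s and x \<alpha> i :: omega1 where s: "s \<in> below q" "x < \<alpha>" "s \<tturnstile> maps_to F (ck i) (ck x)" "s \<tturnstile> maps_to F (ck i) (ck \<alpha>)"
  proof (rule collision[OF qP countable_initial_segment_omega1])
    show "\<exists>t\<in>below s. \<exists>i\<in>{..<\<beta>}. t \<tturnstile> maps_to F (ck i) (ck \<alpha>)" if s: "s \<in> below q" for \<alpha> :: omega1 and s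
    proof -
      note sP = below_P[OF s]
      have "s \<tturnstile> ck \<alpha> \<^bold>\<in> omega1_name" using representsI[OF represents_omega1[OF sP] UNIV_I] .
      then have "s \<tturnstile> (\<^bold>\<exists>x. maps_to F x (ck \<alpha>))" using surj s unfolding forces_All_iff forces_Imp_iff by blast
      with sP obtain t x where t: "t \<in> below s" "t \<tturnstile> maps_to F x (ck \<alpha>)" by (rule forces_ExE)
      have tq: "t \<in> below q" and tP: "t \<in> Qf C f" using t(1) s below_trans below_P by blast+
      obtain u i where u: "u \<in> below t" "i \<in> {..<\<beta>}" "u \<tturnstile> x \<^bold>= ck i"
        using represents_mono[OF q(2) tq] function_rel(1)[OF forces_mono[OF Fq tq] t(2) tP] tP by (rule representsE)
      have "u \<tturnstile> maps_to F (ck i) (ck \<alpha>)" using forces_mono[OF t(2) u(1)] u(3) eq_refl by (rule maps_to_cong)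
      moreover have "u \<in> below s" using u(1) t(1) by (rule below_trans)
      ultimately show ?thesis using u(2) by blast
    qed
  qed
  have "s \<tturnstile> ck x \<^bold>= ck \<alpha>" using forces_mono[OF Fq s(1)] s(3,4) below_P[OF s(1)] by (rule function_unique)
  then show False using check_omega1_eq[OF below_P[OF s(1)]] s(2) by blast
qed

lemma omega1_cardinal:
  assumes p: "p \<in> Qf C f" shows "p \<tturnstile> is_cardinal omega1_name"
proof -
  have False if asm: "q \<in> below p" "q \<tturnstile> b \<^bold>\<in> omega1_name" "r \<in> below q" "r \<tturnstile> (\<^bold>\<exists>F. is_bijection F b omega1_name)" for q b r
  proof -
    obtain s F where s: "s \<in> below r" "s \<tturnstile> is_bijection F b omega1_name"
      using below_P[OF asm(3)] asm(4) by (rule forces_ExE)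
    have "s \<tturnstile> b \<^bold>\<in> omega1_name" using forces_mono[OF asm(2) below_trans[OF s(1) asm(3)]] .
    then show False using no_bijection_onto_omega1[OF below_P[OF s(1)] _ s(2)] by blast
  qed
  then show ?thesis
    unfolding is_cardinal_def forces_Conj_iff forces_All_iff forces_Imp_iff forces_Neg_iff
    using omega1_ordinal[OF p] by blast
qed

lemma coloring_edge:
  assumes "p \<tturnstile> is_coloring F W Y K" "p \<tturnstile> e \<^bold>\<in> Y" "p \<tturnstile> is_upair e x y" "p \<tturnstile> maps_to F x k" "p \<tturnstile> maps_to F y l"
    "p \<in> Qf C f"
  shows "\<not> p \<tturnstile> k \<^bold>= l"
proof -
  have "p \<tturnstile> \<^bold>\<not> (k \<^bold>= l)"
    using assms(1-5) below_refl[OF assms(6)]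
    unfolding is_coloring_def forces_Conj_iff forces_All_iff forces_Imp_iff by blast
  then show ?thesis unfolding forces_Neg_iff using below_refl[OF assms(6)] by blast
qed

lemma no_countable_coloring:
  assumes p: "p \<in> Qf C f" and b: "p \<tturnstile> b \<^bold>\<in> omega1_name" and col: "p \<tturnstile> is_coloring F omega1_name X b"
  shows False
proof -
  obtain q \<beta> where q: "q \<in> below p" "represents q ck {..<\<beta> :: omega1} b" using p b by (rule omega1_members)
  note qP = below_P[OF q(1)]
  have Fq: "q \<tturnstile> is_function F omega1_name b" using forces_mono[OF col q(1)] unfolding is_coloring_def by simp
  obtain s and x \<alpha> i :: omega1 where s: "s \<in> below q" "{x, \<alpha>} \<in> g_of s" "s \<tturnstile> maps_to F (ck x) (ck i)" "s \<tturnstile> maps_to F (ck \<alpha>) (ck i)"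
  proof (rule collision[OF qP countable_initial_segment_omega1])
    show "\<exists>t\<in>below s. \<exists>i\<in>{..<\<beta>}. t \<tturnstile> maps_to F (ck \<alpha>) (ck i)" if s: "s \<in> below q" for \<alpha> :: omega1 and s
    proof -
      note sP = below_P[OF s]
      obtain t i where t: "t \<in> below s" "i \<in> {..<\<beta>}" "t \<tturnstile> maps_to F (ck \<alpha>) (ck i)"
        using forces_mono[OF Fq s] representsI[OF represents_omega1[OF sP] UNIV_I] represents_mono[OF q(2) s] sP
        by (rule function_value)
      then show ?thesis by blast
    qed
  qed
  note sP = below_P[OF s(1)]
  have "s \<tturnstile> is_coloring F omega1_name X b" using forces_mono[OF col below_trans[OF s(1) q(1)]] .
  from coloring_edge[OF this generic_edgeI[OF s(2) sP] edge_name_upair[OF sP] s(3,4) sP] show False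
    using eq_refl by blast
qed

text \<open>A ground model coloring gives one in the extension, provided that each edge of \<open>Y\<close> is
  decided to be some \<open>{a, b}\<close> with \<open>\<phi> a \<noteq> \<phi> b\<close>. It is used for the identity on \<open>\<omega>\<^sub>1\<close> and for finite graphs.\<close>
lemma ground_coloring:
  fixes \<phi> :: "omega1 \<Rightarrow> 'o::wellorder"
  assumes p: "p \<in> Qf C f" and cnt: "\<And>\<alpha>::'o. countable {..<\<alpha>}"
    and W: "represents p ck S W" and K: "\<And>a. a \<in> S \<Longrightarrow> p \<tturnstile> ck (\<phi> a) \<^bold>\<in> K"
    and Y: "\<And>q e. q \<in> below p \<Longrightarrow> q \<tturnstile> e \<^bold>\<in> Y \<Longrightarrow>
      \<exists>r\<in>below q. \<exists>a b. \<phi> a \<noteq> \<phi> b \<and> r \<tturnstile> e \<^bold>= edge_name {a, b}"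
  shows "p \<tturnstile> colorable W Y K"
proof -
  let ?F = "fun_name ck (\<lambda>a. ck (\<phi> a)) S"
  have S: "small S" by (rule small_UNIV_omega1)
  have F: "p \<tturnstile> is_function ?F W K"
    using S W K discrete_check[OF countable_initial_segment_omega1] p by (rule fun_name_function)
  have "q \<tturnstile> \<^bold>\<not> (k \<^bold>= l)" if q: "q \<in> below p" and e: "q \<tturnstile> e \<^bold>\<in> Y" "q \<tturnstile> is_upair e x y"
    and xk: "q \<tturnstile> maps_to ?F x k" and yl: "q \<tturnstile> maps_to ?F y l" for q e x y k l
    unfolding forces_Neg_iff
  proof (intro ballI notI)
    fix r assume r: "r \<in> below q" "r \<tturnstile> k \<^bold>= l"
    obtain s a b where s: "s \<in> below r" "\<phi> a \<noteq> \<phi> b" "s \<tturnstile> e \<^bold>= edge_name {a, b}"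
      using Y[OF below_trans[OF r(1) q] forces_mono[OF e(1) r(1)]] by blast
    have sq: "s \<in> below q" using s(1) r(1) by (rule below_trans)
    obtain t c where t: "t \<in> below s" "t \<tturnstile> x \<^bold>= ck c" "t \<tturnstile> k \<^bold>= ck (\<phi> c)"
      using forces_mono[OF xk sq] S below_P[OF s(1)] by (rule fun_name_maps_toE)
    have tq: "t \<in> below q" using t(1) sq by (rule below_trans)
    obtain u d where u: "u \<in> below t" "u \<tturnstile> y \<^bold>= ck d" "u \<tturnstile> l \<^bold>= ck (\<phi> d)"
      using forces_mono[OF yl tq] S below_P[OF t(1)] by (rule fun_name_maps_toE)
    have uq: "u \<in> below q" and us: "u \<in> below s" and ur: "u \<in> below r" and uP: "u \<in> Qf C f"
      using u(1) tq t(1) s(1) below_trans below_P by blast+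
    have "u \<tturnstile> ck (\<phi> c) \<^bold>= ck (\<phi> d)"
      using eq_trans[OF eq_trans[OF eq_sym[OF forces_mono[OF t(3) u(1)]] forces_mono[OF r(2) ur]] u(3)] .
    then have "\<phi> c = \<phi> d" using check_eq_iff[OF cnt uP] by blast
    moreover have "a = c \<and> b = d \<or> a = d \<and> b = c"
      using uP forces_mono[OF s(3) us] forces_mono[OF e(2) uq] forces_mono[OF t(2) u(1)] u(2) by (rule edge_endpoints)
    ultimately show False using s(2) by auto
  qed
  then have "p \<tturnstile> is_coloring ?F W Y K"
    unfolding is_coloring_def forces_Conj_iff forces_All_iff forces_Imp_iff using F by blast
  then show ?thesis unfolding colorable_def by (rule forces_ExI)
qed

text \<open>The identity colors the graph with \<open>\<omega>\<^sub>1\<close> colors, and every smaller ordinal is countable.\<close>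
lemma chromatic_number_omega1:
  assumes p: "p \<in> Qf C f" shows "p \<tturnstile> is_Chr omega1_name X omega1_name"
proof -
  have "p \<tturnstile> colorable omega1_name X omega1_name"
  proof (rule ground_coloring[OF p countable_initial_segment_omega1 represents_omega1[OF p]])
    show "p \<tturnstile> ck (id a) \<^bold>\<in> omega1_name" for a :: omega1 using representsI[OF represents_omega1[OF p] UNIV_I] by simp
    show "\<exists>r\<in>below q. \<exists>a b. id a \<noteq> id b \<and> r \<tturnstile> e \<^bold>= edge_name {a, b}" if asm: "q \<in> below p" "q \<tturnstile> e \<^bold>\<in> X" for q e
    proof -
      obtain r a b where "r \<in> below q" "{a, b} \<in> g_of r" "a \<noteq> b" "r \<tturnstile> e \<^bold>= edge_name {a, b}"
        using asm(2) below_P[OF asm(1)] by (rule generic_edgeE)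
      then show ?thesis by auto
    qed
  qed
  moreover have False if asm: "q \<in> below p" "q \<tturnstile> \<nu> \<^bold>\<in> omega1_name" "r \<in> below q" "r \<tturnstile> (is_cardinal \<nu> \<^bold>\<and> colorable omega1_name X \<nu>)"
    for q \<nu> r
  proof -
    have "r \<tturnstile> colorable omega1_name X \<nu>" using asm(4) by simp
    with below_P[OF asm(3)] obtain s F where s: "s \<in> below r" "s \<tturnstile> is_coloring F omega1_name X \<nu>"
      unfolding colorable_def by (rule forces_ExE)
    have "s \<tturnstile> \<nu> \<^bold>\<in> omega1_name" using forces_mono[OF asm(2) below_trans[OF s(1) asm(3)]] .
    then show False using no_countable_coloring[OF below_P[OF s(1)] _ s(2)] by blast
  qed
  ultimately show ?thesis
    unfolding is_Chr_def forces_Conj_iff forces_All_iff forces_Imp_iff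
    using omega1_cardinal[OF p] unfolding forces_Neg_iff forces_Conj_iff by blast
qed

lemma uncountably_chromatic_generic:
  assumes p: "p \<in> Qf C f" shows "p \<tturnstile> uncountably_chromatic omega_name omega1_name X"
  unfolding uncountably_chromatic_def
  by (rule forces_ExI[where x=omega1_name]) (simp add: chromatic_number_omega1[OF p] omega1_uncountable[OF p])

text \<open>For \<open>j = 0, 1, \<dots>, n - 1\<close> in turn, decide the element of \<open>W\<close> that is mapped to \<open>j\<close>, unless no stronger
  condition allows for one.\<close>
lemma decide_small_set:
  fixes n :: nat
  assumes p: "p \<in> Qf C f" and W: "p \<tturnstile> is_subset W omega1_name" and F: "p \<tturnstile> is_injection F W (ck n)"
  obtains q and w :: "omega1 set" where "q \<in> below p" "finite w" "card w \<le> n" "represents q ck w W"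
proof -
  have fn: "p \<tturnstile> is_function F W (ck n)"
    and inj: "\<And>q x x' y. q \<in> below p \<Longrightarrow> q \<tturnstile> maps_to F x y \<Longrightarrow> q \<tturnstile> maps_to F x' y \<Longrightarrow> q \<tturnstile> x \<^bold>= x'"
    using F unfolding is_injection_def forces_Conj_iff forces_All_iff forces_Imp_iff by blast+
  have "\<exists>q\<in>below p. \<exists>w :: omega1 set. finite w \<and> card w \<le> k \<and> (\<forall>a\<in>w. q \<tturnstile> ck a \<^bold>\<in> W) \<and>
      (\<forall>r\<in>below q. \<forall>x. \<forall>j<k. r \<tturnstile> x \<^bold>\<in> W \<longrightarrow> r \<tturnstile> maps_to F x (ck j) \<longrightarrow> (\<exists>s\<in>below r. \<exists>a\<in>w. s \<tturnstile> x \<^bold>= ck a))" for k :: nat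
  proof (induction k)
    case 0
    show ?case using below_refl[OF p] by (intro bexI[of _ p] exI[of _ "{}"]) auto
  next
    case (Suc k)
    then obtain q and w :: "omega1 set" where H: "q \<in> below p" "finite w" "card w \<le> k" "\<forall>a\<in>w. q \<tturnstile> ck a \<^bold>\<in> W"
      "\<forall>r\<in>below q. \<forall>x. \<forall>j<k. r \<tturnstile> x \<^bold>\<in> W \<longrightarrow> r \<tturnstile> maps_to F x (ck j) \<longrightarrow> (\<exists>s\<in>below r. \<exists>a\<in>w. s \<tturnstile> x \<^bold>= ck a)"
      by (elim bexE exE conjE) (rule that)
    note q = H(1-3) H(4)[rule_format] and w = H(5)[rule_format]
    show ?case
    proof (cases "\<exists>r\<in>below q. \<exists>x. r \<tturnstile> x \<^bold>\<in> W \<and> r \<tturnstile> maps_to F x (ck k)")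
      case False
      have "\<exists>s\<in>below r. \<exists>a\<in>w. s \<tturnstile> x \<^bold>= ck a"
        if "r \<in> below q" "j < Suc k" "r \<tturnstile> x \<^bold>\<in> W" "r \<tturnstile> maps_to F x (ck j)" for r x j
      proof -
        have "j \<noteq> k" using False that by blast
        then show ?thesis using w[OF that(1) _ that(3,4)] that(2) by simp
      qed
      then show ?thesis using q by (intro bexI[of _ q] exI[of _ w]) auto
    next
      case True
      then obtain r x where r: "r \<in> below q" "r \<tturnstile> x \<^bold>\<in> W" "r \<tturnstile> maps_to F x (ck k)" by blast
      have rp: "r \<in> below p" and rP: "r \<in> Qf C f" using r(1) q(1) below_trans below_P by blast+
      have "r \<tturnstile> x \<^bold>\<in> omega1_name" using W rp r(2) unfolding is_subset_def forces_All_iff forces_Imp_iff by blast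
      with represents_omega1[OF rP] obtain s and a :: omega1 where s: "s \<in> below r" "a \<in> UNIV" "s \<tturnstile> x \<^bold>= ck a"
        using rP by (rule representsE)
      have sq: "s \<in> below q" and sp: "s \<in> below p" using s(1) r(1) rp below_trans by blast+
      have sa: "s \<tturnstile> ck a \<^bold>\<in> W" using mem_cong_left[OF s(3) forces_mono[OF r(2) s(1)]] .
      have "\<exists>u\<in>below t. \<exists>a\<in>insert a w. u \<tturnstile> y \<^bold>= ck a"
        if t: "t \<in> below s" "j < Suc k" "t \<tturnstile> y \<^bold>\<in> W" "t \<tturnstile> maps_to F y (ck j)" for t y j
      proof (cases "j = k")
        case True
        have "t \<tturnstile> maps_to F x (ck k)" using forces_mono[OF r(3) below_trans[OF t(1) s(1)]] .
        then have "t \<tturnstile> y \<^bold>= x" using inj[OF below_trans[OF t(1) sp]] t(4) True by blast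
        then have "t \<tturnstile> y \<^bold>= ck a" using forces_mono[OF s(3) t(1)] by (rule eq_trans)
        then show ?thesis using below_refl[OF below_P[OF t(1)]] by blast
      next
        case False
        then show ?thesis using w[OF below_trans[OF t(1) sq] _ t(3,4)] t(2) by fastforce
      qed
      moreover have "\<forall>b\<in>insert a w. s \<tturnstile> ck b \<^bold>\<in> W" using sa q(4) forces_mono[OF _ sq] by blast
      moreover have "finite (insert a w)" "card (insert a w) \<le> Suc k" using q(2,3) by (auto simp: card_insert_if)
      ultimately show ?thesis using sp by (intro bexI[of _ s] exI[of _ "insert a w"]) auto
    qed
  qed
  from this[of n] obtain q and w :: "omega1 set" where H: "q \<in> below p" "finite w" "card w \<le> n" "\<forall>a\<in>w. q \<tturnstile> ck a \<^bold>\<in> W"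
    "\<forall>r\<in>below q. \<forall>x. \<forall>j<n. r \<tturnstile> x \<^bold>\<in> W \<longrightarrow> r \<tturnstile> maps_to F x (ck j) \<longrightarrow> (\<exists>s\<in>below r. \<exists>a\<in>w. s \<tturnstile> x \<^bold>= ck a)"
    by (elim bexE exE conjE) (rule that)
  note q = H(1-3) H(4)[rule_format] and w = H(5)[rule_format]
  have "\<exists>s\<in>below r. \<exists>a\<in>w. s \<tturnstile> x \<^bold>= ck a" if r: "r \<in> below q" "r \<tturnstile> x \<^bold>\<in> W" for r x
  proof -
    note rP = below_P[OF r(1)]
    obtain s j where s: "s \<in> below r" "j \<in> {..<n}" "s \<tturnstile> maps_to F x (ck j)"
      using forces_mono[OF fn below_trans[OF r(1) q(1)]] r(2) represents_check[OF countable_nat_below rP] rP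
      by (rule function_value)
    obtain t a where "t \<in> below s" "a \<in> w" "t \<tturnstile> x \<^bold>= ck a"
      using w[OF below_trans[OF s(1) r(1)] _ forces_mono[OF r(2) s(1)] s(3)] s(2) by blast
    then show ?thesis using below_trans[OF _ s(1)] by blast
  qed
  then have "represents q ck w W" unfolding represents_def using q(4) by blast
  with q(1-3) show ?thesis by (rule that)
qed

text \<open>Once \<open>w \<subseteq> s\<close>, the generic graph on \<open>w\<close> is decided, and finitely many further decisions determine
  which of its edges belong to \<open>Y\<close>.\<close>
lemma decide_edges:
  fixes w :: "omega1 set"
  assumes p: "p \<in> Qf C f" and w: "finite w" "represents p ck w W"
    and G: "p \<tturnstile> is_graph W Y" and sub: "p \<tturnstile> is_subset Y X"
  obtains q y where "q \<in> below p" "y \<subseteq> g_of q" "y \<subseteq> Pow w" "\<forall>e\<in>y. q \<tturnstile> edge_name e \<^bold>\<in> Y"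
    "\<forall>r\<in>below q. \<forall>e. r \<tturnstile> e \<^bold>\<in> Y \<longrightarrow> (\<exists>s\<in>below r. \<exists>a b. {a, b} \<in> y \<and> s \<tturnstile> e \<^bold>= edge_name {a, b})"
proof -
  obtain p1 where p1: "p1 \<in> Qf C f" "extends p1 p" "w \<subseteq> s_of p1" using extend_s[OF mono_f p w(1)] by blast
  have "finite ((\<lambda>e. edge_name e \<^bold>\<in> Y) ` Pow w)" using w(1) by simp
  from decide_finite[OF this p1(1)] obtain q where q: "q \<in> below p1"
    and dec: "\<And>e. e \<subseteq> w \<Longrightarrow> q \<tturnstile> edge_name e \<^bold>\<in> Y \<or> q \<tturnstile> \<^bold>\<not> (edge_name e \<^bold>\<in> Y)" by blast
  note qP = below_P[OF q]
  have qp: "q \<in> below p" using q belowI[OF p1(1,2)] by (rule below_trans)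
  have ws: "w \<subseteq> s_of q" using p1(3) belowD[OF q] unfolding extends_def by blast
  define y where "y = {e. e \<subseteq> w \<and> q \<tturnstile> edge_name e \<^bold>\<in> Y}"
  have inX: "r \<tturnstile> e \<^bold>\<in> X" if "r \<in> below q" "r \<tturnstile> e \<^bold>\<in> Y" for r e
    using sub below_trans[OF that(1) qp] that(2) unfolding is_subset_def forces_All_iff forces_Imp_iff by blast
  have yg: "y \<subseteq> g_of q"
  proof
    fix e assume "e \<in> y"
    then have "q \<tturnstile> edge_name e \<^bold>\<in> X" "e \<subseteq> s_of q" using inX[OF below_refl[OF qP]] ws unfolding y_def by blast+
    then show "e \<in> g_of q" using generic_edge_decided[OF _ qP] by blast
  qed
  have edges: "\<exists>s\<in>below r. \<exists>a b. {a, b} \<in> y \<and> s \<tturnstile> e \<^bold>= edge_name {a, b}"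
    if r: "r \<in> below q" "r \<tturnstile> e \<^bold>\<in> Y" for r e
  proof -
    have rp: "r \<in> below p" using r(1) qp by (rule below_trans)
    have "r \<tturnstile> (\<^bold>\<exists>x. \<^bold>\<exists>y. x \<^bold>\<in> W \<^bold>\<and> y \<^bold>\<in> W \<^bold>\<and> \<^bold>\<not> (x \<^bold>= y) \<^bold>\<and> is_upair e x y)"
      using G rp r(2) unfolding is_graph_def forces_All_iff forces_Imp_iff by blast
    with below_P[OF r(1)] obtain r1 u where r1: "r1 \<in> below r"
        "r1 \<tturnstile> (\<^bold>\<exists>y. u \<^bold>\<in> W \<^bold>\<and> y \<^bold>\<in> W \<^bold>\<and> \<^bold>\<not> (u \<^bold>= y) \<^bold>\<and> is_upair e u y)" by (rule forces_ExE)
    obtain r2 v where r2: "r2 \<in> below r1" "r2 \<tturnstile> (u \<^bold>\<in> W \<^bold>\<and> v \<^bold>\<in> W \<^bold>\<and> \<^bold>\<not> (u \<^bold>= v) \<^bold>\<and> is_upair e u v)"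
      using below_P[OF r1(1)] r1(2) by (rule forces_ExE)
    then have uv: "r2 \<tturnstile> u \<^bold>\<in> W" "r2 \<tturnstile> v \<^bold>\<in> W" "r2 \<tturnstile> is_upair e u v" by simp_all
    have r2r: "r2 \<in> below r" using r2(1) r1(1) by (rule below_trans)
    note r2p = below_trans[OF r2r rp]
    obtain r3 c where r3: "r3 \<in> below r2" "c \<in> w" "r3 \<tturnstile> u \<^bold>= ck c"
      using represents_mono[OF w(2) r2p] uv(1) below_P[OF r2(1)] by (rule representsE)
    obtain r4 d where r4: "r4 \<in> below r3" "d \<in> w" "r4 \<tturnstile> v \<^bold>= ck d"
      using represents_mono[OF w(2) below_trans[OF r3(1) r2p]] forces_mono[OF uv(2) r3(1)] below_P[OF r3(1)] by (rule representsE)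
    have r4r2: "r4 \<in> below r2" and r4r: "r4 \<in> below r" and r4q: "r4 \<in> below q"
      using r4(1) r3(1) r2r r(1) below_trans by blast+
    obtain s a b where s: "s \<in> below r4" "s \<tturnstile> e \<^bold>= edge_name {a, b}"
      using inX[OF r4q forces_mono[OF r(2) r4r]] below_P[OF r4(1)] by (rule generic_edgeE)
    have ss: "s \<in> below r2" "s \<in> below r3" "s \<in> below r" "s \<in> below q" "s \<in> Qf C f"
      using s(1) r4(1) r4r2 r4r r4q below_trans below_P by blast+
    have "a = c \<and> b = d \<or> a = d \<and> b = c"
      using ss(5) s(2) forces_mono[OF uv(3) ss(1)] forces_mono[OF r3(3) ss(2)] forces_mono[OF r4(3) s(1)] by (rule edge_endpoints)
    then have abw: "{a, b} \<subseteq> w" using r3(2) r4(2) by blast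
    have "s \<tturnstile> edge_name {a, b} \<^bold>\<in> Y" using mem_cong_left[OF s(2) forces_mono[OF r(2) ss(3)]] .
    then have "\<not> q \<tturnstile> \<^bold>\<not> (edge_name {a, b} \<^bold>\<in> Y)" using ss(4) unfolding forces_Neg_iff by blast
    then have "{a, b} \<in> y" using dec[OF abw] abw unfolding y_def by blast
    then show ?thesis using s(2) ss(3) by blast
  qed
  show ?thesis
  proof (rule that[OF qp yg])
    show "y \<subseteq> Pow w" "\<forall>e\<in>y. q \<tturnstile> edge_name e \<^bold>\<in> Y" unfolding y_def by auto
  qed (use edges in blast)
qed

text \<open>The chromatic number of the decided graph \<open>(w, y)\<close> in the ground model is at most \<open>2\<^bsup>r + 1\<^esup>\<close>. It
  is not smaller in the extension, because a coloring there is decided on \<open>w\<close> by one condition.\<close>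
lemma finite_subgraph_Chr:
  assumes p: "p \<in> Qf C f" and w: "finite w" "card w \<le> f r" "represents p ck w W"
    and y: "y \<subseteq> g_of p" "y \<subseteq> Pow w" "\<And>e. e \<in> y \<Longrightarrow> p \<tturnstile> edge_name e \<^bold>\<in> Y"
    and Y: "\<And>q e. q \<in> below p \<Longrightarrow> q \<tturnstile> e \<^bold>\<in> Y \<Longrightarrow> \<exists>s\<in>below q. \<exists>a b. {a, b} \<in> y \<and> s \<tturnstile> e \<^bold>= edge_name {a, b}"
  shows "p \<tturnstile> Chr_at_most W Y (ck ((2::nat) ^ (r + 1)))"
proof -
  define good where "good k \<longleftrightarrow> (\<exists>\<phi>. (\<forall>a\<in>w. \<phi> a < k) \<and> (\<forall>a b. {a, b} \<in> y \<longrightarrow> \<phi> a \<noteq> \<phi> b))" for k :: nat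
  define n where "n = (LEAST k. good k)"
  have "\<exists>\<phi>. (\<forall>a. \<phi> a < (2::nat) ^ (r + 1)) \<and> (\<forall>a b. {a, b} \<in> y \<longrightarrow> \<phi> a \<noteq> \<phi> b)"
    using mono_f p w(1,2) y(1) by (rule condition_coloring) (use y(2) in blast)
  then have g2: "good (2 ^ (r + 1))" unfolding good_def by blast
  have n: "good n" "n \<le> 2 ^ (r + 1)" unfolding n_def using LeastI[of good] Least_le[of good] g2 by blast+
  obtain \<phi> where \<phi>: "\<And>a. a \<in> w \<Longrightarrow> \<phi> a < n" "\<And>a b. {a, b} \<in> y \<Longrightarrow> \<phi> a \<noteq> \<phi> b" using n(1) unfolding good_def by blast
  have "p \<tturnstile> colorable W Y (ck n)"
  proof (rule ground_coloring[OF p countable_nat_below w(3)])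
    show "p \<tturnstile> ck (\<phi> a) \<^bold>\<in> ck n" if "a \<in> w" for a using check_less[OF countable_nat_below p \<phi>(1)[OF that]] .
    show "\<exists>s\<in>below q. \<exists>a b. \<phi> a \<noteq> \<phi> b \<and> s \<tturnstile> e \<^bold>= edge_name {a, b}" if "q \<in> below p" "q \<tturnstile> e \<^bold>\<in> Y" for q e
      using Y[OF that] \<phi>(2) by blast
  qed
  moreover have False if q: "q \<in> below p" "q \<tturnstile> \<nu> \<^bold>\<in> ck n" "q' \<in> below q" "q' \<tturnstile> (is_cardinal \<nu> \<^bold>\<and> colorable W Y \<nu>)" for q \<nu> q'
  proof -
    have "q' \<tturnstile> colorable W Y \<nu>" using q(4) by simp
    with below_P[OF q(3)] obtain s F where s: "s \<in> below q'" "s \<tturnstile> is_coloring F W Y \<nu>"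
      unfolding colorable_def by (rule forces_ExE)
    have sq: "s \<in> below q" and sp: "s \<in> below p" and sP: "s \<in> Qf C f"
      using s(1) q(3) q(1) below_trans below_P by blast+
    obtain t k where t: "t \<in> below s" "k \<in> {..<n}" "t \<tturnstile> \<nu> \<^bold>= ck k"
      using represents_check[OF countable_nat_below sP] forces_mono[OF q(2) sq] sP by (rule representsE)
    note tP = below_P[OF t(1)] and tp = below_trans[OF t(1) sp]
    have \<nu>: "represents t ck {..<k} \<nu>"
      using eq_sym[OF t(3)] represents_check[OF countable_nat_below tP] by (rule represents_cong)
    have F: "t \<tturnstile> is_function F W \<nu>" using forces_mono[OF s(2) t(1)] unfolding is_coloring_def by simp
    have "\<exists>u\<in>below t. \<exists>\<psi>. \<forall>a\<in>w. \<psi> a \<in> {..<k} \<and> u \<tturnstile> maps_to F (ck a) (ck (\<psi> a))"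
      by (rule function_decide[OF w(1) representsI[OF represents_mono[OF w(3) tp]] F \<nu> tP])
    then obtain u \<psi> where u: "u \<in> below t" "\<And>a. a \<in> w \<Longrightarrow> \<psi> a \<in> {..<k}" "\<And>a. a \<in> w \<Longrightarrow> u \<tturnstile> maps_to F (ck a) (ck (\<psi> a))"
      by blast
    note uP = below_P[OF u(1)]
    have "\<psi> a \<noteq> \<psi> b" if e: "{a, b} \<in> y" for a b
    proof
      assume eq: "\<psi> a = \<psi> b"
      have ab: "a \<in> w" "b \<in> w" using e y(2) by blast+
      have "u \<tturnstile> is_coloring F W Y \<nu>" using forces_mono[OF s(2) below_trans[OF u(1) t(1)]] .
      moreover have "u \<tturnstile> edge_name {a, b} \<^bold>\<in> Y" using forces_mono[OF y(3)[OF e] below_trans[OF u(1) tp]] .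
      ultimately have "\<not> u \<tturnstile> ck (\<psi> a) \<^bold>= ck (\<psi> b)"
        using edge_name_upair[OF uP] u(3)[OF ab(1)] u(3)[OF ab(2)] uP by (rule coloring_edge)
      then show False unfolding eq using eq_refl by blast
    qed
    then have "good k" unfolding good_def using u(2) by blast
    then show False using Least_le[of good k] t(2) unfolding n_def by simp
  qed
  ultimately have "p \<tturnstile> is_Chr W Y (ck n)"
    unfolding is_Chr_def forces_Conj_iff forces_All_iff forces_Imp_iff
    using finite_ordinal_is_cardinal[OF p] unfolding forces_Neg_iff forces_Conj_iff by blast
  moreover have "p \<tturnstile> (ck n \<^bold>\<in> ck ((2::nat) ^ (r + 1)) \<^bold>\<or> ck n \<^bold>= ck ((2::nat) ^ (r + 1)))"
  proof (cases "n = 2 ^ (r + 1)")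
    case True
    then show ?thesis using forces_DisjI2[OF eq_refl] by simp
  next
    case False
    then have "n < 2 ^ (r + 1)" using n(2) by simp
    from check_less[OF countable_nat_below p this] show ?thesis by (rule forces_DisjI1)
  qed
  ultimately have "p \<tturnstile> (is_Chr W Y (ck n) \<^bold>\<and> (ck n \<^bold>\<in> ck ((2::nat) ^ (r + 1)) \<^bold>\<or> ck n \<^bold>= ck ((2::nat) ^ (r + 1))))"
    by simp
  then show ?thesis unfolding Chr_at_most_def by (rule forces_ExI)
qed

lemma small_subgraph_Chr:
  assumes p: "p \<in> Qf C f" and sub: "p \<tturnstile> is_subgraph W Y omega1_name X" and emb: "p \<tturnstile> embeds W (ck (f r))"
  shows "p \<tturnstile> Chr_at_most W Y (ck ((2::nat) ^ (r + 1)))"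
proof (rule forces_local)
  fix p0 assume p0: "p0 \<in> below p"
  obtain p1 F where p1: "p1 \<in> below p0" "p1 \<tturnstile> is_injection F W (ck (f r))"
    using below_P[OF p0] forces_mono[OF emb p0] unfolding embeds_def by (rule forces_ExE)
  have p1p: "p1 \<in> below p" using p1(1) p0 by (rule below_trans)
  have S: "p \<tturnstile> is_graph W Y" "p \<tturnstile> is_subset W omega1_name" "p \<tturnstile> is_subset Y X"
    using sub unfolding is_subgraph_def by simp_all
  obtain p2 and w :: "omega1 set" where p2: "p2 \<in> below p1" "finite w" "card w \<le> f r" "represents p2 ck w W"
    using below_P[OF p1(1)] forces_mono[OF S(2) p1p] p1(2) by (rule decide_small_set)
  have p2p: "p2 \<in> below p" using p2(1) p1p by (rule below_trans)
  obtain q y where q: "q \<in> below p2" "y \<subseteq> g_of q" "y \<subseteq> Pow w" "\<forall>e\<in>y. q \<tturnstile> edge_name e \<^bold>\<in> Y"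
    "\<forall>r\<in>below q. \<forall>e. r \<tturnstile> e \<^bold>\<in> Y \<longrightarrow> (\<exists>s\<in>below r. \<exists>a b. {a, b} \<in> y \<and> s \<tturnstile> e \<^bold>= edge_name {a, b})"
    by (rule decide_edges[OF below_P[OF p2(1)] p2(2,4) forces_mono[OF S(1) p2p] forces_mono[OF S(3) p2p]])
  have "q \<tturnstile> Chr_at_most W Y (ck ((2::nat) ^ (r + 1)))"
    using below_P[OF q(1)] p2(2,3) represents_mono[OF p2(4) q(1)] q(2,3) q(4,5)[rule_format] by (rule finite_subgraph_Chr)
  moreover have "q \<in> below p0" using q(1) p2(1) p1(1) below_trans by blast
  ultimately show "\<exists>q\<in>below p0. q \<tturnstile> Chr_at_most W Y (ck ((2::nat) ^ (r + 1)))" by blast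
qed

end

theorem theorem1:
  fixes C :: "omega1 \<Rightarrow> omega1 set" and f :: "nat \<Rightarrow> nat"
    and \<iota> :: "omega1 \<Rightarrow> 'i"
    and X :: "('i, cond) name"
  assumes "club_guessing C"
    and "strict_mono f"
    and "inj \<iota>"
    and X: "X = generic_graph C f"
  shows "holds_in_extension (Qf C f) extends
           (is_first_uncountable omega_name omega1_name \<^bold>\<and>
            is_graph omega1_name X \<^bold>\<and>
            uncountably_chromatic omega_name omega1_name X)
       \<and> (\<forall>r. holds_in_extension (Qf C f) extends
           (\<^bold>\<forall>W. \<^bold>\<forall>Y. is_subgraph W Y omega1_name X \<^bold>\<and> embeds W (check_ord top_cond (f r)) \<^bold>\<longrightarrow>
              Chr_at_most W Y (check_ord top_cond ((2::nat) ^ (r + 1)))))"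
proof -
  interpret generic_extension C f \<iota> using assms(1-3) by unfold_locales
  show ?thesis
    unfolding X holds_in_extension_def forces_Conj_iff forces_All_iff forces_Imp_iff
    using first_uncountable generic_graph_is_graph uncountably_chromatic_generic small_subgraph_Chr below_P
    by blast
qed

end
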